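(* Let $X$ be a topological space. The triple $(O,A,U)$ of points of $X$, Moore paths in $X$, and null-homotopic Moore loops in $X$ with given null-homotopy, with the structure described in the context, constitutes a fair category in $\mathbf{Top}$, where the equimorphisms in $\mathbf{Top}$ are the homotopy equivalences. That is, there is a fair category $\Delta_{\mathrm{fat}}^{\mathrm{op}}\to\mathbf{Top}$ whose spaces of objects, arrows and weak identity arrows are $O$, $A$ and $U$, with the source and target maps, the map $U\to A$, and the compositions on $A$ and $U$ described in the context.
   Context: The data. $O$ is the set of points of $X$ with the discrete topology. A Moore path from $x$ to $y$ is a continuous map $\gamma:[0,r]\to X$ with $r>0$, $\gamma(0)=x$, $\gamma(r)=y$; $A(x,y)$ is the space of these, with the compact-open topology, lengths being allowed to vary (identify $A(x,y)$ with a subspace of $\mathbb R_{>0}\times\mathrm{Map}([0,1],X)$ by rescaling the domain), and $A=\coprod_{x,y\in O}A(x,y)$. Composition is concatenation: $\gamma_1\otimes\gamma_2:[0,r_1+r_2]\to X$ is $\gamma_1(t)$ for $t\le r_1$ and $\gamma_2(t-r_1)$ for $t\ge r_1$, defined when $\gamma_1(r_1)=\gamma_2(0)$. For $r>0$ let $T_r\subset\mathbb R^2$ be the closed triangle with vertices $(0,0),(0,1),(r,1)$. For $x\in O$, $U(x)$ is the space of continuous maps $\omega:T_r\to X$, $r>0$, sending the two sides from $(0,0)$ to $(0,1)$ and from $(0,0)$ to $(r,1)$ to $x$ (a null-homotopic Moore loop, namely the restriction to the top side, together with a null-homotopy), with the compact-open topology ($r$ varying; identify with a subspace of $\mathbb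 R_{>0}\times\mathrm{Map}(T_1,X)$ by rescaling the horizontal coordinate). $U=\coprod_{x\in O}U(x)$; both maps $U\to O$ send $\omega\in U(x)$ to $x$. The map $U\to A$ restricts $\omega$ to the top side of $T_r$ (identified with $[0,r]$). Composition in $U(x)$: $\omega_1\otimes\omega_2:T_{r_1+r_2}\to X$ sends $v$ to $\omega_1(v)$ if $v\in T_{r_1}$, and to $\omega_2\left(\begin{pmatrix}1&-r_1\\0&1\end{pmatrix}v\right)$ if $v\notin T_{r_1}$. Fat delta. Let $\Delta$ be the category of nonempty finite ordinals $\mathbf n=\{0\le\dots\le n\}$. Objects of $\Delta_{\mathrm{fat}}$ are the epimorphisms $e:\mathbf m\twoheadrightarrow\mathbf k$ of $\Delta$; an arrow from $e$ to $e':\mathbf m'\twoheadrightarrow\mathbf k'$ is a pair $(f,g)$ with $f:\mathbf m\to\mathbf m'$ a monomorphism in $\Delta$, $g:\mathbf k\to\mathbf k'$ in $\Delta$, and $ge=e'f$. Vertical arrows are those with $g$ an identity. An object is pictured as a column of $m+1$ dots, consecutive dots being linked when they have the same image under $e$. Write $\bullet=(\mathbf 0\twoheadrightarrow\mathbf 0)$, $\bullet\,\bullet=(\mathrm{id}:\mathbf 1\to\mathbf 1)$ and $\bullet\!\!-\!\!\bullet=(\mathbf 1\twoheadrightarrow\mathbf 0)$. $m\dotplus n$ is the pushout of $m\leftarrow\bullet\to n$ with $\bullet$ included as last dot of $m$ and first dot of $n$. A fair category in $\mathbf{Top}$ is a functor $Y:\Delta_{\mathrm{fat}}^{\mathrm{op}}\to\mathbf{Top}$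 sending vertical arrows to homotopy equivalences, with $Y_\bullet$ a discrete space, and such that each canonical map $Y_{m\dotplus n}\to Y_m\times_{Y_\bullet}Y_n$ is an isomorphism. Its space of objects is $Y_\bullet$, of arrows $Y_{\bullet\,\bullet}$, of weak identity arrows $Y_{\bullet\!-\!\bullet}$. The images of the two arrows $\bullet\to\bullet\,\bullet$ (first dot, last dot) are source and target, the image of the arrow $\bullet\,\bullet\to\bullet\!\!-\!\!\bullet$ is the map from weak identity arrows to arrows, and the images of the endpoint inclusions of $\bullet\,\bullet$ into $\bullet\,\bullet\dotplus\bullet\,\bullet$, and of $\bullet\!\!-\!\!\bullet$ into $\bullet\!\!-\!\!\bullet\dotplus\bullet\!\!-\!\!\bullet$, are the composition maps on arrows and on weak identity arrows. *)

theory Defs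
  imports "HOL-Analysis.Analysis" "HOL-Library.FuncSet"
begin

section \<open>The fat delta category\<close>

text \<open>The ordinal \<open>n\<close> has the elements \<open>0, \<dots>, n\<close>. Morphisms are extensional, so that equality of
  morphisms is equality in HOL.\<close>

definition delta_hom :: "nat \<Rightarrow> nat \<Rightarrow> (nat \<Rightarrow> nat) set" where
  "delta_hom m n = {f \<in> {..m} \<rightarrow>\<^sub>E {..n}. mono_on {..m} f}"

definition delta_mono :: "nat \<Rightarrow> nat \<Rightarrow> (nat \<Rightarrow> nat) \<Rightarrow> bool" where
  "delta_mono m n f \<longleftrightarrow> f \<in> delta_hom m n \<and> inj_on f {..m}"

definition delta_epi :: "nat \<Rightarrow> nat \<Rightarrow> (nat \<Rightarrow> nat) \<Rightarrow> bool" where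
  "delta_epi m n f \<longleftrightarrow> f \<in> delta_hom m n \<and> f ` {..m} = {..n}"

lemma delta_mono_iff_cancel:
  assumes "f \<in> delta_hom m n"
  shows "delta_mono m n f \<longleftrightarrow>
    (\<forall>l. \<forall>a\<in>delta_hom l m. \<forall>b\<in>delta_hom l m. compose {..l} f a = compose {..l} f b \<longrightarrow> a = b)"
    (is "_ \<longleftrightarrow> ?cancel")
proof
  assume f: "delta_mono m n f"
  show ?cancel
  proof (intro allI ballI impI)
    fix l a b
    assume a: "a \<in> delta_hom l m" and b: "b \<in> delta_hom l m"
      and eq: "compose {..l} f a = compose {..l} f b"
    have "a i = b i" if "i \<in> {..l}" for i
    proof -
      have "f (a i) = f (b i)" using fun_cong[OF eq, of i] that by (simp add: compose_def)
      moreover have "a i \<in> {..m}" "b i \<in> {..m}"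
        using a b that unfolding delta_hom_def by (auto dest!: PiE_mem)
      ultimately show ?thesis using f unfolding delta_mono_def inj_on_def by blast
    qed
    then show "a = b" using a b unfolding delta_hom_def by (auto intro: PiE_ext)
  qed
next
  assume c: ?cancel
  have "i = j" if i: "i \<le> m" and j: "j \<le> m" and eq: "f i = f j" for i j
  proof -
    let ?a = "\<lambda>x\<in>{..0::nat}. i" and ?b = "\<lambda>x\<in>{..0::nat}. j"
    have "?a \<in> delta_hom 0 m" "?b \<in> delta_hom 0 m"
      using i j by (auto simp: delta_hom_def mono_on_def)
    moreover have "compose {..0} f ?a = compose {..0} f ?b"
      using eq by (auto simp: compose_def)
    ultimately have "?a = ?b" using c by blast
    then show ?thesis by (auto dest: fun_cong[of _ _ 0])
  qed
  then show "delta_mono m n f" using assms unfolding delta_mono_def inj_on_def by simp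
qed

lemma delta_epi_iff_cancel:
  assumes "f \<in> delta_hom m n"
  shows "delta_epi m n f \<longleftrightarrow>
    (\<forall>l. \<forall>a\<in>delta_hom n l. \<forall>b\<in>delta_hom n l. compose {..m} a f = compose {..m} b f \<longrightarrow> a = b)"
    (is "_ \<longleftrightarrow> ?cancel")
proof
  assume f: "delta_epi m n f"
  show ?cancel
  proof (intro allI ballI impI)
    fix l a b
    assume a: "a \<in> delta_hom n l" and b: "b \<in> delta_hom n l"
      and eq: "compose {..m} a f = compose {..m} b f"
    have "a j = b j" if j: "j \<in> {..n}" for j
    proof -
      from f j obtain i where i: "i \<in> {..m}" "j = f i" unfolding delta_epi_def by blast
      then show ?thesis using fun_cong[OF eq, of i] by (simp add: compose_def)
    qed
    then show "a = b" using a b unfolding delta_hom_def by (auto intro: PiE_ext)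
  qed
next
  assume c: ?cancel
  have "j \<in> f ` {..m}" if j: "j \<le> n" for j
  proof (rule ccontr)
    assume nj: "j \<notin> f ` {..m}"
    let ?a = "\<lambda>x\<in>{..n}. if x \<le> j then 0 else 1::nat"
    let ?b = "\<lambda>x\<in>{..n}. if x < j then 0 else 1::nat"
    have "?a \<in> delta_hom n 1" "?b \<in> delta_hom n 1"
      by (auto simp: delta_hom_def mono_on_def)
    moreover have "compose {..m} ?a f = compose {..m} ?b f"
      using nj by (auto simp: compose_def fun_eq_iff restrict_def image_iff)
    ultimately have "?a = ?b" using c by blast
    then show False using j by (auto dest: fun_cong[of _ _ j])
  qed
  moreover have "f ` {..m} \<subseteq> {..n}" using assms unfolding delta_hom_def by (auto dest!: PiE_mem)
  ultimately show "delta_epi m n f" using assms unfolding delta_epi_def by auto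
qed

datatype fat_obj = Fat_Obj (dots: nat) (cols: nat) (proj: "nat \<Rightarrow> nat")

definition is_fat_obj :: "fat_obj \<Rightarrow> bool" where
  "is_fat_obj e \<longleftrightarrow> delta_epi (dots e) (cols e) (proj e)"

datatype fat_arr =
  Fat_Arr (fdom: fat_obj) (fcod: fat_obj) (fmap: "nat \<Rightarrow> nat") (gmap: "nat \<Rightarrow> nat")

definition is_fat_arr :: "fat_arr \<Rightarrow> bool" where
  "is_fat_arr a \<longleftrightarrow> is_fat_obj (fdom a) \<and> is_fat_obj (fcod a) \<and>
     delta_mono (dots (fdom a)) (dots (fcod a)) (fmap a) \<and>
     gmap a \<in> delta_hom (cols (fdom a)) (cols (fcod a)) \<and>
     compose {..dots (fdom a)} (gmap a) (proj (fdom a)) =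
       compose {..dots (fdom a)} (proj (fcod a)) (fmap a)"

definition fat_arrow :: "fat_obj \<Rightarrow> fat_obj \<Rightarrow> (nat \<Rightarrow> nat) \<Rightarrow> (nat \<Rightarrow> nat) \<Rightarrow> fat_arr" where
  "fat_arrow e e' f g = Fat_Arr e e' (restrict f {..dots e}) (restrict g {..cols e})"

definition fat_id :: "fat_obj \<Rightarrow> fat_arr" where
  "fat_id e = fat_arrow e e (\<lambda>i. i) (\<lambda>j. j)"

text \<open>\<open>fat_comp b a\<close> is \<open>b\<close> after \<open>a\<close>, meaningful when \<open>fcod a = fdom b\<close>.\<close>

definition fat_comp :: "fat_arr \<Rightarrow> fat_arr \<Rightarrow> fat_arr" where
  "fat_comp b a = fat_arrow (fdom a) (fcod b) (fmap b \<circ> fmap a) (gmap b \<circ> gmap a)"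

definition is_vertical :: "fat_arr \<Rightarrow> bool" where
  "is_vertical a \<longleftrightarrow> is_fat_arr a \<and> cols (fdom a) = cols (fcod a) \<and>
     gmap a = restrict (\<lambda>j. j) {..cols (fdom a)}"

text \<open>\<open>fat_dot\<close>, \<open>fat_edge\<close> and \<open>fat_link\<close> are pictured as one dot, two unlinked dots and two
  linked dots.\<close>

definition fat_dot :: fat_obj where
  "fat_dot = Fat_Obj 0 0 (\<lambda>i\<in>{..0}. i)"

definition fat_edge :: fat_obj where
  "fat_edge = Fat_Obj 1 1 (\<lambda>i\<in>{..1}. i)"

definition fat_link :: fat_obj where
  "fat_link = Fat_Obj 1 0 (\<lambda>i\<in>{..1}. 0)"

definition first_dot :: "fat_obj \<Rightarrow> fat_arr" where
  "first_dot e = fat_arrow fat_dot e (\<lambda>_. 0) (\<lambda>_. 0)"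

definition last_dot :: "fat_obj \<Rightarrow> fat_arr" where
  "last_dot e = fat_arrow fat_dot e (\<lambda>_. dots e) (\<lambda>_. cols e)"

definition edge_to_link :: fat_arr where
  "edge_to_link = fat_arrow fat_edge fat_link (\<lambda>i. i) (\<lambda>_. 0)"

definition fat_sum :: "fat_obj \<Rightarrow> fat_obj \<Rightarrow> fat_obj" (infixl \<open>\<dotplus>\<close> 65) where
  "m \<dotplus> n = Fat_Obj (dots m + dots n) (cols m + cols n)
     (\<lambda>i\<in>{..dots m + dots n}. if i \<le> dots m then proj m i else cols m + proj n (i - dots m))"

definition sum_left :: "fat_obj \<Rightarrow> fat_obj \<Rightarrow> fat_arr" where
  "sum_left m n = fat_arrow m (m \<dotplus> n) (\<lambda>i. i) (\<lambda>j. j)"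

definition sum_right :: "fat_obj \<Rightarrow> fat_obj \<Rightarrow> fat_arr" where
  "sum_right m n = fat_arrow n (m \<dotplus> n) (\<lambda>i. dots m + i) (\<lambda>j. cols m + j)"

definition edge_ends :: fat_arr where
  "edge_ends = fat_arrow fat_edge (fat_edge \<dotplus> fat_edge) (\<lambda>i. 2 * i) (\<lambda>j. 2 * j)"

definition link_ends :: fat_arr where
  "link_ends = fat_arrow fat_link (fat_link \<dotplus> fat_link) (\<lambda>i. 2 * i) (\<lambda>j. j)"


lemma fat_objD:
  assumes "is_fat_obj e"
  shows "\<And>i. i \<le> dots e \<Longrightarrow> proj e i \<le> cols e"
    and "\<And>i j. i \<le> j \<Longrightarrow> j \<le> dots e \<Longrightarrow> proj e i \<le> proj e j"
    and "\<And>j. j \<le> cols e \<Longrightarrow> \<exists>i\<le>dots e. proj e i = j"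
    and "proj e 0 = 0" and "proj e (dots e) = cols e" and "proj e \<in> extensional {..dots e}"
proof -
  have hom: "proj e \<in> {..dots e} \<rightarrow>\<^sub>E {..cols e}" "mono_on {..dots e} (proj e)"
    and im: "proj e ` {..dots e} = {..cols e}"
    using assms by (auto simp: is_fat_obj_def delta_epi_def delta_hom_def)
  show 1: "\<And>i. i \<le> dots e \<Longrightarrow> proj e i \<le> cols e" using hom(1) by (auto dest!: PiE_mem)
  show 2: "\<And>i j. i \<le> j \<Longrightarrow> j \<le> dots e \<Longrightarrow> proj e i \<le> proj e j"
    using hom(2) by (auto simp: mono_on_def)
  show 3: "\<exists>i\<le>dots e. proj e i = j" if "j \<le> cols e" for j
  proof -
    have "j \<in> proj e ` {..dots e}" using im that by simp
    then show ?thesis by auto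
  qed
  show "proj e 0 = 0" using 3[of 0] 2[of 0] by fastforce
  show "proj e (dots e) = cols e" using 3[of "cols e"] 2[of _ "dots e"] 1[of "dots e"] by fastforce
  show "proj e \<in> extensional {..dots e}" using hom(1) by (simp add: PiE_def)
qed

lemma is_fat_objI:
  assumes "\<And>i. i \<le> dots e \<Longrightarrow> proj e i \<le> cols e"
    and "\<And>i j. i \<le> j \<Longrightarrow> j \<le> dots e \<Longrightarrow> proj e i \<le> proj e j"
    and "\<And>j. j \<le> cols e \<Longrightarrow> \<exists>i\<le>dots e. proj e i = j"
    and "proj e \<in> extensional {..dots e}"
  shows "is_fat_obj e"
  using assms unfolding is_fat_obj_def delta_epi_def delta_hom_def PiE_def
  by (fastforce simp: mono_on_def image_iff)

lemma is_fat_arr_iff: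
  "is_fat_arr a \<longleftrightarrow> is_fat_obj (fdom a) \<and> is_fat_obj (fcod a) \<and>
     fmap a \<in> extensional {..dots (fdom a)} \<and> gmap a \<in> extensional {..cols (fdom a)} \<and>
     (\<forall>i\<le>dots (fdom a). fmap a i \<le> dots (fcod a)) \<and>
     (\<forall>j\<le>dots (fdom a). \<forall>i<j. fmap a i < fmap a j) \<and>
     (\<forall>i\<le>cols (fdom a). gmap a i \<le> cols (fcod a)) \<and>
     (\<forall>j\<le>cols (fdom a). \<forall>i\<le>j. gmap a i \<le> gmap a j) \<and>
     (\<forall>i\<le>dots (fdom a). gmap a (proj (fdom a) i) = proj (fcod a) (fmap a i))"
proof -
  have "delta_mono m n f \<longleftrightarrow> f \<in> extensional {..m} \<and> (\<forall>i\<le>m. f i \<le> n) \<and> (\<forall>j\<le>m. \<forall>i<j. f i < f j)"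
    for m n f
  proof -
    have "mono_on {..m} f \<and> inj_on f {..m} \<longleftrightarrow> (\<forall>j\<le>m. \<forall>i<j. f i < f j)"
    proof -
      have "mono_on {..m} f \<and> inj_on f {..m} \<longleftrightarrow> strict_mono_on {..m} f"
        by (auto simp: strict_mono_iff_mono strict_mono_on_imp_mono_on strict_mono_on_imp_inj_on
            mono_on_def inj_on_def strict_mono_on_def order_less_le)
      also have "\<dots> \<longleftrightarrow> (\<forall>j\<le>m. \<forall>i<j. f i < f j)"
        by (auto simp: strict_mono_on_def)
      finally show ?thesis .
    qed
    then show ?thesis by (auto simp: delta_mono_def delta_hom_def PiE_def)
  qed
  moreover have "g \<in> delta_hom m n \<longleftrightarrow>
      g \<in> extensional {..m} \<and> (\<forall>i\<le>m. g i \<le> n) \<and> (\<forall>j\<le>m. \<forall>i\<le>j. g i \<le> g j)" for m n g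
    by (auto simp: delta_hom_def PiE_def mono_on_def)
  moreover have "compose {..m} g e = compose {..m} e' f \<longleftrightarrow> (\<forall>i\<le>m. g (e i) = e' (f i))"
    for m and g e e' f :: "nat \<Rightarrow> nat"
    by (auto simp: compose_def fun_eq_iff restrict_def)
  ultimately show ?thesis unfolding is_fat_arr_def by auto
qed

lemma fat_arrow_simps [simp]:
  "fdom (fat_arrow e e' f g) = e" "fcod (fat_arrow e e' f g) = e'"
  "fmap (fat_arrow e e' f g) = restrict f {..dots e}"
  "gmap (fat_arrow e e' f g) = restrict g {..cols e}"
  by (simp_all add: fat_arrow_def)

lemma fat_sum_simps [simp]:
  "dots (m \<dotplus> n) = dots m + dots n" "cols (m \<dotplus> n) = cols m + cols n"
  by (simp_all add: fat_sum_def)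

lemma proj_fat_sum:
  "i \<le> dots m \<Longrightarrow> proj (m \<dotplus> n) i = proj m i"
  "is_fat_obj m \<Longrightarrow> is_fat_obj n \<Longrightarrow> i \<le> dots n \<Longrightarrow> proj (m \<dotplus> n) (dots m + i) = cols m + proj n i"
  by (auto simp: fat_sum_def fat_objD)

lemma le_sum_cases:
  fixes i a b :: nat
  assumes "i \<le> a + b"
  obtains "i \<le> a" | k where "i = a + k" "k \<le> b" "0 < k"
  by (metis add_le_cancel_left assms le_Suc_ex linorder_not_less nat_less_le add_0_right gr0I nle_le)

lemma is_fat_obj_sum:
  assumes m: "is_fat_obj m" and n: "is_fat_obj n"
  shows "is_fat_obj (m \<dotplus> n)"
proof (rule is_fat_objI)
  fix i assume "i \<le> dots (m \<dotplus> n)"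
  then have "i \<le> dots m + dots n" by simp
  then show "proj (m \<dotplus> n) i \<le> cols (m \<dotplus> n)"
    by (cases rule: le_sum_cases)
      (use fat_objD(1)[OF m] fat_objD(1)[OF n] in \<open>auto simp: proj_fat_sum m n intro: trans_le_add1\<close>)
next
  fix i j assume ij: "i \<le> j" "j \<le> dots (m \<dotplus> n)"
  then have j: "j \<le> dots m + dots n" by simp
  then show "proj (m \<dotplus> n) i \<le> proj (m \<dotplus> n) j"
  proof (cases rule: le_sum_cases)
    case 1
    then show ?thesis using ij fat_objD(2)[OF m] by (simp add: proj_fat_sum)
  next
    case (2 k)
    have "i \<le> dots m + dots n" using ij j by simp
    then show ?thesis
    proof (cases rule: le_sum_cases)
      case 1
      then show ?thesis using 2 fat_objD(1)[OF m] by (simp add: proj_fat_sum m n trans_le_add1)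
    next
      case (2 l)
      then show ?thesis using \<open>j = dots m + k\<close> \<open>k \<le> dots n\<close> ij fat_objD(2)[OF n]
        by (simp add: proj_fat_sum m n)
    qed
  qed
next
  fix j assume "j \<le> cols (m \<dotplus> n)"
  then have "j \<le> cols m + cols n" by simp
  then show "\<exists>i\<le>dots (m \<dotplus> n). proj (m \<dotplus> n) i = j"
  proof (cases rule: le_sum_cases)
    case 1
    then obtain i where "i \<le> dots m" "proj m i = j" using fat_objD(3)[OF m] by blast
    then show ?thesis by (intro exI[of _ i]) (simp add: proj_fat_sum)
  next
    case (2 k)
    then obtain i where "i \<le> dots n" "proj n i = k" using fat_objD(3)[OF n] by blast
    then show ?thesis using 2 by (intro exI[of _ "dots m + i"]) (simp add: proj_fat_sum m n)
  qed
next
  show "proj (m \<dotplus> n) \<in> extensional {..dots (m \<dotplus> n)}" by (simp add: fat_sum_def)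
qed

text \<open>\<open>m \<dotplus> n\<close> is the pushout that glues the last dot of \<open>m\<close> to the first dot of \<open>n\<close>.\<close>

lemma fat_sum_cocone:
  assumes m: "is_fat_obj m" and n: "is_fat_obj n"
  shows "is_fat_arr (sum_left m n)" "is_fat_arr (sum_right m n)"
    "fat_comp (sum_left m n) (last_dot m) = fat_comp (sum_right m n) (first_dot n)"
proof -
  show "is_fat_arr (sum_left m n)" "is_fat_arr (sum_right m n)"
    using fat_objD(1)[OF m] fat_objD(1)[OF n]
    by (auto simp: is_fat_arr_iff sum_left_def sum_right_def m n is_fat_obj_sum proj_fat_sum)
  show "fat_comp (sum_left m n) (last_dot m) = fat_comp (sum_right m n) (first_dot n)"
    by (auto simp: fat_comp_def sum_left_def sum_right_def last_dot_def first_dot_def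
        fat_arrow_def fat_dot_def fun_eq_iff)
qed

lemma fat_sum_universal:
  assumes m: "is_fat_obj m" and n: "is_fat_obj n"
    and a: "is_fat_arr a" "fdom a = m" "fcod a = e" and b: "is_fat_arr b" "fdom b = n" "fcod b = e"
    and ab: "fat_comp a (last_dot m) = fat_comp b (first_dot n)"
  shows "\<exists>!c. is_fat_arr c \<and> fdom c = m \<dotplus> n \<and> fcod c = e \<and>
           fat_comp c (sum_left m n) = a \<and> fat_comp c (sum_right m n) = b"
proof -
  have a': "is_fat_obj e" "fmap a \<in> extensional {..dots m}" "gmap a \<in> extensional {..cols m}"
      "\<And>i. i \<le> dots m \<Longrightarrow> fmap a i \<le> dots e"
      "\<And>i j. j \<le> dots m \<Longrightarrow> i < j \<Longrightarrow> fmap a i < fmap a j"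
      "\<And>i. i \<le> cols m \<Longrightarrow> gmap a i \<le> cols e"
      "\<And>i j. j \<le> cols m \<Longrightarrow> i \<le> j \<Longrightarrow> gmap a i \<le> gmap a j"
      "\<And>i. i \<le> dots m \<Longrightarrow> gmap a (proj m i) = proj e (fmap a i)"
    using a(1) unfolding is_fat_arr_iff a(2,3) by auto
  have b': "fmap b \<in> extensional {..dots n}" "gmap b \<in> extensional {..cols n}"
      "\<And>i. i \<le> dots n \<Longrightarrow> fmap b i \<le> dots e"
      "\<And>i j. j \<le> dots n \<Longrightarrow> i < j \<Longrightarrow> fmap b i < fmap b j"
      "\<And>i. i \<le> cols n \<Longrightarrow> gmap b i \<le> cols e"
      "\<And>i j. j \<le> cols n \<Longrightarrow> i \<le> j \<Longrightarrow> gmap b i \<le> gmap b j"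
      "\<And>i. i \<le> dots n \<Longrightarrow> gmap b (proj n i) = proj e (fmap b i)"
    using b(1) unfolding is_fat_arr_iff b(2,3) by auto
  have f0: "fmap a (dots m) = fmap b 0" and g0: "gmap a (cols m) = gmap b 0"
    using arg_cong[OF ab, of "\<lambda>c. fmap c 0"] arg_cong[OF ab, of "\<lambda>c. gmap c 0"]
    by (simp_all add: fat_comp_def last_dot_def first_dot_def fat_dot_def)
  define f where "f = (\<lambda>i. if i \<le> dots m then fmap a i else fmap b (i - dots m))"
  define g where "g = (\<lambda>j. if j \<le> cols m then gmap a j else gmap b (j - cols m))"
  have f1: "f i = fmap a i" if "i \<le> dots m" for i using that by (simp add: f_def)
  have f2: "f (dots m + i) = fmap b i" for i using f0 by (simp add: f_def)
  have g1: "g i = gmap a i" if "i \<le> cols m" for i using that by (simp add: g_def)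
  have g2: "g (cols m + i) = gmap b i" for i using g0 by (simp add: g_def)
  let ?c = "fat_arrow (m \<dotplus> n) e f g"
  have arr: "is_fat_arr ?c"
  proof -
    have fb: "f i \<le> dots e" if "i \<le> dots m + dots n" for i
      using that by (cases rule: le_sum_cases) (auto simp: f1 f2 a' b')
    have gb: "g i \<le> cols e" if "i \<le> cols m + cols n" for i
      using that by (cases rule: le_sum_cases) (auto simp: g1 g2 a' b')
    have fm: "f i < f j" if j: "j \<le> dots m + dots n" and ij: "i < j" for i j
      using j
    proof (cases rule: le_sum_cases)
      case 1
      then show ?thesis using ij by (simp add: f1 a')
    next
      case (2 k)
      have "i \<le> dots m + dots n" using j ij by simp
      then show ?thesis
      proof (cases rule: le_sum_cases)
        case 1
        have "f i \<le> fmap a (dots m)" using 1 a'(5)[of "dots m" i] by (cases "i = dots m") (auto simp: f1)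
        also have "\<dots> < fmap b k" using f0 2 b'(4) by simp
        finally show ?thesis using 2 f2 by simp
      next
        case l: (2 l)
        then show ?thesis using 2 ij b'(4) f2 by simp
      qed
    qed
    have gm: "g i \<le> g j" if j: "j \<le> cols m + cols n" and ij: "i \<le> j" for i j
      using j
    proof (cases rule: le_sum_cases)
      case 1
      then show ?thesis using ij by (simp add: g1 a')
    next
      case (2 k)
      have "i \<le> cols m + cols n" using j ij by simp
      then show ?thesis
      proof (cases rule: le_sum_cases)
        case 1
        have "g i \<le> gmap a (cols m)" using 1 a'(7) by (simp add: g1)
        also have "\<dots> \<le> gmap b k" using g0 2 b'(6) by simp
        finally show ?thesis using 2 g2 by simp
      next
        case l: (2 l)
        then show ?thesis using 2 ij b'(6) g2 by simp
      qed
    qed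
    have sq: "g (proj (m \<dotplus> n) i) = proj e (f i)" if "i \<le> dots m + dots n" for i
      using that
      by (cases rule: le_sum_cases) (auto simp: f1 f2 g1 g2 proj_fat_sum m n a' b' fat_objD(1))
    have "proj (m \<dotplus> n) i \<le> cols m + cols n" if "i \<le> dots m + dots n" for i
      using fat_objD(1)[OF is_fat_obj_sum[OF m n]] that by simp
    then show ?thesis
      unfolding is_fat_arr_iff
      by (intro conjI allI impI) (simp_all add: is_fat_obj_sum m n a'(1) fb gb fm gm sq)
  qed
  have left: "fat_comp ?c (sum_left m n) = a"
  proof -
    have "fat_comp ?c (sum_left m n) = Fat_Arr m e (fmap a) (gmap a)"
      unfolding fat_comp_def sum_left_def fat_arrow_def using a'(2,3)
      by (auto simp: f1 g1 fun_eq_iff restrict_def extensional_def)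
    then show ?thesis using a(2,3) by (cases a) simp
  qed
  have right: "fat_comp ?c (sum_right m n) = b"
  proof -
    have "fat_comp ?c (sum_right m n) = Fat_Arr n e (fmap b) (gmap b)"
      unfolding fat_comp_def sum_right_def fat_arrow_def using b'(1,2)
      by (auto simp: f2 g2 fun_eq_iff restrict_def extensional_def)
    then show ?thesis using b(2,3) by (cases b) simp
  qed
  have uniq: "c = ?c"
    if c: "is_fat_arr c" "fdom c = m \<dotplus> n" "fcod c = e"
      "fat_comp c (sum_left m n) = a" "fat_comp c (sum_right m n) = b" for c
  proof -
    have F: "fmap c i = f i" if "i \<le> dots m + dots n" for i
      using that
    proof (cases rule: le_sum_cases)
      case 1
      then show ?thesis unfolding f1[OF 1] c(4)[symmetric] by (simp add: fat_comp_def sum_left_def)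
    next
      case (2 k)
      then show ?thesis unfolding 2(1) f2 c(5)[symmetric] by (simp add: fat_comp_def sum_right_def)
    qed
    have G: "gmap c i = g i" if "i \<le> cols m + cols n" for i
      using that
    proof (cases rule: le_sum_cases)
      case 1
      then show ?thesis unfolding g1[OF 1] c(4)[symmetric] by (simp add: fat_comp_def sum_left_def)
    next
      case (2 k)
      then show ?thesis unfolding 2(1) g2 c(5)[symmetric] by (simp add: fat_comp_def sum_right_def)
    qed
    have "fmap c \<in> extensional {..dots m + dots n}" "gmap c \<in> extensional {..cols m + cols n}"
      using c(1,2) by (auto simp: is_fat_arr_iff)
    then have "fmap c = restrict f {..dots m + dots n}" "gmap c = restrict g {..cols m + cols n}"
      using F G by (auto simp: fun_eq_iff restrict_def extensional_def)
    then show ?thesis using c(2,3) unfolding fat_arrow_def by (cases c) simp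
  qed
  show ?thesis
    by (rule ex1I[of _ ?c]) (intro conjI arr left right fat_arrow_simps(1,2), elim conjE, rule uniq)
qed

lemma fat_shapes:
  "is_fat_obj fat_dot" "is_fat_obj fat_edge" "is_fat_obj fat_link"
  by (auto intro!: is_fat_objI simp: fat_dot_def fat_edge_def fat_link_def)

lemma fat_shape_arrows:
  "is_fat_obj e \<Longrightarrow> is_fat_arr (first_dot e)" "is_fat_obj e \<Longrightarrow> is_fat_arr (last_dot e)"
  "is_fat_arr edge_to_link" "is_fat_arr edge_ends" "is_fat_arr link_ends"
proof -
  show "is_fat_arr (first_dot e)" "is_fat_arr (last_dot e)" if "is_fat_obj e"
    using fat_shapes fat_objD[OF that] that
    by (auto simp: is_fat_arr_iff first_dot_def last_dot_def fat_dot_def)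
  show "is_fat_arr edge_to_link"
    using fat_shapes by (auto simp: is_fat_arr_iff edge_to_link_def fat_edge_def fat_link_def)
  have ones: "(\<forall>i\<le>Suc 0. P i) \<longleftrightarrow> P 0 \<and> P 1" "(\<forall>i<Suc 0. P i) \<longleftrightarrow> P 0" for P
    by (auto simp: le_Suc_eq)
  have *: "is_fat_obj (fat_edge \<dotplus> fat_edge)" "is_fat_obj (fat_link \<dotplus> fat_link)"
    using fat_shapes is_fat_obj_sum by blast+
  show "is_fat_arr edge_ends"
    using fat_shapes(2) *(1) unfolding is_fat_arr_iff edge_ends_def
    by (simp add: fat_sum_def) (simp add: fat_edge_def ones)
  show "is_fat_arr link_ends"
    using fat_shapes(3) *(2) unfolding is_fat_arr_iff link_ends_def
    by (simp add: fat_sum_def) (simp add: fat_link_def ones)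
qed

lemma is_fat_arr_id: "is_fat_obj e \<Longrightarrow> is_fat_arr (fat_id e)"
  by (auto simp: is_fat_arr_iff fat_id_def fat_objD)

lemma is_fat_arr_comp:
  assumes "is_fat_arr a" "is_fat_arr b" "fcod a = fdom b"
  shows "is_fat_arr (fat_comp b a)"
proof -
  define d e where "d = fdom a" and "e = fdom b"
  have a: "is_fat_obj d" "\<And>i. i \<le> dots d \<Longrightarrow> fmap a i \<le> dots e"
    "\<And>i j. j \<le> dots d \<Longrightarrow> i < j \<Longrightarrow> fmap a i < fmap a j" "\<And>i. i \<le> cols d \<Longrightarrow> gmap a i \<le> cols e"
    "\<And>i j. j \<le> cols d \<Longrightarrow> i \<le> j \<Longrightarrow> gmap a i \<le> gmap a j"
    "\<And>i. i \<le> dots d \<Longrightarrow> gmap a (proj d i) = proj e (fmap a i)"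
    using assms(1) unfolding is_fat_arr_iff d_def e_def assms(3) by auto
  have b: "is_fat_obj (fcod b)" "\<And>i. i \<le> dots e \<Longrightarrow> fmap b i \<le> dots (fcod b)"
    "\<And>i j. j \<le> dots e \<Longrightarrow> i < j \<Longrightarrow> fmap b i < fmap b j"
    "\<And>i. i \<le> cols e \<Longrightarrow> gmap b i \<le> cols (fcod b)"
    "\<And>i j. j \<le> cols e \<Longrightarrow> i \<le> j \<Longrightarrow> gmap b i \<le> gmap b j"
    "\<And>i. i \<le> dots e \<Longrightarrow> gmap b (proj e i) = proj (fcod b) (fmap b i)"
    using assms(2) unfolding is_fat_arr_iff e_def by auto
  show ?thesis
    unfolding is_fat_arr_iff fat_comp_def d_def[symmetric] using a b fat_objD(1)[OF a(1)] by simp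
qed


section \<open>Fair categories in topological spaces\<close>

definition homotopy_equivalence_map :: "'a topology \<Rightarrow> 'b topology \<Rightarrow> ('a \<Rightarrow> 'b) \<Rightarrow> bool" where
  "homotopy_equivalence_map S T f \<longleftrightarrow> continuous_map S T f \<and>
     (\<exists>g. continuous_map T S g \<and>
        homotopic_with (\<lambda>_. True) S S (g \<circ> f) id \<and>
        homotopic_with (\<lambda>_. True) T T (f \<circ> g) id)"

text \<open>A contravariant functor has an object part \<open>Y\<close> and an arrow part \<open>F\<close>. Continuous maps are
  only compared on the underlying spaces.\<close>

definition fat_functor :: "(fat_obj \<Rightarrow> 'b topology) \<Rightarrow> (fat_arr \<Rightarrow> 'b \<Rightarrow> 'b) \<Rightarrow> bool" where
  "fat_functor Y F \<longleftrightarrow>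
     (\<forall>a. is_fat_arr a \<longrightarrow> continuous_map (Y (fcod a)) (Y (fdom a)) (F a)) \<and>
     (\<forall>e. is_fat_obj e \<longrightarrow> (\<forall>y\<in>topspace (Y e). F (fat_id e) y = y)) \<and>
     (\<forall>a b. is_fat_arr a \<and> is_fat_arr b \<and> fcod a = fdom b \<longrightarrow>
        (\<forall>y\<in>topspace (Y (fcod b)). F (fat_comp b a) y = F a (F b y)))"

definition fair_category :: "(fat_obj \<Rightarrow> 'b topology) \<Rightarrow> (fat_arr \<Rightarrow> 'b \<Rightarrow> 'b) \<Rightarrow> bool" where
  "fair_category Y F \<longleftrightarrow> fat_functor Y F \<and>
     (\<forall>a. is_vertical a \<longrightarrow> homotopy_equivalence_map (Y (fcod a)) (Y (fdom a)) (F a)) \<and>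
     Y fat_dot = discrete_topology (topspace (Y fat_dot)) \<and>
     (\<forall>m n. is_fat_obj m \<and> is_fat_obj n \<longrightarrow>
        homeomorphic_map (Y (m \<dotplus> n))
          (subtopology (prod_topology (Y m) (Y n)) {(y, z). F (last_dot m) y = F (first_dot n) z})
          (\<lambda>w. (F (sum_left m n) w, F (sum_right m n) w)))"

text \<open>\<open>fair_structure Y F Ob Ar We s t p q i ca cu\<close> says that the spaces of objects, arrows and weak
  identity arrows of \<open>(Y, F)\<close> are \<open>Ob\<close>, \<open>Ar\<close> and \<open>We\<close> up to homeomorphisms under which source and
  target become \<open>s\<close> and \<open>t\<close>, the two maps from weak identity arrows to objects become \<open>p\<close> and \<open>q\<close>,
  the map from weak identity arrows to arrows becomes \<open>i\<close>, and the compositions become \<open>ca\<close> and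
  \<open>cu\<close>. Homeomorphisms are needed since all \<open>Y e\<close> share one carrier type. In the composition clauses
  \<open>w\<close> is the point of the space over \<open>m \<dotplus> m\<close> that corresponds to a composable pair.\<close>

definition fair_structure ::
  "(fat_obj \<Rightarrow> 'b topology) \<Rightarrow> (fat_arr \<Rightarrow> 'b \<Rightarrow> 'b) \<Rightarrow>
   'o topology \<Rightarrow> 'm topology \<Rightarrow> 'w topology \<Rightarrow> ('m \<Rightarrow> 'o) \<Rightarrow> ('m \<Rightarrow> 'o) \<Rightarrow> ('w \<Rightarrow> 'o) \<Rightarrow> ('w \<Rightarrow> 'o) \<Rightarrow>
   ('w \<Rightarrow> 'm) \<Rightarrow> ('m \<Rightarrow> 'm \<Rightarrow> 'm) \<Rightarrow> ('w \<Rightarrow> 'w \<Rightarrow> 'w) \<Rightarrow> bool" where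
  "fair_structure Y F Ob Ar We s t p q i ca cu \<longleftrightarrow>
     (\<exists>ho ha hu.
        homeomorphic_map Ob (Y fat_dot) ho \<and>
        homeomorphic_map Ar (Y fat_edge) ha \<and>
        homeomorphic_map We (Y fat_link) hu \<and>
        (\<forall>a\<in>topspace Ar. F (first_dot fat_edge) (ha a) = ho (s a)) \<and>
        (\<forall>a\<in>topspace Ar. F (last_dot fat_edge) (ha a) = ho (t a)) \<and>
        (\<forall>u\<in>topspace We. F (first_dot fat_link) (hu u) = ho (p u)) \<and>
        (\<forall>u\<in>topspace We. F (last_dot fat_link) (hu u) = ho (q u)) \<and>
        (\<forall>u\<in>topspace We. F edge_to_link (hu u) = ha (i u)) \<and>
        (\<forall>a\<in>topspace Ar. \<forall>b\<in>topspace Ar. t a = s b \<longrightarrow>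
           (\<forall>w\<in>topspace (Y (fat_edge \<dotplus> fat_edge)).
              F (sum_left fat_edge fat_edge) w = ha a \<and> F (sum_right fat_edge fat_edge) w = ha b \<longrightarrow>
              F edge_ends w = ha (ca a b))) \<and>
        (\<forall>u\<in>topspace We. \<forall>v\<in>topspace We. q u = p v \<longrightarrow>
           (\<forall>w\<in>topspace (Y (fat_link \<dotplus> fat_link)).
              F (sum_left fat_link fat_link) w = hu u \<and> F (sum_right fat_link fat_link) w = hu v \<longrightarrow>
              F link_ends w = hu (cu u v))))"


section \<open>Moore paths and null-homotopic Moore loops\<close>

definition compact_open_topology :: "'a topology \<Rightarrow> 'b topology \<Rightarrow> ('a \<Rightarrow> 'b) topology" where
  "compact_open_topology S T = topology_generated_by
     {{f \<in> extensional (topspace S). continuous_map S T f \<and> f ` K \<subseteq> V} | K V.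
        compactin S K \<and> openin T V}"

definition moore_objects :: "'a topology \<Rightarrow> 'a topology" where
  "moore_objects X = discrete_topology (topspace X)"

text \<open>A Moore path is a pair of its length and an extensional function on \<open>{0..r}\<close>.\<close>

type_synonym 'a moore_path = "real \<times> (real \<Rightarrow> 'a)"

definition moore_paths :: "'a topology \<Rightarrow> 'a \<Rightarrow> 'a \<Rightarrow> 'a moore_path set" where
  "moore_paths X x y = {(r, \<gamma>). r > 0 \<and> \<gamma> \<in> extensional {0..r} \<and>
     continuous_map (top_of_set {0..r}) X \<gamma> \<and> \<gamma> 0 = x \<and> \<gamma> r = y}"

definition rescale_path :: "'a moore_path \<Rightarrow> real \<times> (real \<Rightarrow> 'a)" where
  "rescale_path = (\<lambda>(r, \<gamma>). (r, \<lambda>t\<in>{0..1}. \<gamma> (r * t)))"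

definition moore_path_space :: "'a topology \<Rightarrow> 'a \<Rightarrow> 'a \<Rightarrow> 'a moore_path topology" where
  "moore_path_space X x y = pullback_topology (moore_paths X x y) rescale_path
     (prod_topology (top_of_set {0<..}) (compact_open_topology (top_of_set {0..1}) X))"

definition concat_path :: "'a moore_path \<Rightarrow> 'a moore_path \<Rightarrow> 'a moore_path" where
  "concat_path = (\<lambda>(r1, \<gamma>1) (r2, \<gamma>2).
     (r1 + r2, \<lambda>t\<in>{0..r1 + r2}. if t \<le> r1 then \<gamma>1 t else \<gamma>2 (t - r1)))"

text \<open>Points of the coproduct of the spaces of Moore paths carry the endpoints as a tag.\<close>

type_synonym 'a moore_arrow = "('a \<times> 'a) \<times> 'a moore_path"

definition moore_arrows :: "'a topology \<Rightarrow> 'a moore_arrow topology" where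
  "moore_arrows X = sum_topology (\<lambda>(x, y). moore_path_space X x y) (topspace X \<times> topspace X)"

definition arrow_source :: "'a moore_arrow \<Rightarrow> 'a" where
  "arrow_source a = fst (fst a)"

definition arrow_target :: "'a moore_arrow \<Rightarrow> 'a" where
  "arrow_target a = snd (fst a)"

definition arrow_concat :: "'a moore_arrow \<Rightarrow> 'a moore_arrow \<Rightarrow> 'a moore_arrow" where
  "arrow_concat a b = ((arrow_source a, arrow_target b), concat_path (snd a) (snd b))"

definition triangle :: "real \<Rightarrow> (real \<times> real) set" where
  "triangle r = convex hull {(0, 0), (0, 1), (r, 1)}"

type_synonym 'a null_homotopy = "real \<times> (real \<times> real \<Rightarrow> 'a)"

definition null_homotopies :: "'a topology \<Rightarrow> 'a \<Rightarrow> 'a null_homotopy set" where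
  "null_homotopies X x = {(r, \<omega>). r > 0 \<and> \<omega> \<in> extensional (triangle r) \<and>
     continuous_map (top_of_set (triangle r)) X \<omega> \<and>
     (\<forall>v \<in> closed_segment (0, 0) (0, 1) \<union> closed_segment (0, 0) (r, 1). \<omega> v = x)}"

definition rescale_null :: "'a null_homotopy \<Rightarrow> real \<times> (real \<times> real \<Rightarrow> 'a)" where
  "rescale_null = (\<lambda>(r, \<omega>). (r, \<lambda>v\<in>triangle 1. \<omega> (r * fst v, snd v)))"

definition null_homotopy_space :: "'a topology \<Rightarrow> 'a \<Rightarrow> 'a null_homotopy topology" where
  "null_homotopy_space X x = pullback_topology (null_homotopies X x) rescale_null
     (prod_topology (top_of_set {0<..}) (compact_open_topology (top_of_set (triangle 1)) X))"

definition concat_null :: "'a null_homotopy \<Rightarrow> 'a null_homotopy \<Rightarrow> 'a null_homotopy" where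
  "concat_null = (\<lambda>(r1, \<omega>1) (r2, \<omega>2).
     (r1 + r2, \<lambda>v\<in>triangle (r1 + r2).
        if v \<in> triangle r1 then \<omega>1 v else \<omega>2 (fst v - r1 * snd v, snd v)))"

definition top_side :: "'a null_homotopy \<Rightarrow> 'a moore_path" where
  "top_side = (\<lambda>(r, \<omega>). (r, \<lambda>t\<in>{0..r}. \<omega> (t, 1)))"

type_synonym 'a null_loop = "'a \<times> 'a null_homotopy"

definition null_loops :: "'a topology \<Rightarrow> 'a null_loop topology" where
  "null_loops X = sum_topology (null_homotopy_space X) (topspace X)"

definition null_loop_base :: "'a null_loop \<Rightarrow> 'a" where
  "null_loop_base u = fst u"

definition null_loop_arrow :: "'a null_loop \<Rightarrow> 'a moore_arrow" where
  "null_loop_arrow u = ((fst u, fst u), top_side (snd u))"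

definition null_loop_concat :: "'a null_loop \<Rightarrow> 'a null_loop \<Rightarrow> 'a null_loop" where
  "null_loop_concat u v = (fst u, concat_null (snd u) (snd v))"

text \<open>A type with room for the spaces of composable chains of Moore paths and null-homotopic loops:
  an initial point and a sequence of which a space \<open>Y e\<close> uses finitely many entries.\<close>

type_synonym 'a moore_chain = "'a \<times> (nat \<Rightarrow> 'a moore_arrow + 'a null_loop)"

end

theory Submission
  imports Defs
begin

text \<open>The space over \<open>e\<close> consists of the composable chains having a Moore path for each unlinked and
  a null-homotopic loop for each linked pair of consecutive dots, and an arrow acts by composing
  along the gaps of its image; this is strictly functorial since Moore composition is associative.
  Null-homotopic loops contract, so a chain can be deformed to one whose loops are all constant, and
  constant loops of length \<open>s\<close> inserted around a Moore path disappear as \<open>s\<close> tends to \<open>0\<close>. Hence a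
  vertical arrow is homotopic to the map that keeps the Moore paths and makes all loops constant,
  which is a homotopy equivalence.

  A null-homotopy \<open>\<omega>\<close> on the triangle of width \<open>r\<close> is rewritten as \<open>f (t, b) = \<omega> (t * b, b)\<close> on the
  strip \<open>0 \<le> t \<le> r\<close>, where composition no longer depends on the height \<open>b\<close>; Moore paths are the strips
  independent of \<open>b\<close>. By the exponential law for compact-open topologies, continuity of maps into
  spaces of strips is continuity of evaluations.\<close>

section \<open>Compact-open and pullback topologies\<close>

text \<open>End points of paths and loops carry the discrete topology, so a homotopy must fix all
  vertices of a chain; contraction and padding do, and can therefore be applied to each entry
  separately. Lengths are positive, so there is no strict unit to insert: a homotopy inverse of a
  face has to invent loops, and constant loops of length 1 are its choice. Composing them again
  leaves waiting times behind, so the inverse is one only up to homotopy. For a vertical arrow two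
  homotopies meet in an exact equality of maps. One acts before the face and contracts the loops;
  the other acts after it and interpolates linearly between the waiting times that composition
  produces and those of the normal form. A null strip contracts because its bottom side is constant:
  compressing the heights towards 0 pushes the triangle into its vertex. That vertex is also the
  analytic obstacle. Turning a strip into a map on the triangle divides by the height, which is
  discontinuous there, so continuity in that direction is tested on the square, of which the
  triangle is a quotient.\<close>

lemma compact_open_topology_alt:
  "compact_open_topology S T = topology_generated_by
     ((\<lambda>(K, V). {f \<in> extensional (topspace S). continuous_map S T f \<and> f ` K \<subseteq> V}) `
        {(K, V). compactin S K \<and> openin T V})"
  unfolding compact_open_topology_def by (intro arg_cong[where f = topology_generated_by] set_eqI) (simp add: image_iff conj_commute)

lemma topspace_compact_open_topology [simp]:
  "topspace (compact_open_topology S T) = {f \<in> extensional (topspace S). continuous_map S T f}"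
proof
  \<comment> \<open>For empty \<open>K\<close> the subbasic condition is void, so this one member is
    already the whole carrier.\<close>
  have "({}, {}) \<in> {(K, V). compactin S K \<and> openin T V}" by simp
  then show "{f \<in> extensional (topspace S). continuous_map S T f} \<subseteq> topspace (compact_open_topology S T)"
    unfolding compact_open_topology_alt topology_generated_by_topspace
    by (intro subsetI UN_I[of "({}, {})"]) auto
qed (auto simp: compact_open_topology_alt)

section \<open>Currying and evaluation for compact-open topologies\<close>

lemma continuous_map_into_compact_open_iff:
  "continuous_map W (compact_open_topology S T) h \<longleftrightarrow>
     (\<forall>w\<in>topspace W. h w \<in> extensional (topspace S) \<and> continuous_map S T (h w)) \<and>
     (\<forall>K V. compactin S K \<and> openin T V \<longrightarrow> openin W {w \<in> topspace W. h w ` K \<subseteq> V})"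
    (is "?L \<longleftrightarrow> ?P \<and> ?O")
proof -
  let ?B = "\<lambda>(K, V). {f \<in> extensional (topspace S). continuous_map S T f \<and> f ` K \<subseteq> V}"
  let ?I = "{(K, V). compactin S K \<and> openin T V}"
  have L: "?L \<longleftrightarrow> (\<forall>i\<in>?I. openin W (h -` ?B i \<inter> topspace W)) \<and> ?P"
    unfolding compact_open_topology_alt continuous_on_generated_topo_iff
    unfolding topology_generated_by_topspace[symmetric] compact_open_topology_alt[symmetric]
      topspace_compact_open_topology
    by (intro arg_cong2[where f = "(\<and>)"]) blast+
  have "h -` ?B (K, V) \<inter> topspace W = {w \<in> topspace W. h w ` K \<subseteq> V}" if ?P for K V
    using that by auto
  then have "?P \<Longrightarrow> (\<forall>i\<in>?I. openin W (h -` ?B i \<inter> topspace W)) \<longleftrightarrow> ?O"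
    by simp blast
  then show ?thesis unfolding L by blast
qed

text \<open>Currying. By the tube lemma, an open set that contains the slice
  \<open>{w} \<times> K\<close> over a compact \<open>K\<close> contains a tube around it, and the
  tube's base is a neighbourhood of \<open>w\<close>.\<close>

lemma continuous_map_into_compact_open:
  assumes "\<And>w. w \<in> topspace W \<Longrightarrow> h w \<in> extensional (topspace S)"
    and cont: "continuous_map (prod_topology W S) T (\<lambda>(w, p). h w p)"
  shows "continuous_map W (compact_open_topology S T) h"
  unfolding continuous_map_into_compact_open_iff
proof (intro conjI ballI allI impI)
  fix w assume w: "w \<in> topspace W"
  show "h w \<in> extensional (topspace S)" using assms(1) w by simp
  have "continuous_map S T ((\<lambda>(w, p). h w p) \<circ> (\<lambda>p. (w, p)))"
    using w by (intro continuous_map_compose[OF _ cont]) (simp add: continuous_map_pairwise o_def)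
  then show "continuous_map S T (h w)" by (simp add: o_def)
next
  fix K V assume KV: "compactin S K \<and> openin T V"
  let ?U = "{q \<in> topspace (prod_topology W S). (\<lambda>(w, p). h w p) q \<in> V}"
  have U: "openin (prod_topology W S) ?U"
    using KV cont openin_continuous_map_preimage by blast
  show "openin W {w \<in> topspace W. h w ` K \<subseteq> V}"
  proof (subst openin_subopen, intro ballI)
    fix w assume w: "w \<in> {w \<in> topspace W. h w ` K \<subseteq> V}"
    then have "{w} \<times> K \<subseteq> ?U" using KV compactin_subset_topspace by fastforce
    then obtain A B where "openin W A" "w \<in> A" "K \<subseteq> B" "A \<times> B \<subseteq> ?U"
      using tube_lemma_right[OF U, of K w] KV w by auto
    then show "\<exists>A. openin W A \<and> w \<in> A \<and> A \<subseteq> {w \<in> topspace W. h w ` K \<subseteq> V}"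
      using KV openin_subset[of W A] by (intro exI[of _ A]) fastforce
  qed
qed

text \<open>Uncurrying. Local compactness gives a compact neighbourhood \<open>K\<close> of
  \<open>g w\<close> that \<open>h w\<close> still maps into \<open>V\<close>; mapping
  \<open>K\<close> into \<open>V\<close> is an open condition on the map, and lying in the interior
  of \<open>K\<close> is one on the point.\<close>

lemma continuous_map_eval_compact_open:
  assumes S: "neighbourhood_base_of (compactin S) S"
    and h: "continuous_map W (compact_open_topology S T) h" and g: "continuous_map W S g"
  shows "continuous_map W T (\<lambda>w. h w (g w))"
  unfolding continuous_map_alt
proof (intro conjI strip)
  note h' = h[unfolded continuous_map_into_compact_open_iff]
  show "(\<lambda>w. h w (g w)) \<in> topspace W \<rightarrow> topspace T"
    using h' continuous_map_funspace[OF g] by (auto dest!: continuous_map_funspace)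
  fix V assume V: "openin T V"
  show "openin W ((\<lambda>w. h w (g w)) -` V \<inter> topspace W)"
  proof (subst openin_subopen, intro ballI)
    fix w assume w: "w \<in> (\<lambda>w. h w (g w)) -` V \<inter> topspace W"
    have "openin S {p \<in> topspace S. h w p \<in> V}"
      using h' w V openin_continuous_map_preimage by blast
    moreover have "g w \<in> {p \<in> topspace S. h w p \<in> V}"
      using w continuous_map_funspace[OF g] by auto
    ultimately obtain U K where U: "openin S U" "compactin S K" "g w \<in> U" "U \<subseteq> K"
      "K \<subseteq> {p \<in> topspace S. h w p \<in> V}"
      using S unfolding neighbourhood_base_of by meson
    let ?N = "{v \<in> topspace W. h v ` K \<subseteq> V} \<inter> {v \<in> topspace W. g v \<in> U}"
    have "openin W ?N"
      using h' U(1,2) V openin_continuous_map_preimage[OF g] by blast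
    then show "\<exists>N. openin W N \<and> w \<in> N \<and> N \<subseteq> (\<lambda>w. h w (g w)) -` V \<inter> topspace W"
      using U w by (intro exI[of _ ?N]) blast
  qed
qed

lemma neighbourhood_base_compact_euclidean:
  "neighbourhood_base_of (compactin euclidean) (euclidean :: 'b::euclidean_space topology)"
  using locally_compact_space_neighbourhood_base locally_compact_space_euclidean Hausdorff_space_euclidean
  by blast

lemma neighbourhood_base_compact_set:
  fixes S :: "'b::metric_space set"
  assumes "compact S"
  shows "neighbourhood_base_of (compactin (top_of_set S)) (top_of_set S)"
proof -
  have "Hausdorff_space (top_of_set S)"
    by (intro Hausdorff_space_subtopology Hausdorff_space_euclidean)
  moreover have "locally_compact_space (top_of_set S)"
    using assms by (intro compact_imp_locally_compact_space) (simp add: compact_space_subtopology)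
  ultimately show ?thesis
    by (intro locally_compact_space_neighbourhood_base[THEN iffD1] disjI1)
qed

text \<open>The preimage under \<open>q\<close> of a compact set is closed, hence compact, so each
  subbasic condition on \<open>S'\<close> is a subbasic condition on \<open>S\<close>. Intended for
  the triangle as a quotient of the square, where a formula with a division becomes continuous only
  after pulling back.\<close>

lemma continuous_map_compact_open_quotient:
  assumes S: "compact_space S" and S': "Hausdorff_space S'" and q: "quotient_map S S' q"
    and ext: "\<And>w. w \<in> topspace W \<Longrightarrow> h w \<in> extensional (topspace S')"
    and h: "continuous_map W (compact_open_topology S T) (\<lambda>w. \<lambda>p\<in>topspace S. h w (q p))"
  shows "continuous_map W (compact_open_topology S' T) h"
  unfolding continuous_map_into_compact_open_iff
proof (intro conjI ballI allI impI)
  note h' = h[unfolded continuous_map_into_compact_open_iff]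
  fix w assume w: "w \<in> topspace W"
  show "h w \<in> extensional (topspace S')" using ext w .
  have "continuous_map S T (\<lambda>p\<in>topspace S. h w (q p))" using h' w by blast
  then have "continuous_map S T (h w \<circ> q)"
    by (rule continuous_map_eq) simp
  then show "continuous_map S' T (h w)" using continuous_compose_quotient_map q by blast
next
  note h' = h[unfolded continuous_map_into_compact_open_iff]
  have im: "q ` topspace S = topspace S'" using q by (simp add: quotient_map_def)
  fix K V assume KV: "compactin S' K \<and> openin T V"
  let ?K = "{p \<in> topspace S. q p \<in> K}"
  have "closedin S ?K"
    by (rule closedin_continuous_map_preimage[OF quotient_imp_continuous_map[OF q]])
      (rule compactin_imp_closedin[OF S' conjunct1[OF KV]])
  then have "compactin S ?K" using S by (rule closedin_compact_space[rotated])
  then have "openin W {w \<in> topspace W. (\<lambda>p\<in>topspace S. h w (q p)) ` ?K \<subseteq> V}"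
    using h' KV by blast
  moreover have "(\<lambda>p\<in>topspace S. h w (q p)) ` ?K = h w ` K" for w
  proof -
    have "q ` ?K = K" using im KV compactin_subset_topspace by fastforce
    moreover have "(\<lambda>p\<in>topspace S. h w (q p)) ` ?K = h w ` q ` ?K"
      unfolding image_image by (intro image_cong) auto
    ultimately show ?thesis by simp
  qed
  ultimately show "openin W {w \<in> topspace W. h w ` K \<subseteq> V}" by simp
qed

section \<open>Coproducts and pullback topologies\<close>

text \<open>All summands are pulled back along the same \<open>f\<close> from the same
  \<open>T\<close>, so the index is just one more, discrete, coordinate. Continuity into the
  coproducts of paths and of loops thereby reduces to continuity of tag, length and rescaled
  map.\<close>

lemma sum_topology_pullback:
  "sum_topology (\<lambda>i. pullback_topology (A i) f T) I =
   pullback_topology (Sigma I A) (\<lambda>(i, x). (i, f x)) (prod_topology (discrete_topology I) T)"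
  (is "?L = ?R")
proof (rule topology_eq[THEN iffD2], intro allI iffI)
  fix U assume "openin ?L U"
  then have U: "U \<subseteq> Sigma I (topspace \<circ> (\<lambda>i. pullback_topology (A i) f T))"
    "\<forall>i\<in>I. \<exists>V. openin T V \<and> {x. (i, x) \<in> U} = f -` V \<inter> A i"
    unfolding openin_sum_topology openin_pullback_topology by auto
  then obtain V where V: "\<And>i. i \<in> I \<Longrightarrow> openin T (V i)"
    "\<And>i. i \<in> I \<Longrightarrow> {x. (i, x) \<in> U} = f -` V i \<inter> A i"
    by metis
  let ?V = "\<Union>i\<in>I. {i} \<times> V i"
  have "openin (prod_topology (discrete_topology I) T) ?V"
    using V(1) by (intro openin_Union) (auto simp: openin_prod_Times_iff)
  moreover have "U = (\<lambda>(i, x). (i, f x)) -` ?V \<inter> Sigma I A"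
  proof (rule set_eqI)
    fix p :: "'a \<times> 'b"
    obtain i x where p: "p = (i, x)" by force
    show "p \<in> U \<longleftrightarrow> p \<in> (\<lambda>(i, x). (i, f x)) -` ?V \<inter> Sigma I A"
      using V(2)[of i] U(1) unfolding p by fastforce
  qed
  ultimately show "openin ?R U" unfolding openin_pullback_topology by blast
next
  fix U assume "openin ?R U"
  then obtain V where V: "openin (prod_topology (discrete_topology I) T) V"
    "U = (\<lambda>(i, x). (i, f x)) -` V \<inter> Sigma I A"
    unfolding openin_pullback_topology by blast
  have *: "openin T {y. (i, y) \<in> V}" if "i \<in> I" for i
  proof -
    have "V \<subseteq> I \<times> topspace T" using openin_subset[OF V(1)] by simp
    then have "{y. (i, y) \<in> V} = {y \<in> topspace T. (i, y) \<in> V}" by auto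
    moreover have "openin T {y \<in> topspace T. (i, y) \<in> V}"
      using that V(1)
      by (intro openin_continuous_map_preimage[where X = T]) (simp_all add: continuous_map_pairwise o_def)
    ultimately show ?thesis by simp
  qed
  have "openin (pullback_topology (A i) f T) {x. (i, x) \<in> U}" if "i \<in> I" for i
    unfolding openin_pullback_topology V(2) using *[OF that] that
    by (intro exI[of _ "{y. (i, y) \<in> V}"]) auto
  moreover have "U \<subseteq> Sigma I (topspace \<circ> (\<lambda>i. pullback_topology (A i) f T))"
    using openin_subset[OF V(1)] V(2) by (auto simp: topspace_pullback_topology)
  ultimately show "openin ?L U" unfolding openin_sum_topology by blast
qed

lemma continuous_map_pullback_topology_iff:
  "continuous_map W (pullback_topology A f T) h \<longleftrightarrow>
     h ` topspace W \<subseteq> A \<and> continuous_map W T (\<lambda>w. f (h w))"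
proof
  assume L: "continuous_map W (pullback_topology A f T) h"
  have "continuous_map (pullback_topology A f T) T (id \<circ> f)"
    by (rule continuous_map_pullback) simp
  then have "continuous_map W T ((id \<circ> f) \<circ> h)" by (rule continuous_map_compose[OF L])
  then show "h ` topspace W \<subseteq> A \<and> continuous_map W T (\<lambda>w. f (h w))"
    using continuous_map_image_subset_topspace[OF L] by (auto simp: o_def topspace_pullback_topology)
next
  assume "h ` topspace W \<subseteq> A \<and> continuous_map W T (\<lambda>w. f (h w))"
  then show "continuous_map W (pullback_topology A f T) h"
    by (intro continuous_map_pullback') (auto simp: o_def)
qed

lemma continuous_map_Pair_euclidean:
  assumes "continuous_map W euclideanreal f" "continuous_map W euclideanreal g"
  shows "continuous_map W euclidean (\<lambda>w. (f w, g w))"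
  using assms by (simp add: continuous_map_pairwise o_def flip: prod_topology_euclidean)


section \<open>Strips\<close>

type_synonym 'a strip = "'a moore_arrow + 'a null_loop"

text \<open>A strip is a length \<open>r\<close> with a total function of \<open>(t, b)\<close>, where \<open>t\<close> is clamped to \<open>[0, r]\<close> and
  \<open>b\<close> to \<open>[0, 1]\<close>. It is stored in the entry type of \<open>moore_chain\<close>, whose first component is
  redundant here.\<close>

definition mk_strip :: "real \<Rightarrow> (real \<times> real \<Rightarrow> 'a) \<Rightarrow> 'a strip" where
  "mk_strip r f = Inr (f (0, 0), r, f)"

definition len :: "'a strip \<Rightarrow> real" where
  "len z = fst (snd (projr z))"

definition ev :: "'a strip \<Rightarrow> real \<times> real \<Rightarrow> 'a" where
  "ev z = snd (snd (projr z))"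

definition src :: "'a strip \<Rightarrow> 'a" where
  "src z = ev z (0, 0)"

definition tgt :: "'a strip \<Rightarrow> 'a" where
  "tgt z = ev z (len z, 0)"

lemma mk_strip_simps [simp]:
  "len (mk_strip r f) = r" "ev (mk_strip r f) = f" "src (mk_strip r f) = f (0, 0)"
  "tgt (mk_strip r f) = f (r, 0)"
  by (simp_all add: mk_strip_def len_def ev_def src_def tgt_def)

lemma mk_strip_cong:
  assumes "r = r'" "\<And>t b. f (t, b) = f' (t, b)"
  shows "mk_strip r f = mk_strip r' f'"
proof -
  have "f = f'" using assms(2) by auto
  then show ?thesis using assms(1) by simp
qed

text \<open>The clamping makes the total function canonical: a strip is determined by its values
  over \<open>[0, len z] \<times> [0, 1]\<close>, and the equation with \<open>mk_strip\<close>
  fixes the redundant component. Both lateral sides are constant, as a null-homotopy of loops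
  requires.\<close>

definition strip_shape :: "'a strip \<Rightarrow> bool" where
  "strip_shape z \<longleftrightarrow> z = mk_strip (len z) (ev z) \<and> len z > 0 \<and>
     (\<forall>t b. t \<le> 0 \<longrightarrow> ev z (t, b) = src z) \<and> (\<forall>t b. len z \<le> t \<longrightarrow> ev z (t, b) = tgt z) \<and>
     (\<forall>t b. ev z (t, b) = ev z (t, max 0 (min 1 b)))"

definition strip :: "'a topology \<Rightarrow> 'a strip \<Rightarrow> bool" where
  "strip X z \<longleftrightarrow> strip_shape z \<and> continuous_map euclidean X (ev z)"

definition flat_strip :: "'a strip \<Rightarrow> bool" where
  "flat_strip z \<longleftrightarrow> (\<forall>t b. ev z (t, b) = ev z (t, 1))"

text \<open>The bottom side is what the triangle collapses to its vertex, so it has to be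
  constant.\<close>

definition null_strip :: "'a strip \<Rightarrow> bool" where
  "null_strip z \<longleftrightarrow> (\<forall>t. ev z (t, 0) = src z)"

lemma strip_shapeD:
  assumes "strip_shape z"
  shows "len z > 0" "\<And>t b. t \<le> 0 \<Longrightarrow> ev z (t, b) = src z"
    "\<And>t b. len z \<le> t \<Longrightarrow> ev z (t, b) = tgt z" "\<And>t b. ev z (t, max 0 (min 1 b)) = ev z (t, b)"
    "mk_strip (len z) (ev z) = z"
proof -
  from assms[unfolded strip_shape_def]
  have mk: "z = mk_strip (len z) (ev z)" and *: "0 < len z" "\<forall>t b. t \<le> 0 \<longrightarrow> ev z (t, b) = src z"
    "\<forall>t b. len z \<le> t \<longrightarrow> ev z (t, b) = tgt z"
    and clamp: "\<forall>t b. ev z (t, b) = ev z (t, max 0 (min 1 b))"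
    by blast+
  show "len z > 0" "\<And>t b. t \<le> 0 \<Longrightarrow> ev z (t, b) = src z"
    "\<And>t b. len z \<le> t \<Longrightarrow> ev z (t, b) = tgt z" using * by blast+
  show "\<And>t b. ev z (t, max 0 (min 1 b)) = ev z (t, b)" by (rule clamp[rule_format, symmetric])
  show "mk_strip (len z) (ev z) = z" by (rule mk[symmetric])
qed

lemma strip_shape_mk:
  assumes "r > 0" "\<And>t b. t \<le> 0 \<Longrightarrow> f (t, b) = f (0, 0)" "\<And>t b. r \<le> t \<Longrightarrow> f (t, b) = f (r, 0)"
    "\<And>t b. f (t, b) = f (t, max 0 (min 1 b))"
  shows "strip_shape (mk_strip r f)"
  unfolding strip_shape_def mk_strip_simps by (intro conjI allI impI refl assms)

lemma strip_eqI:
  assumes "strip_shape z" "strip_shape z'" "len z = len z'" "\<And>t b. ev z (t, b) = ev z' (t, b)"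
  shows "z = z'"
proof -
  have "ev z = ev z'" using assms(4) by auto
  then show ?thesis using assms(3) strip_shapeD(5)[OF assms(1)] strip_shapeD(5)[OF assms(2)] by metis
qed

lemma null_strip_tgt: "null_strip z \<Longrightarrow> tgt z = src z"
  by (simp add: null_strip_def tgt_def)

lemma strip_ev_in: "strip X z \<Longrightarrow> ev z p \<in> topspace X"
  unfolding strip_def using continuous_map_funspace by fastforce

lemma strip_ends_in: "strip X z \<Longrightarrow> src z \<in> topspace X" "strip X z \<Longrightarrow> tgt z \<in> topspace X"
  by (simp_all add: src_def tgt_def strip_ev_in)

text \<open>The end points are topologised discretely, as in the coproducts over pairs of points.\<close>

definition strips :: "'a topology \<Rightarrow> 'a strip topology" where
  "strips X = pullback_topology {z. strip X z} (\<lambda>z. ((src z, tgt z), (len z, ev z)))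
     (prod_topology (prod_topology (discrete_topology (topspace X)) (discrete_topology (topspace X)))
       (prod_topology euclideanreal (compact_open_topology euclidean X)))"

lemma topspace_strips [simp]: "topspace (strips X) = {z. strip X z}"
  unfolding strips_def topspace_pullback_topology
  by (auto simp: strip_ends_in strip_def extensional_def)

section \<open>Continuity into and out of the space of strips\<close>

lemma continuous_map_strips_iff:
  "continuous_map W (strips X) h \<longleftrightarrow> (\<forall>w\<in>topspace W. strip X (h w)) \<and>
     continuous_map W (discrete_topology (topspace X)) (\<lambda>w. src (h w)) \<and>
     continuous_map W (discrete_topology (topspace X)) (\<lambda>w. tgt (h w)) \<and>
     continuous_map W euclideanreal (\<lambda>w. len (h w)) \<and>
     continuous_map W (compact_open_topology euclidean X) (\<lambda>w. ev (h w))"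
  unfolding strips_def continuous_map_pullback_topology_iff
  by (auto simp: continuous_map_pairwise o_def)

lemma continuous_map_strip: "continuous_map W (strips X) h \<Longrightarrow> w \<in> topspace W \<Longrightarrow> strip X (h w)"
  by (simp add: continuous_map_strips_iff)

lemma continuous_map_src:
    "continuous_map W (strips X) h \<Longrightarrow> continuous_map W (discrete_topology (topspace X)) (\<lambda>w. src (h w))"
  and continuous_map_tgt:
    "continuous_map W (strips X) h \<Longrightarrow> continuous_map W (discrete_topology (topspace X)) (\<lambda>w. tgt (h w))"
  and continuous_map_len:
    "continuous_map W (strips X) h \<Longrightarrow> continuous_map W euclideanreal (\<lambda>w. len (h w))"
  by (simp_all add: continuous_map_strips_iff)

lemma continuous_map_ev:
  assumes "continuous_map W (strips X) h" "continuous_map W euclideanreal f" "continuous_map W euclideanreal g"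
  shows "continuous_map W X (\<lambda>w. ev (h w) (f w, g w))"
proof -
  have "continuous_map W (compact_open_topology euclidean X) (\<lambda>w. ev (h w))"
    using assms(1) by (simp add: continuous_map_strips_iff)
  from continuous_map_eval_compact_open[OF neighbourhood_base_compact_euclidean this
      continuous_map_Pair_euclidean[OF assms(2,3)]]
  show ?thesis .
qed

text \<open>Joint continuity of the evaluation also makes every single value continuous, so beyond
  it only the shape, the end points and the length remain to be checked.\<close>

lemma continuous_map_into_strips:
  assumes shape: "\<And>w. w \<in> topspace W \<Longrightarrow> strip_shape (h w)"
    and "continuous_map W (discrete_topology (topspace X)) (\<lambda>w. src (h w))"
    and "continuous_map W (discrete_topology (topspace X)) (\<lambda>w. tgt (h w))"
    and "continuous_map W euclideanreal (\<lambda>w. len (h w))"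
    and ev: "continuous_map (prod_topology W euclidean) X (\<lambda>q. ev (h (fst q)) (fst (snd q), snd (snd q)))"
  shows "continuous_map W (strips X) h"
proof -
  have co: "continuous_map W (compact_open_topology euclidean X) (\<lambda>w. ev (h w))"
    using ev by (intro continuous_map_into_compact_open) (simp_all add: case_prod_unfold extensional_def)
  then have "\<forall>w\<in>topspace W. strip X (h w)"
    using continuous_map_funspace[OF co] shape by (auto simp: strip_def)
  then show ?thesis using co assms by (simp add: continuous_map_strips_iff)
qed

lemma continuous_map_of_fst:
  "continuous_map W Y h \<Longrightarrow> continuous_map (prod_topology W Z) Y (\<lambda>q. h (fst q))"
  using continuous_map_compose[OF continuous_map_fst, of W Y h Z] by (simp add: o_def)

lemma continuous_map_of_snd:
  "continuous_map Z Y h \<Longrightarrow> continuous_map (prod_topology W Z) Y (\<lambda>q. h (snd q))"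
  using continuous_map_compose[OF continuous_map_snd, of Z Y h W] by (simp add: o_def)

lemma continuous_map_fst_snd:
  "continuous_map (prod_topology W euclidean) euclideanreal (\<lambda>q. fst (snd q :: real \<times> real))"
  "continuous_map (prod_topology W euclidean) euclideanreal (\<lambda>q. snd (snd q :: real \<times> real))"
  by (intro continuous_map_of_snd, simp add: continuous_on_fst continuous_on_snd)+

section \<open>Concatenation, top side, padding and contraction of strips\<close>

definition cat :: "'a strip \<Rightarrow> 'a strip \<Rightarrow> 'a strip" where
  "cat y z = mk_strip (len y + len z) (\<lambda>(t, b). if t \<le> len y then ev y (t, b) else ev z (t - len y, b))"

definition top_strip :: "'a strip \<Rightarrow> 'a strip" where
  "top_strip z = mk_strip (len z) (\<lambda>(t, b). ev z (t, 1))"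

text \<open>Since \<open>z\<close> clamps its argument, it waits for time \<open>p\<close> at its
  source and for time \<open>q\<close> at its target. Waiting time 0 is allowed here, whereas a
  constant strip needs positive length.\<close>

definition pad :: "real \<Rightarrow> real \<Rightarrow> 'a strip \<Rightarrow> 'a strip" where
  "pad p q z = mk_strip (p + len z + q) (\<lambda>(t, b). ev z (t - p, b))"

definition const_strip :: "real \<Rightarrow> 'a \<Rightarrow> 'a strip" where
  "const_strip r x = mk_strip r (\<lambda>_. x)"

text \<open>At time \<open>s\<close> only the heights up to \<open>1 - s\<close> are used, so at
  time 1 just the bottom side is left. The length moves linearly from \<open>len z\<close> to 1, the
  length of the normal form, and \<open>t\<close> is rescaled accordingly.\<close>

definition contract :: "real \<Rightarrow> 'a strip \<Rightarrow> 'a strip" where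
  "contract s z = mk_strip ((1 - s) * len z + s)
     (\<lambda>(t, b). ev z (t * len z / ((1 - s) * len z + s), (1 - s) * max 0 (min 1 b)))"

lemma strip_shape_cat:
  assumes y: "strip_shape y" and z: "strip_shape z" and "tgt y = src z"
  shows "strip_shape (cat y z)"
  unfolding cat_def
  using strip_shapeD[OF y] strip_shapeD[OF z] assms(3) by (intro strip_shape_mk) auto

lemma len_cat: "len (cat y z) = len y + len z"
  by (simp add: cat_def)

lemma src_cat: "strip_shape y \<Longrightarrow> src (cat y z) = src y"
  using strip_shapeD(1)[of y] by (simp add: cat_def src_def)

lemma tgt_cat: "strip_shape z \<Longrightarrow> tgt (cat y z) = tgt z"
  using strip_shapeD(1)[of z] by (simp add: cat_def tgt_def)

lemma null_strip_cat:
  "null_strip y \<Longrightarrow> null_strip z \<Longrightarrow> tgt y = src z \<Longrightarrow> strip_shape y \<Longrightarrow> null_strip (cat y z)"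
  using strip_shapeD(1)[of y] null_strip_tgt[of y] by (auto simp: null_strip_def src_cat) (auto simp: cat_def)

text \<open>Strict because lengths add and are never normalised. The positive length of the middle
  factor puts every time spent in \<open>x\<close> before the end of \<open>cat x y\<close>.\<close>

lemma cat_assoc: "len y > 0 \<Longrightarrow> len z > 0 \<Longrightarrow> cat (cat x y) z = cat x (cat y z)"
  unfolding cat_def mk_strip_simps by (rule mk_strip_cong) (auto simp: algebra_simps)

lemma top_cat: "top_strip (cat y z) = cat (top_strip y) (top_strip z)"
  unfolding cat_def top_strip_def mk_strip_simps by (rule mk_strip_cong) auto

lemma strip_shape_top: "strip_shape z \<Longrightarrow> strip_shape (top_strip z)"
  unfolding top_strip_def by (intro strip_shape_mk) (simp_all add: strip_shapeD)

lemma flat_top: "flat_strip (top_strip z)"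
  by (simp add: flat_strip_def top_strip_def)

lemma len_top [simp]: "len (top_strip z) = len z"
  by (simp add: top_strip_def)

lemma ends_top: "strip_shape z \<Longrightarrow> src (top_strip z) = src z" "strip_shape z \<Longrightarrow> tgt (top_strip z) = tgt z"
  by (simp_all add: top_strip_def strip_shapeD)

lemma top_flat: "strip_shape z \<Longrightarrow> flat_strip z \<Longrightarrow> top_strip z = z"
  by (rule strip_eqI[OF strip_shape_top], assumption+)
    (auto simp: flat_strip_def top_strip_def, metis)

lemma top_top [simp]: "top_strip (top_strip z) = top_strip z"
  by (simp add: top_strip_def)

text \<open>Pasting along the closed sets \<open>t \<le> len y\<close> and
  \<open>len y \<le> t\<close>. The seam moves with \<open>w\<close>, so the pasting takes place on
  the product with the plane; on the seam both branches give the common end point.\<close>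

lemma continuous_map_cat:
  assumes y: "continuous_map W (strips X) y" and z: "continuous_map W (strips X) z"
    and yz: "\<And>w. w \<in> topspace W \<Longrightarrow> tgt (y w) = src (z w)"
  shows "continuous_map W (strips X) (\<lambda>w. cat (y w) (z w))"
proof (rule continuous_map_into_strips)
  have shape: "strip_shape (y w)" "strip_shape (z w)" if "w \<in> topspace W" for w
    using continuous_map_strip[OF y] continuous_map_strip[OF z] that by (auto simp: strip_def)
  then show "strip_shape (cat (y w) (z w))" if "w \<in> topspace W" for w
    using that by (simp add: strip_shape_cat yz)
  show "continuous_map W (discrete_topology (topspace X)) (\<lambda>w. src (cat (y w) (z w)))"
    by (rule continuous_map_eq[OF continuous_map_src[OF y]]) (simp add: src_cat shape)
  show "continuous_map W (discrete_topology (topspace X)) (\<lambda>w. tgt (cat (y w) (z w)))"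
    by (rule continuous_map_eq[OF continuous_map_tgt[OF z]]) (simp add: tgt_cat shape)
  show "continuous_map W euclideanreal (\<lambda>w. len (cat (y w) (z w)))"
    unfolding len_cat by (intro continuous_map_add continuous_map_len[OF y] continuous_map_len[OF z])
  show "continuous_map (prod_topology W euclidean) X
      (\<lambda>q. ev (cat (y (fst q)) (z (fst q))) (fst (snd q), snd (snd q)))"
    unfolding cat_def mk_strip_simps prod.case
  proof (intro continuous_map_cases_le continuous_map_from_subtopology continuous_map_ev
      continuous_map_diff continuous_map_of_fst[OF continuous_map_len[OF y]] continuous_map_of_fst y z
      continuous_map_fst_snd)
    fix q :: "_ \<times> real \<times> real"
    assume "q \<in> topspace (prod_topology W euclidean)" "fst (snd q) = len (y (fst q))"
    then show "ev (y (fst q)) (fst (snd q), snd (snd q)) =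
        ev (z (fst q)) (fst (snd q) - len (y (fst q)), snd (snd q))"
      using shape[of "fst q"] yz[of "fst q"] by (auto simp: strip_shapeD)
  qed
qed

lemma continuous_map_top:
  assumes z: "continuous_map W (strips X) z"
  shows "continuous_map W (strips X) (\<lambda>w. top_strip (z w))"
proof (rule continuous_map_into_strips)
  have shape: "strip_shape (z w)" if "w \<in> topspace W" for w
    using continuous_map_strip[OF z] that by (auto simp: strip_def)
  then show "strip_shape (top_strip (z w))" if "w \<in> topspace W" for w
    using that by (simp add: strip_shape_top)
  show "continuous_map W (discrete_topology (topspace X)) (\<lambda>w. src (top_strip (z w)))"
    by (rule continuous_map_eq[OF continuous_map_src[OF z]]) (simp add: ends_top shape)
  show "continuous_map W (discrete_topology (topspace X)) (\<lambda>w. tgt (top_strip (z w)))"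
    by (rule continuous_map_eq[OF continuous_map_tgt[OF z]]) (simp add: ends_top shape)
  show "continuous_map W euclideanreal (\<lambda>w. len (top_strip (z w)))"
    using continuous_map_len[OF z] by simp
  show "continuous_map (prod_topology W euclidean) X
      (\<lambda>q. ev (top_strip (z (fst q))) (fst (snd q), snd (snd q)))"
    unfolding top_strip_def mk_strip_simps prod.case
    by (intro continuous_map_ev continuous_map_of_fst z continuous_map_fst_snd) simp
qed

lemma strip_shape_pad:
  "strip_shape z \<Longrightarrow> 0 \<le> p \<Longrightarrow> 0 \<le> q \<Longrightarrow> strip_shape (pad p q z)"
  unfolding pad_def using strip_shapeD[of z] by (intro strip_shape_mk) auto

lemma ends_pad:
  "strip_shape z \<Longrightarrow> 0 \<le> p \<Longrightarrow> src (pad p q z) = src z"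
  "strip_shape z \<Longrightarrow> 0 \<le> q \<Longrightarrow> tgt (pad p q z) = tgt z"
  by (simp_all add: pad_def strip_shapeD)

lemma flat_pad: "flat_strip z \<Longrightarrow> flat_strip (pad p q z)"
  unfolding flat_strip_def pad_def by auto

lemma pad_0: "strip_shape z \<Longrightarrow> pad 0 0 z = z"
  unfolding pad_def by (subst (3) strip_shapeD(5)[symmetric]) (auto intro: mk_strip_cong)

lemma continuous_map_pad:
  assumes z: "continuous_map W (strips X) z"
    and p: "continuous_map W euclideanreal p" and q: "continuous_map W euclideanreal q"
    and pq: "\<And>w. w \<in> topspace W \<Longrightarrow> 0 \<le> p w \<and> 0 \<le> q w"
  shows "continuous_map W (strips X) (\<lambda>w. pad (p w) (q w) (z w))"
proof (rule continuous_map_into_strips)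
  have shape: "strip_shape (z w)" if "w \<in> topspace W" for w
    using continuous_map_strip[OF z] that by (auto simp: strip_def)
  then show "strip_shape (pad (p w) (q w) (z w))" if "w \<in> topspace W" for w
    using that pq by (simp add: strip_shape_pad)
  show "continuous_map W (discrete_topology (topspace X)) (\<lambda>w. src (pad (p w) (q w) (z w)))"
    by (rule continuous_map_eq[OF continuous_map_src[OF z]]) (simp add: ends_pad shape pq)
  show "continuous_map W (discrete_topology (topspace X)) (\<lambda>w. tgt (pad (p w) (q w) (z w)))"
    by (rule continuous_map_eq[OF continuous_map_tgt[OF z]]) (simp add: ends_pad shape pq)
  show "continuous_map W euclideanreal (\<lambda>w. len (pad (p w) (q w) (z w)))"
    unfolding pad_def mk_strip_simps by (intro continuous_intros p q continuous_map_len[OF z])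
  show "continuous_map (prod_topology W euclidean) X
      (\<lambda>v. ev (pad (p (fst v)) (q (fst v)) (z (fst v))) (fst (snd v), snd (snd v)))"
    unfolding pad_def mk_strip_simps prod.case
    by (intro continuous_map_ev continuous_map_diff continuous_map_of_fst z p continuous_map_fst_snd)
qed

lemma strip_shape_const: "r > 0 \<Longrightarrow> strip_shape (const_strip r x)"
  by (auto simp: const_strip_def intro: strip_shape_mk)

lemma const_strip_simps [simp]:
  "len (const_strip r x) = r" "ev (const_strip r x) = (\<lambda>_. x)" "src (const_strip r x) = x"
  "tgt (const_strip r x) = x" "null_strip (const_strip r x)" "flat_strip (const_strip r x)"
  "top_strip (const_strip r x) = const_strip r x"
  by (auto simp: const_strip_def null_strip_def flat_strip_def top_strip_def intro: mk_strip_cong)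

lemma continuous_map_const:
  assumes x: "continuous_map W (discrete_topology (topspace X)) x"
    and r: "continuous_map W euclideanreal r" "\<And>w. w \<in> topspace W \<Longrightarrow> 0 < r w"
  shows "continuous_map W (strips X) (\<lambda>w. const_strip (r w) (x w))"
proof (rule continuous_map_into_strips)
  have "continuous_map (discrete_topology (topspace X)) X id"
    by (simp add: continuous_map_from_discrete_topology)
  from continuous_map_compose[OF x this] have "continuous_map W X x" by simp
  then show "continuous_map (prod_topology W euclidean) X
      (\<lambda>q. ev (const_strip (r (fst q)) (x (fst q))) (fst (snd q), snd (snd q)))"
    by (simp add: continuous_map_of_fst)
qed (use assms in \<open>auto intro: strip_shape_const\<close>)

text \<open>A convex combination of \<open>l\<close> and 1.\<close>

lemma contract_len_pos:
  fixes s l :: real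
  assumes "0 \<le> s" "s \<le> 1" "0 < l"
  shows "0 < (1 - s) * l + s"
  using assms by (cases "s = 0") (auto simp: add_nonneg_pos)

lemma strip_shape_contract:
  assumes z: "strip_shape z" and s: "0 \<le> s" "s \<le> 1" and "null_strip z"
  shows "strip_shape (contract s z)"
  unfolding contract_def
proof (intro strip_shape_mk, goal_cases)
  let ?r = "(1 - s) * len z + s"
  show r: "0 < ?r" using contract_len_pos[OF s strip_shapeD(1)[OF z]] .
  case (2 t b)
  then have "t * len z / ?r \<le> 0"
    using r strip_shapeD(1)[OF z] by (simp add: divide_nonpos_pos mult_nonpos_nonneg)
  then show ?case by (simp add: strip_shapeD[OF z])
next
  case (3 t b)
  let ?r = "(1 - s) * len z + s"
  have r: "0 < ?r" using contract_len_pos[OF s strip_shapeD(1)[OF z]] .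
  have "len z \<le> t * len z / ?r"
    using r 3 strip_shapeD(1)[OF z] by (simp add: pos_le_divide_eq mult.commute)
  then show ?case using r by (simp add: strip_shapeD[OF z])
next
  case (4 t b)
  then show ?case by simp
qed

lemma ends_contract:
  assumes z: "strip_shape z" and s: "0 \<le> s" "s \<le> 1" 
  shows "src (contract s z) = src z" "tgt (contract s z) = tgt z"
proof -
  have "(1 - s) * len z + s \<noteq> 0" using contract_len_pos[OF s strip_shapeD(1)[OF z]] by simp
  then show "src (contract s z) = src z" "tgt (contract s z) = tgt z"
    by (simp_all add: contract_def strip_shapeD[OF z])
qed

lemma null_contract: "null_strip z \<Longrightarrow> null_strip (contract s z)"
  by (simp add: null_strip_def contract_def)

lemma contract_0: "strip_shape z \<Longrightarrow> contract 0 z = z"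
  unfolding contract_def using strip_shapeD(1,4)[of z]
  by (subst (4) strip_shapeD(5)[symmetric]) (auto intro: mk_strip_cong)

lemma contract_1: "null_strip z \<Longrightarrow> contract 1 z = const_strip 1 (src z)"
  unfolding contract_def const_strip_def null_strip_def by (rule mk_strip_cong) auto

lemma continuous_map_contract:
  assumes z: "continuous_map W (strips X) z" and null: "\<And>w. w \<in> topspace W \<Longrightarrow> null_strip (z w)"
    and s: "continuous_map W euclideanreal s" and s01: "\<And>w. w \<in> topspace W \<Longrightarrow> 0 \<le> s w \<and> s w \<le> 1"
  shows "continuous_map W (strips X) (\<lambda>w. contract (s w) (z w))"
proof (rule continuous_map_into_strips)
  have shape: "strip_shape (z w)" if "w \<in> topspace W" for w
    using continuous_map_strip[OF z] that by (auto simp: strip_def)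
  then show "strip_shape (contract (s w) (z w))" if "w \<in> topspace W" for w
    using that null s01 by (simp add: strip_shape_contract)
  show "continuous_map W (discrete_topology (topspace X)) (\<lambda>w. src (contract (s w) (z w)))"
    by (rule continuous_map_eq[OF continuous_map_src[OF z]]) (simp add: ends_contract shape s01)
  show "continuous_map W (discrete_topology (topspace X)) (\<lambda>w. tgt (contract (s w) (z w)))"
    by (rule continuous_map_eq[OF continuous_map_tgt[OF z]]) (simp add: ends_contract shape s01)
  show "continuous_map W euclideanreal (\<lambda>w. len (contract (s w) (z w)))"
    unfolding contract_def mk_strip_simps by (intro continuous_intros s continuous_map_len[OF z])
  have ne: "(1 - s (fst v)) * len (z (fst v)) + s (fst v) \<noteq> 0"
    if "v \<in> topspace (prod_topology W (euclidean :: (real \<times> real) topology))" for v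
    using that contract_len_pos[of "s (fst v)" "len (z (fst v))"] s01[of "fst v"]
      strip_shapeD(1)[OF shape[of "fst v"]] by (metis mem_Sigma_iff order_less_irrefl prod.collapse topspace_prod_topology)
  show "continuous_map (prod_topology W euclidean) X
      (\<lambda>v. ev (contract (s (fst v)) (z (fst v))) (fst (snd v), snd (snd v)))"
    unfolding contract_def mk_strip_simps prod.case
    by (intro continuous_map_ev continuous_map_diff continuous_map_add continuous_map_real_mult
        continuous_map_real_divide continuous_map_real_max continuous_map_real_min
        continuous_map_of_fst[OF continuous_map_len[OF z]] continuous_map_of_fst z s
        continuous_map_fst_snd ne)
      simp_all
qed

text \<open>With a one-point parameter space, each continuity lemma for an operation says that the
  operation preserves strips.\<close>

lemma strip_iff_continuous_map:
  "strip X z \<longleftrightarrow> continuous_map (discrete_topology {()}) (strips X) (\<lambda>_. z)"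
  using continuous_map_strip[of "discrete_topology {()}" X "\<lambda>_. z" "()"] by auto

lemma strip_shape_strip: "strip X z \<Longrightarrow> strip_shape z"
  by (simp add: strip_def)

lemma strip_cat: "strip X y \<Longrightarrow> strip X z \<Longrightarrow> tgt y = src z \<Longrightarrow> strip X (cat y z)"
  unfolding strip_iff_continuous_map by (rule continuous_map_cat)

lemma strip_top: "strip X z \<Longrightarrow> strip X (top_strip z)"
  unfolding strip_iff_continuous_map by (rule continuous_map_top)

lemma strip_const: "x \<in> topspace X \<Longrightarrow> 0 < r \<Longrightarrow> strip X (const_strip r x)"
  unfolding strip_iff_continuous_map by (rule continuous_map_const) auto


section \<open>Chains and their faces\<close>

text \<open>The point of \<open>X\<close> at dot \<open>i\<close>. After the first dot it is the
  target of the preceding strip, so that \<open>src (snd w i) = vert w i\<close> expresses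
  composability.\<close>

definition vert :: "'a moore_chain \<Rightarrow> nat \<Rightarrow> 'a" where
  "vert w i = (case i of 0 \<Rightarrow> fst w | Suc j \<Rightarrow> tgt (snd w j))"

lemma vert_simps [simp]: "vert w 0 = fst w" "vert w (Suc j) = tgt (snd w j)"
  by (simp_all add: vert_def)

definition linked :: "fat_obj \<Rightarrow> nat \<Rightarrow> bool" where
  "linked e i \<longleftrightarrow> proj e i = proj e (Suc i)"

definition chains :: "'a topology \<Rightarrow> fat_obj \<Rightarrow> 'a moore_chain set" where
  "chains X e = {w. fst w \<in> topspace X \<and> snd w \<in> extensional {..<dots e} \<and>
     (\<forall>i<dots e. strip X (snd w i) \<and> src (snd w i) = vert w i \<and>
        (if linked e i then null_strip (snd w i) else flat_strip (snd w i)))}"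

definition chain_space :: "'a topology \<Rightarrow> fat_obj \<Rightarrow> 'a moore_chain topology" where
  "chain_space X e = subtopology
     (prod_topology (discrete_topology (topspace X)) (product_topology (\<lambda>_. strips X) {..<dots e}))
     (chains X e)"

lemma chainsD:
  assumes "w \<in> chains X e"
  shows "fst w \<in> topspace X" "snd w \<in> extensional {..<dots e}"
    "\<And>i. i < dots e \<Longrightarrow> strip X (snd w i)" "\<And>i. i < dots e \<Longrightarrow> src (snd w i) = vert w i"
    "\<And>i. i < dots e \<Longrightarrow> linked e i \<Longrightarrow> null_strip (snd w i)"
    "\<And>i. i < dots e \<Longrightarrow> \<not> linked e i \<Longrightarrow> flat_strip (snd w i)"
    "\<And>i. i < dots e \<Longrightarrow> strip_shape (snd w i)"
  using assms strip_shape_strip unfolding chains_def by (auto split: if_splits)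

lemma vert_in: "w \<in> chains X e \<Longrightarrow> i \<le> dots e \<Longrightarrow> vert w i \<in> topspace X"
  by (cases i) (simp_all add: chainsD strip_ends_in)

lemma chain_eqI:
  assumes "w \<in> chains X e" "v \<in> chains X e" "fst w = fst v" "\<And>i. i < dots e \<Longrightarrow> snd w i = snd v i"
  shows "w = v"
proof -
  have "snd w = snd v"
    using assms(4) by (intro extensionalityI[OF chainsD(2)[OF assms(1)] chainsD(2)[OF assms(2)]]) auto
  then show ?thesis using assms(3) by (simp add: prod_eq_iff)
qed

lemma topspace_chain_space [simp]: "topspace (chain_space X e) = chains X e"
  unfolding chain_space_def topspace_subtopology
  using chainsD(1-3) by (fastforce simp: PiE_iff mem_Times_iff)

lemma continuous_map_chain_space_iff:
  "continuous_map W (chain_space X e) h \<longleftrightarrow> (\<forall>w\<in>topspace W. h w \<in> chains X e) \<and>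
     continuous_map W (discrete_topology (topspace X)) (\<lambda>w. fst (h w)) \<and>
     (\<forall>i<dots e. continuous_map W (strips X) (\<lambda>w. snd (h w) i))"
  unfolding chain_space_def continuous_map_in_subtopology continuous_map_pairwise
    continuous_map_componentwise o_def
  by (auto simp: image_subset_iff chainsD)

lemma continuous_map_chain:
  assumes "continuous_map W (chain_space X e) h"
  shows "w \<in> topspace W \<Longrightarrow> h w \<in> chains X e"
    and "i < dots e \<Longrightarrow> continuous_map W (strips X) (\<lambda>w. snd (h w) i)"
    and "i \<le> dots e \<Longrightarrow> continuous_map W (discrete_topology (topspace X)) (\<lambda>w. vert (h w) i)"
proof -
  note h = assms[unfolded continuous_map_chain_space_iff]
  show "w \<in> topspace W \<Longrightarrow> h w \<in> chains X e"
    "i < dots e \<Longrightarrow> continuous_map W (strips X) (\<lambda>w. snd (h w) i)"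
    using h by blast+
  show "i \<le> dots e \<Longrightarrow> continuous_map W (discrete_topology (topspace X)) (\<lambda>w. vert (h w) i)"
    using h by (cases i) (simp_all add: continuous_map_tgt)
qed

section \<open>Composites over intervals of gaps\<close>

text \<open>For \<open>p < q\<close> this is the composite of the entries from \<open>p\<close> to
  \<open>q - 1\<close>. The other values are placeholders, as no strip of length 0 exists to serve
  as an empty composite.\<close>

primrec joins :: "(nat \<Rightarrow> 'a strip) \<Rightarrow> nat \<Rightarrow> nat \<Rightarrow> 'a strip" where
  "joins s p 0 = s p"
| "joins s p (Suc q) = (if q \<le> p then s p else cat (joins s p q) (s q))"

lemma joins_chain:
  assumes w: "w \<in> chains X e" and "p < q" "q \<le> dots e"
  shows "strip X (joins (snd w) p q)" "src (joins (snd w) p q) = vert w p"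
    "tgt (joins (snd w) p q) = vert w q"
    "(\<And>i. p \<le> i \<Longrightarrow> i < q \<Longrightarrow> linked e i) \<Longrightarrow> null_strip (joins (snd w) p q)"
proof -
  have "strip X (joins (snd w) p q) \<and> src (joins (snd w) p q) = vert w p \<and>
    tgt (joins (snd w) p q) = vert w q \<and>
    ((\<forall>i. p \<le> i \<longrightarrow> i < q \<longrightarrow> linked e i) \<longrightarrow> null_strip (joins (snd w) p q))"
    using assms(2,3)
  proof (induction q)
    case (Suc q)
    show ?case
    proof (cases "q = p")
      case True
      then show ?thesis using Suc.prems chainsD[OF w] by simp
    next
      case False
      then have "strip_shape (joins (snd w) p q)" using Suc strip_shape_strip by force
      then show ?thesis
        using False Suc chainsD[OF w] by (simp add: strip_cat src_cat tgt_cat null_strip_cat)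
    qed
  qed simp
  then show "strip X (joins (snd w) p q)" "src (joins (snd w) p q) = vert w p"
    "tgt (joins (snd w) p q) = vert w q"
    "(\<And>i. p \<le> i \<Longrightarrow> i < q \<Longrightarrow> linked e i) \<Longrightarrow> null_strip (joins (snd w) p q)" by blast+
qed

text \<open>Strict associativity reassembles adjacent composites; the functoriality of
  \<open>face\<close> rests on this.\<close>

lemma joins_cat:
  assumes w: "w \<in> chains X e" and "p < q" "q < r" "r \<le> dots e"
  shows "cat (joins (snd w) p q) (joins (snd w) q r) = joins (snd w) p r"
  using assms(3,4)
proof (induction r)
  case (Suc r)
  show ?case
  proof (cases "r = q")
    case True
    then show ?thesis using \<open>p < q\<close> by simp
  next
    case False
    then have "joins (snd w) p (Suc r) = cat (cat (joins (snd w) p q) (joins (snd w) q r)) (snd w r)"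
      using Suc \<open>p < q\<close> by simp
    also have "\<dots> = cat (joins (snd w) p q) (cat (joins (snd w) q r) (snd w r))"
      using False Suc.prems \<open>p < q\<close> joins_chain(1)[OF w, of q r] chainsD(7)[OF w, of r]
      by (intro cat_assoc) (auto dest: strip_shape_strip strip_shapeD(1))
    finally show ?thesis using False Suc.prems by simp
  qed
qed simp

lemma continuous_map_joins:
  assumes h: "continuous_map W (chain_space X e) h" and "p < q" "q \<le> dots e"
  shows "continuous_map W (strips X) (\<lambda>w. joins (snd (h w)) p q)"
  using assms(2,3)
proof (induction q)
  case (Suc q)
  show ?case
  proof (cases "q = p")
    case True
    then show ?thesis using Suc.prems continuous_map_chain(2)[OF h] by simp
  next
    case False
    have "continuous_map W (strips X) (\<lambda>w. cat (joins (snd (h w)) p q) (snd (h w) q))"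
      using False Suc
      by (intro continuous_map_cat continuous_map_chain(2)[OF h])
        (auto simp: joins_chain(3)[OF continuous_map_chain(1)[OF h]]
          chainsD(4)[OF continuous_map_chain(1)[OF h]])
    then show ?thesis using False Suc.prems by simp
  qed
qed simp

text \<open>The first argument of \<open>retop\<close> says whether the strip sits on a linked pair of dots; otherwise
  only its top side matters.\<close>

definition retop :: "bool \<Rightarrow> 'a strip \<Rightarrow> 'a strip" where
  "retop l z = (if l then z else top_strip z)"

text \<open>The condition \<open>l \<Longrightarrow> k\<close> excludes the one bad case, in which a
  strip should be kept whose heights have already been forgotten.\<close>

lemma retop_simps:
  "retop l (cat y z) = cat (retop l y) (retop l z)" "(l \<Longrightarrow> k) \<Longrightarrow> retop l (retop k z) = retop l z"
  by (simp_all add: retop_def top_cat)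

lemma retop_strip:
  assumes "strip X z"
  shows "strip X (retop l z)" "src (retop l z) = src z" "tgt (retop l z) = tgt z"
  using assms by (auto simp: retop_def strip_top ends_top strip_shape_strip)

section \<open>The action of arrows on chains\<close>

text \<open>An unlinked gap may run over linked ones, whose loops then count as Moore paths;
  \<open>retop\<close> forgets their null-homotopies.\<close>

definition face :: "fat_arr \<Rightarrow> 'a moore_chain \<Rightarrow> 'a moore_chain" where
  "face a w = (vert w (fmap a 0), \<lambda>i\<in>{..<dots (fdom a)}.
     retop (linked (fdom a) i) (joins (snd w) (fmap a i) (fmap a (Suc i))))"

lemma snd_face:
  "i < dots (fdom a) \<Longrightarrow>
     snd (face a w) i = retop (linked (fdom a) i) (joins (snd w) (fmap a i) (fmap a (Suc i)))"
  by (simp add: face_def)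

lemma fat_arrD:
  assumes "is_fat_arr a"
  shows "is_fat_obj (fdom a)" "is_fat_obj (fcod a)"
    "\<And>i. i \<le> dots (fdom a) \<Longrightarrow> fmap a i \<le> dots (fcod a)"
    "\<And>i j. i < j \<Longrightarrow> j \<le> dots (fdom a) \<Longrightarrow> fmap a i < fmap a j"
    "\<And>i. i \<le> dots (fdom a) \<Longrightarrow> gmap a (proj (fdom a) i) = proj (fcod a) (fmap a i)"
  using assms by (auto simp: is_fat_arr_iff)

lemma linked_between:
  assumes e: "is_fat_obj e" and "proj e p = proj e q" "p \<le> i" "i < q" "q \<le> dots e"
  shows "linked e i"
proof -
  have "proj e p \<le> proj e i" "proj e i \<le> proj e (Suc i)" "proj e (Suc i) \<le> proj e q"
    using assms(3-5) by (auto intro!: fat_objD(2)[OF e])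
  then show ?thesis using assms(2) by (simp add: linked_def)
qed

text \<open>The commuting square sends two dots of one column into one column, and all gaps between
  the images are then linked. Hence a linked gap composes only null-homotopic loops.\<close>

lemma linked_image:
  assumes a: "is_fat_arr a" and i: "i < dots (fdom a)" "linked (fdom a) i"
    and j: "fmap a i \<le> j" "j < fmap a (Suc i)"
  shows "linked (fcod a) j"
proof (rule linked_between[OF fat_arrD(2)[OF a] _ j])
  show "proj (fcod a) (fmap a i) = proj (fcod a) (fmap a (Suc i))"
    using i fat_arrD(5)[OF a, of i] fat_arrD(5)[OF a, of "Suc i"] by (simp add: linked_def)
qed (use fat_arrD(3)[OF a] i in simp)

lemma vert_face:
  assumes a: "is_fat_arr a" and w: "w \<in> chains X (fcod a)" and i: "i \<le> dots (fdom a)"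
  shows "vert (face a w) i = vert w (fmap a i)"
proof (cases i)
  case (Suc j)
  then show ?thesis
    using i fat_arrD[OF a] joins_chain[OF w, of "fmap a j" "fmap a (Suc j)"]
    by (simp add: snd_face retop_strip)
qed (simp add: face_def)

lemma face_in_chains:
  assumes a: "is_fat_arr a" and w: "w \<in> chains X (fcod a)"
  shows "face a w \<in> chains X (fdom a)"
proof -
  have *: "strip X (snd (face a w) i) \<and> src (snd (face a w) i) = vert (face a w) i \<and>
      (if linked (fdom a) i then null_strip (snd (face a w) i) else flat_strip (snd (face a w) i))"
    if i: "i < dots (fdom a)" for i
  proof -
    have less: "fmap a i < fmap a (Suc i)" "fmap a (Suc i) \<le> dots (fcod a)"
      using i fat_arrD[OF a] by auto
    note j = joins_chain[OF w less]
    have "null_strip (joins (snd w) (fmap a i) (fmap a (Suc i)))" if "linked (fdom a) i"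
      using linked_image[OF a i that] by (rule j(4))
    then show ?thesis
      using i j by (auto simp: snd_face vert_face[OF a w] retop_strip) (auto simp: retop_def flat_top)
  qed
  have "fst (face a w) \<in> topspace X"
    using vert_in[OF w] fat_arrD(3)[OF a, of 0] by (simp add: face_def)
  moreover have "snd (face a w) \<in> extensional {..<dots (fdom a)}" by (simp add: face_def)
  ultimately show ?thesis using * by (simp add: chains_def)
qed

lemma continuous_map_face:
  assumes a: "is_fat_arr a"
  shows "continuous_map (chain_space X (fcod a)) (chain_space X (fdom a)) (face a)"
  unfolding continuous_map_chain_space_iff
proof (intro conjI ballI allI impI)
  note id = continuous_map_id[unfolded id_def, of "chain_space X (fcod a)"]
  show "face a w \<in> chains X (fdom a)" if "w \<in> topspace (chain_space X (fcod a))" for w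
    using that face_in_chains[OF a] by simp
  show "continuous_map (chain_space X (fcod a)) (discrete_topology (topspace X)) (\<lambda>w. fst (face a w))"
    using continuous_map_chain(3)[OF id] fat_arrD(3)[OF a, of 0] by (simp add: face_def)
  fix i assume i: "i < dots (fdom a)"
  then have less: "fmap a i < fmap a (Suc i)" "fmap a (Suc i) \<le> dots (fcod a)"
    using i fat_arrD[OF a] by auto
  show "continuous_map (chain_space X (fcod a)) (strips X) (\<lambda>w. snd (face a w) i)"
    using continuous_map_joins[OF id less] continuous_map_top[OF continuous_map_joins[OF id less]]
    by (simp add: snd_face[OF i] retop_def)
qed

text \<open>Nothing is composed when neighbouring dots stay neighbours, and flattening changes
  nothing either, since an entry over an unlinked gap is already flat. Covers identities and both
  inclusions into a sum.\<close>

lemma snd_face_step: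
  assumes w: "w \<in> chains X (fcod a)" and i: "i < dots (fdom a)"
    and step: "fmap a (Suc i) = Suc (fmap a i)" "fmap a i < dots (fcod a)"
    and l: "linked (fdom a) i \<longleftrightarrow> linked (fcod a) (fmap a i)"
  shows "snd (face a w) i = snd w (fmap a i)"
  using chainsD(6,7)[OF w step(2)] l by (simp add: snd_face[OF i] step retop_def top_flat)

lemma face_id:
  assumes e: "is_fat_obj e" and w: "w \<in> chains X e"
  shows "face (fat_id e) w = w"
proof (rule chain_eqI)
  show "face (fat_id e) w \<in> chains X e"
    using face_in_chains[OF is_fat_arr_id[OF e]] w by (simp add: fat_id_def)
  show "snd (face (fat_id e) w) i = snd w i" if "i < dots e" for i
    using snd_face_step[of w X "fat_id e" i] w that by (simp add: fat_id_def)
qed (use w in \<open>simp_all add: face_def fat_id_def\<close>)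

text \<open>Flattening commutes with composition, so a final flattening absorbs all those done by
  the inner face; without a final flattening, \<open>l\<close> ensures that the inner face did not
  flatten any gap in between.\<close>

lemma retop_joins_face:
  assumes a: "is_fat_arr a" and w: "w \<in> chains X (fcod a)" and "p < q" "q \<le> dots (fdom a)"
    and l: "\<And>i. l \<Longrightarrow> p \<le> i \<Longrightarrow> i < q \<Longrightarrow> linked (fdom a) i"
  shows "retop l (joins (snd (face a w)) p q) = retop l (joins (snd w) (fmap a p) (fmap a q))"
  using assms(3-)
proof (induction q)
  case (Suc q)
  have q: "retop l (snd (face a w) q) = retop l (joins (snd w) (fmap a q) (fmap a (Suc q)))"
    using Suc.prems by (simp add: snd_face retop_simps(2))
  show ?case
  proof (cases "q = p")
    case True
    then show ?thesis using q by simp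
  next
    case False
    then have "retop l (joins (snd (face a w)) p (Suc q)) =
        cat (retop l (joins (snd w) (fmap a p) (fmap a q)))
          (retop l (joins (snd w) (fmap a q) (fmap a (Suc q))))"
      using Suc q by (simp add: retop_simps)
    also have "\<dots> = retop l (joins (snd w) (fmap a p) (fmap a (Suc q)))"
      using False Suc.prems fat_arrD(3,4)[OF a]
      by (simp add: retop_simps(1)[symmetric] joins_cat[OF w])
    finally show ?thesis .
  qed
qed simp

lemma face_comp:
  assumes a: "is_fat_arr a" and b: "is_fat_arr b" and ab: "fcod a = fdom b"
    and w: "w \<in> chains X (fcod b)"
  shows "face (fat_comp b a) w = face a (face b w)"
proof (rule chain_eqI)
  have c: "fdom (fat_comp b a) = fdom a" "fcod (fat_comp b a) = fcod b"
    "\<And>i. i \<le> dots (fdom a) \<Longrightarrow> fmap (fat_comp b a) i = fmap b (fmap a i)"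
    by (simp_all add: fat_comp_def)
  have bw: "face b w \<in> chains X (fcod a)" using face_in_chains[OF b w] ab by simp
  show "face (fat_comp b a) w \<in> chains X (fdom a)"
    using face_in_chains[OF is_fat_arr_comp[OF a b ab]] w c by simp
  show "face a (face b w) \<in> chains X (fdom a)" using face_in_chains[OF a bw] .
  show "fst (face (fat_comp b a) w) = fst (face a (face b w))"
    using vert_face[OF b w, of "fmap a 0"] fat_arrD(3)[OF a, of 0] c ab by (simp add: face_def)
  fix i assume i: "i < dots (fdom a)"
  then have less: "fmap a i < fmap a (Suc i)" "fmap a (Suc i) \<le> dots (fdom b)"
    using i fat_arrD[OF a] ab by auto
  have "retop (linked (fdom a) i) (joins (snd (face b w)) (fmap a i) (fmap a (Suc i))) =
    retop (linked (fdom a) i) (joins (snd w) (fmap b (fmap a i)) (fmap b (fmap a (Suc i))))"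
    using linked_image[OF a i] ab by (intro retop_joins_face[OF b w less]) simp
  then show "snd (face (fat_comp b a) w) i = snd (face a (face b w)) i"
    using i c by (simp add: snd_face)
qed

lemma fat_functor_chain_space: "fat_functor (chain_space X) face"
  unfolding fat_functor_def by (auto simp: continuous_map_face face_id face_comp)

section \<open>The pushout condition\<close>

lemma linked_sum:
  "i < dots m \<Longrightarrow> linked (m \<dotplus> n) i = linked m i"
  "is_fat_obj m \<Longrightarrow> is_fat_obj n \<Longrightarrow> i < dots n \<Longrightarrow> linked (m \<dotplus> n) (dots m + i) = linked n i"
  using proj_fat_sum(2)[of m n "Suc i"] by (simp_all add: linked_def proj_fat_sum)

lemma face_sum:
  assumes m: "is_fat_obj m" and n: "is_fat_obj n" and w: "w \<in> chains X (m \<dotplus> n)"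
  shows "fst (face (sum_left m n) w) = fst w" "fst (face (sum_right m n) w) = vert w (dots m)"
    "\<And>i. i < dots m \<Longrightarrow> snd (face (sum_left m n) w) i = snd w i"
    "\<And>i. i < dots n \<Longrightarrow> snd (face (sum_right m n) w) i = snd w (dots m + i)"
proof -
  show "fst (face (sum_left m n) w) = fst w" "fst (face (sum_right m n) w) = vert w (dots m)"
    by (simp_all add: face_def sum_left_def sum_right_def)
  show "snd (face (sum_left m n) w) i = snd w i" if "i < dots m" for i
    using that w snd_face_step[of w X "sum_left m n" i] by (simp add: sum_left_def linked_sum)
  show "snd (face (sum_right m n) w) i = snd w (dots m + i)" if "i < dots n" for i
    using that w snd_face_step[of w X "sum_right m n" i] by (simp add: sum_right_def linked_sum m n)
qed

lemma face_dot:
  "face (first_dot e) w = (fst w, \<lambda>_. undefined)" "face (last_dot e) w = (vert w (dots e), \<lambda>_. undefined)"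
  by (simp_all add: face_def first_dot_def last_dot_def fat_dot_def fun_eq_iff)

text \<open>The inverse \<open>g\<close> juxtaposes two chains. Agreement over the one-dot object
  equates the last vertex of the first with the starting point of the second, which is exactly
  composability at the joint.\<close>

lemma homeomorphic_map_sum:
  assumes m: "is_fat_obj m" and n: "is_fat_obj n"
  shows "homeomorphic_map (chain_space X (m \<dotplus> n))
    (subtopology (prod_topology (chain_space X m) (chain_space X n))
      {(y, z). face (last_dot m) y = face (first_dot n) z})
    (\<lambda>w. (face (sum_left m n) w, face (sum_right m n) w))"
    (is "homeomorphic_map ?S ?T ?f")
proof -
  define g :: "'a moore_chain \<times> 'a moore_chain \<Rightarrow> 'a moore_chain" where
    "g = (\<lambda>(y, z). (fst y, \<lambda>i\<in>{..<dots m + dots n}. if i < dots m then snd y i else snd z (i - dots m)))"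
  have T: "topspace ?T = {(y, z). y \<in> chains X m \<and> z \<in> chains X n \<and> vert y (dots m) = fst z}"
    by (auto simp: face_dot)
  note l = fat_sum_cocone(1)[OF m n] and r = fat_sum_cocone(2)[OF m n]
  have ends: "fdom (sum_left m n) = m" "fcod (sum_left m n) = m \<dotplus> n"
    "fdom (sum_right m n) = n" "fcod (sum_right m n) = m \<dotplus> n"
    by (simp_all add: sum_left_def sum_right_def)
  have vert_g: "i \<le> dots m \<Longrightarrow> vert (g (y, z)) i = vert y i"
    "i \<le> dots n \<Longrightarrow> vert (g (y, z)) (dots m + i) = vert z i"
    if "vert y (dots m) = fst z" for y z i
  proof -
    show 1: "vert (g (y, z)) i = vert y i" if "i \<le> dots m" for i
      using that by (cases i) (simp_all add: g_def)
    show "vert (g (y, z)) (dots m + i) = vert z i" if "i \<le> dots n"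
      using that 1[of "dots m"] \<open>vert y (dots m) = fst z\<close> by (cases i) (simp_all add: g_def)
  qed
  have snd_g: "i < dots m \<Longrightarrow> snd (g (y, z)) i = snd y i"
    "i < dots n \<Longrightarrow> snd (g (y, z)) (dots m + i) = snd z i" for y z i
    by (simp_all add: g_def)
  have split: "(i < dots m \<Longrightarrow> P i) \<Longrightarrow> (\<And>j. j < dots n \<Longrightarrow> P (dots m + j)) \<Longrightarrow> i < dots m + dots n \<Longrightarrow> P i"
    for i P by (metis add_less_cancel_left le_Suc_ex linorder_not_less)
  have g_in: "g (y, z) \<in> chains X (m \<dotplus> n)"
    if y: "y \<in> chains X m" and z: "z \<in> chains X n" and yz: "vert y (dots m) = fst z" for y z
  proof -
    let ?P = "\<lambda>i. strip X (snd (g (y, z)) i) \<and> src (snd (g (y, z)) i) = vert (g (y, z)) i \<and>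
        (if linked (m \<dotplus> n) i then null_strip (snd (g (y, z)) i) else flat_strip (snd (g (y, z)) i))"
    have "?P i" if "i < dots m + dots n" for i
      using that
    proof (rule split[rotated 2])
      show "?P i" if "i < dots m" using that chainsD[OF y] by (simp add: snd_g vert_g[OF yz] linked_sum)
      show "?P (dots m + j)" if "j < dots n" for j
        using that chainsD[OF z] by (simp add: snd_g vert_g[OF yz] linked_sum m n)
    qed
    then show ?thesis using chainsD(1)[OF y] by (simp add: chains_def) (simp add: g_def)
  qed
  have "continuous_map ?S ?T ?f"
    unfolding continuous_map_in_subtopology continuous_map_pairwise o_def fst_conv snd_conv
  proof (intro conjI)
    show "continuous_map ?S (chain_space X m) (face (sum_left m n))"
      "continuous_map ?S (chain_space X n) (face (sum_right m n))"
      using continuous_map_face[OF l] continuous_map_face[OF r] by (simp_all add: ends)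
    have "vert (face (sum_left m n) w) (dots m) = fst (face (sum_right m n) w)"
      if "w \<in> chains X (m \<dotplus> n)" for w
      using that vert_face[OF l, of w X "dots m"] by (simp add: ends face_sum[OF m n]) (simp add: sum_left_def)
    then show "?f \<in> topspace ?S \<rightarrow> {(y, z). face (last_dot m) y = face (first_dot n) z}"
      by (auto simp: face_dot)
  qed
  moreover have "continuous_map ?T ?S g"
    unfolding continuous_map_chain_space_iff
  proof (intro conjI ballI allI impI)
    show "g v \<in> chains X (m \<dotplus> n)" if "v \<in> topspace ?T" for v
      using that g_in unfolding T by auto
    have y: "continuous_map ?T (chain_space X m) fst" and z: "continuous_map ?T (chain_space X n) snd"
      by (intro continuous_map_from_subtopology continuous_map_fst continuous_map_snd)+
    show "continuous_map ?T (discrete_topology (topspace X)) (\<lambda>v. fst (g v))"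
      using continuous_map_chain(3)[OF y, of 0] by (simp add: g_def case_prod_unfold)
    fix i assume "i < dots (m \<dotplus> n)"
    then have "i < dots m + dots n" by simp
    then show "continuous_map ?T (strips X) (\<lambda>v. snd (g v) i)"
    proof (rule split[rotated 2])
      show "continuous_map ?T (strips X) (\<lambda>v. snd (g v) i)" if "i < dots m"
        using continuous_map_chain(2)[OF y that] that by (simp add: g_def case_prod_unfold)
      show "continuous_map ?T (strips X) (\<lambda>v. snd (g v) (dots m + j))" if "j < dots n" for j
        using continuous_map_chain(2)[OF z that] that by (simp add: g_def case_prod_unfold)
    qed
  qed
  moreover have "g (?f w) = w" if w: "w \<in> chains X (m \<dotplus> n)" for w
  proof (rule chain_eqI[OF g_in w])
    show "face (sum_left m n) w \<in> chains X m" "face (sum_right m n) w \<in> chains X n"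
      using face_in_chains[OF l] face_in_chains[OF r] w by (simp_all add: ends)
    show "vert (face (sum_left m n) w) (dots m) = fst (face (sum_right m n) w)"
      using w vert_face[OF l, of w X "dots m"] by (simp add: ends face_sum[OF m n]) (simp add: sum_left_def)
    show "fst (g (?f w)) = fst w" using face_sum[OF m n w] by (simp add: g_def)
    fix i assume "i < dots (m \<dotplus> n)"
    then have "i < dots m + dots n" by simp
    then show "snd (g (?f w)) i = snd w i"
      by (rule split[rotated 2]) (simp_all add: snd_g face_sum[OF m n w])
  qed
  moreover have "?f (g (y, z)) = (y, z)"
    if y: "y \<in> chains X m" and z: "z \<in> chains X n" and yz: "vert y (dots m) = fst z" for y z
  proof -
    note f = face_sum[OF m n g_in[OF y z yz]]
    have "face (sum_left m n) (g (y, z)) = y"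
      using face_in_chains[OF l, of "g (y, z)" X] g_in[OF y z yz]
      by (intro chain_eqI[OF _ y]) (simp_all add: ends f snd_g, simp add: g_def)
    moreover have "face (sum_right m n) (g (y, z)) = z"
      using face_in_chains[OF r, of "g (y, z)" X] g_in[OF y z yz] vert_g(1)[OF yz, of "dots m"] yz
      by (intro chain_eqI[OF _ z]) (simp_all add: ends f snd_g)
    ultimately show ?thesis by simp
  qed
  ultimately have "homeomorphic_maps ?S ?T ?f g"
    unfolding homeomorphic_maps_def T topspace_chain_space by auto
  then show ?thesis unfolding homeomorphic_map_maps by blast
qed

text \<open>Without gaps the product of spaces of strips has no factors, and only the discrete
  starting point is left.\<close>

lemma chain_space_dot:
  "chain_space X fat_dot = discrete_topology (topspace (chain_space X fat_dot))"
proof -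
  have "chain_space X fat_dot =
      subtopology (discrete_topology (topspace X \<times> {\<lambda>_. undefined})) (chains X fat_dot)"
    by (simp add: chain_space_def fat_dot_def product_topology_empty_discrete
        prod_topology_discrete_topology lessThan_0)
  then show ?thesis by (simp add: subtopology_discrete_topology)
qed


section \<open>Vertical arrows\<close>

text \<open>Unless column \<open>j\<close> is the last one, this is the index of the gap through
  which a chain leaves it, hence the place of its \<open>j\<close>-th Moore path.\<close>

definition last_in_col :: "fat_obj \<Rightarrow> nat \<Rightarrow> nat" where
  "last_in_col e j = Max {i. i \<le> dots e \<and> proj e i = j}"

lemma last_in_col:
  assumes e: "is_fat_obj e" and j: "j \<le> cols e"
  shows "last_in_col e j \<le> dots e" "proj e (last_in_col e j) = j"
    "\<And>i. i \<le> dots e \<Longrightarrow> proj e i = j \<Longrightarrow> i \<le> last_in_col e j"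
proof -
  let ?S = "{i. i \<le> dots e \<and> proj e i = j}"
  have fin: "finite ?S" by simp
  moreover have "?S \<noteq> {}" using fat_objD(3)[OF e j] by auto
  ultimately have "Max ?S \<in> ?S" by (rule Max_in)
  then show "last_in_col e j \<le> dots e" "proj e (last_in_col e j) = j"
    by (simp_all add: last_in_col_def)
  show "i \<le> last_in_col e j" if "i \<le> dots e" "proj e i = j" for i
    unfolding last_in_col_def using fin that by (intro Max_ge) auto
qed

text \<open>A skipped column would have to be hit somewhere by surjectivity, but monotonicity
  forbids this both before and after the gap.\<close>

lemma proj_Suc_unlinked:
  assumes e: "is_fat_obj e" and i: "i < dots e" "\<not> linked e i"
  shows "proj e (Suc i) = Suc (proj e i)"
proof (rule ccontr)
  assume ne: "proj e (Suc i) \<noteq> Suc (proj e i)"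
  have "proj e i \<le> proj e (Suc i)" using i fat_objD(2)[OF e, of i "Suc i"] by simp
  then have gap: "Suc (proj e i) < proj e (Suc i)" using ne i by (simp add: linked_def)
  moreover have "proj e (Suc i) \<le> cols e" using i fat_objD(1)[OF e, of "Suc i"] by simp
  ultimately obtain k where k: "k \<le> dots e" "proj e k = Suc (proj e i)"
    using fat_objD(3)[OF e, of "Suc (proj e i)"] by auto
  show False
  proof (cases "k \<le> i")
    case True
    then show False using fat_objD(2)[OF e, of k i] i k by simp
  next
    case False
    then show False using fat_objD(2)[OF e, of "Suc i" k] k gap by simp
  qed
qed

text \<open>Together with \<open>last_in_col_inner\<close> and \<open>col_less\<close> this matches
  unlinked gaps with the columns other than the last.\<close>

lemma last_in_col_unlinked:
  assumes e: "is_fat_obj e" and i: "i < dots e" "\<not> linked e i"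
  shows "last_in_col e (proj e i) = i"
proof (rule antisym)
  have col: "proj e i \<le> cols e" using i fat_objD(1)[OF e, of i] by simp
  show "i \<le> last_in_col e (proj e i)" using i by (intro last_in_col(3)[OF e col]) simp_all
  show "last_in_col e (proj e i) \<le> i"
  proof (rule ccontr)
    assume "\<not> last_in_col e (proj e i) \<le> i"
    then have "proj e (Suc i) \<le> proj e (last_in_col e (proj e i))"
      using last_in_col(1)[OF e col] fat_objD(2)[OF e] by simp
    then show False using last_in_col(2)[OF e col] proj_Suc_unlinked[OF e i] by simp
  qed
qed

lemma last_in_col_inner:
  assumes e: "is_fat_obj e" and j: "j < cols e"
  shows "last_in_col e j < dots e" "\<not> linked e (last_in_col e j)"
proof -
  have col: "j \<le> cols e" using j by simp
  note l = last_in_col[OF e col]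
  show less: "last_in_col e j < dots e"
    using l(1,2) fat_objD(5)[OF e] j by (metis le_neq_implies_less less_irrefl)
  show "\<not> linked e (last_in_col e j)"
    using l(2) l(3)[of "Suc (last_in_col e j)"] less by (auto simp: linked_def)
qed

lemma col_less:
  assumes e: "is_fat_obj e" and i: "i < dots e" "\<not> linked e i"
  shows "proj e i < cols e"
  using proj_Suc_unlinked[OF assms] fat_objD(1)[OF e, of "Suc i"] i by simp

text \<open>All gaps inside a column carry loops, and these return to their base point.\<close>

lemma vert_column:
  assumes e: "is_fat_obj e" and w: "w \<in> chains X e" and "p \<le> q" "q \<le> dots e" "proj e p = proj e q"
  shows "vert w p = vert w q"
  using assms(3-)
proof (induction q rule: dec_induct)
  case (step n)
  have n: "linked e n" using step by (intro linked_between[OF e step.prems(2)]) auto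
  moreover have "proj e p = proj e n" using n step.prems(2) by (simp add: linked_def)
  ultimately have "vert w p = vert w n" using step by simp
  also have "\<dots> = tgt (snd w n)"
    using chainsD(4,5)[OF w, of n] n step.prems by (simp add: null_strip_tgt)
  finally show ?case by simp
qed simp

lemma vert_last_in_col:
  assumes e: "is_fat_obj e" and w: "w \<in> chains X e" and i: "i \<le> dots e"
  shows "vert w (last_in_col e (proj e i)) = vert w i"
  using last_in_col[OF e fat_objD(1)[OF e i]] i by (intro vert_column[OF e w, symmetric]) auto

text \<open>Two objects with equally many columns have chains with the same sequence of Moore paths;
  \<open>transport\<close> keeps this sequence and makes all null-homotopic loops constant.\<close>

definition transport :: "fat_obj \<Rightarrow> fat_obj \<Rightarrow> 'a moore_chain \<Rightarrow> 'a moore_chain" where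
  "transport e e' w = (fst w, \<lambda>i\<in>{..<dots e'}.
     if linked e' i then const_strip 1 (vert w (last_in_col e (proj e' i)))
     else snd w (last_in_col e (proj e' i)))"

lemma snd_transport:
  "i < dots e' \<Longrightarrow> linked e' i \<Longrightarrow>
    snd (transport e e' w) i = const_strip 1 (vert w (last_in_col e (proj e' i)))"
  "i < dots e' \<Longrightarrow> \<not> linked e' i \<Longrightarrow> snd (transport e e' w) i = snd w (last_in_col e (proj e' i))"
  by (simp_all add: transport_def)

context
  fixes e e' :: fat_obj
  assumes e: "is_fat_obj e" and e': "is_fat_obj e'" and cols: "cols e = cols e'"
begin

lemma vert_transport:
  assumes w: "w \<in> chains X e" and i: "i \<le> dots e'"
  shows "vert (transport e e' w) i = vert w (last_in_col e (proj e' i))"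
proof (cases i)
  case 0
  then show ?thesis
    using vert_last_in_col[OF e w, of 0] fat_objD(4)[OF e] fat_objD(4)[OF e'] by (simp add: transport_def)
next
  case (Suc k)
  show ?thesis
  proof (cases "linked e' k")
    case True
    then show ?thesis using Suc i by (simp add: snd_transport) (simp add: linked_def)
  next
    case False
    have k: "k < dots e'" using Suc i by simp
    let ?l = "last_in_col e (proj e' k)"
    have less: "proj e' k < cols e" using col_less[OF e' k False] cols by simp
    then have l: "?l < dots e" "\<not> linked e ?l" "proj e ?l = proj e' k"
      using last_in_col_inner[OF e less] last_in_col(2)[OF e, of "proj e' k"] by auto
    \<comment> \<open>Crossing the unlinked gap raises the column by one in \<open>e\<close> just as
      in \<open>e'\<close>.\<close>
    have "proj e (Suc ?l) = proj e' i"
      using proj_Suc_unlinked[OF e l(1,2)] proj_Suc_unlinked[OF e' k False] l(3) Suc by simp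
    moreover have "vert (transport e e' w) i = vert w (Suc ?l)"
      using Suc k False by (simp add: snd_transport)
    ultimately show ?thesis using vert_last_in_col[OF e w, of "Suc ?l"] l(1) by simp
  qed
qed

lemma transport_strip:
  assumes i: "i < dots e'" "\<not> linked e' i"
  shows "last_in_col e (proj e' i) < dots e" "\<not> linked e (last_in_col e (proj e' i))"
  using last_in_col_inner[OF e, of "proj e' i"] col_less[OF e' i] cols by simp_all

lemma transport_in_chains:
  assumes w: "w \<in> chains X e"
  shows "transport e e' w \<in> chains X e'"
proof -
  have "strip X (snd (transport e e' w) i) \<and> src (snd (transport e e' w) i) = vert (transport e e' w) i \<and>
      (if linked e' i then null_strip (snd (transport e e' w) i) else flat_strip (snd (transport e e' w) i))"
    if i: "i < dots e'" for i
  proof (cases "linked e' i")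
    case True
    have "last_in_col e (proj e' i) \<le> dots e"
      using last_in_col(1)[OF e, of "proj e' i"] fat_objD(1)[OF e', of i] i cols by simp
    from vert_in[OF w this] show ?thesis
      using True i by (simp add: snd_transport vert_transport[OF w] strip_const)
  next
    case False
    note l = transport_strip[OF i False]
    show ?thesis using False i chainsD(3,4,6)[OF w l(1)] l by (simp add: snd_transport vert_transport[OF w])
  qed
  moreover have "snd (transport e e' w) \<in> extensional {..<dots e'}" by (simp add: transport_def)
  moreover have "fst (transport e e' w) \<in> topspace X" using chainsD(1)[OF w] by (simp add: transport_def)
  ultimately show ?thesis by (simp add: chains_def)
qed

lemma continuous_map_transport:
  "continuous_map (chain_space X e) (chain_space X e') (transport e e')"
  unfolding continuous_map_chain_space_iff
proof (intro conjI ballI allI impI)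
  note id = continuous_map_id[unfolded id_def, of "chain_space X e"]
  show "transport e e' w \<in> chains X e'" if "w \<in> topspace (chain_space X e)" for w
    using that transport_in_chains by simp
  show "continuous_map (chain_space X e) (discrete_topology (topspace X)) (\<lambda>w. fst (transport e e' w))"
    using continuous_map_chain(3)[OF id, of 0] by (simp add: transport_def)
  fix i assume i: "i < dots e'"
  show "continuous_map (chain_space X e) (strips X) (\<lambda>w. snd (transport e e' w) i)"
  proof (cases "linked e' i")
    case True
    have "last_in_col e (proj e' i) \<le> dots e"
      using last_in_col(1)[OF e, of "proj e' i"] fat_objD(1)[OF e', of i] i cols by simp
    then show ?thesis
      using True i continuous_map_chain(3)[OF id]
      by (simp add: snd_transport) (intro continuous_map_const, simp_all)
  next
    case False
    have "last_in_col e (proj e' i) < dots e"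
      using last_in_col_inner[OF e, of "proj e' i"] col_less[OF e' i False] cols by simp
    then show ?thesis
      using False i continuous_map_chain(2)[OF id] by (simp add: snd_transport)
  qed
qed

end

text \<open>Only vertices and Moore paths survive a transport, and both are indexed by columns
  alone, so no trace of the intermediate object remains.\<close>

lemma transport_transport:
  assumes e: "is_fat_obj e" and e': "is_fat_obj e'" and e'': "is_fat_obj e''"
    and cols: "cols e = cols e'" "cols e' = cols e''" and w: "w \<in> chains X e"
  shows "transport e' e'' (transport e e' w) = transport e e'' w"
proof (rule chain_eqI)
  note w' = transport_in_chains[OF e e' cols(1) w]
  show "transport e' e'' (transport e e' w) \<in> chains X e''"
    using transport_in_chains[OF e' e'' cols(2) w'] .
  show "transport e e'' w \<in> chains X e''" using transport_in_chains[OF e e'' _ w] cols by simp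
  show "fst (transport e' e'' (transport e e' w)) = fst (transport e e'' w)" by (simp add: transport_def)
  fix i assume i: "i < dots e''"
  have le: "proj e'' i \<le> cols e'" using i fat_objD(1)[OF e'', of i] cols by simp
  note l = last_in_col[OF e' le]
  show "snd (transport e' e'' (transport e e' w)) i = snd (transport e e'' w) i"
  proof (cases "linked e'' i")
    case True
    then show ?thesis using i l by (simp add: snd_transport vert_transport[OF e e' cols(1) w])
  next
    case False
    note transport_strip[OF e' e'' cols(2) i False]
    then show ?thesis using False i l by (simp add: snd_transport)
  qed
qed

section \<open>Homotopies applied entry by entry\<close>

definition modify :: "fat_obj \<Rightarrow> (nat \<Rightarrow> 'a strip \<Rightarrow> 'a strip) \<Rightarrow> 'a moore_chain \<Rightarrow> 'a moore_chain" where
  "modify e m w = (fst w, \<lambda>i\<in>{..<dots e}. m i (snd w i))"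

lemma modify_in_chains:
  assumes w: "w \<in> chains X e"
    and m: "\<And>i. i < dots e \<Longrightarrow> strip X (m i (snd w i)) \<and> src (m i (snd w i)) = src (snd w i) \<and>
      tgt (m i (snd w i)) = tgt (snd w i) \<and>
      (if linked e i then null_strip (m i (snd w i)) else flat_strip (m i (snd w i)))"
  shows "modify e m w \<in> chains X e"
proof -
  have "vert (modify e m w) i = vert w i" if "i \<le> dots e" for i
    using that m by (cases i) (simp_all add: modify_def)
  then show ?thesis using m chainsD(1,4)[OF w] by (simp add: chains_def) (simp add: modify_def)
qed

text \<open>Composability concerns end points only, so homotopies of strips that fix the end points
  and respect the kind of each gap can run in all entries independently.\<close>

lemma homotopic_modify:
  fixes X :: "'a topology"
  defines "W \<equiv> \<lambda>e. prod_topology (top_of_set {0..1::real}) (chain_space X e)"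
  assumes m: "\<And>i s w. i < dots e \<Longrightarrow> w \<in> chains X e \<Longrightarrow> 0 \<le> s \<Longrightarrow> s \<le> 1 \<Longrightarrow>
      src (m s i (snd w i)) = src (snd w i) \<and> tgt (m s i (snd w i)) = tgt (snd w i) \<and>
      (if linked e i then null_strip (m s i (snd w i)) else flat_strip (m s i (snd w i)))"
    and cont: "\<And>i. i < dots e \<Longrightarrow> continuous_map (W e) (strips X) (\<lambda>q. m (fst q) i (snd (snd q) i))"
  shows "homotopic_with (\<lambda>_. True) (chain_space X e) (chain_space X e) (modify e (m 0)) (modify e (m 1))"
proof -
  have "continuous_map (W e) (chain_space X e) (\<lambda>q. modify e (m (fst q)) (snd q))"
    unfolding continuous_map_chain_space_iff
  proof (intro conjI ballI allI impI)
    show "modify e (m (fst q)) (snd q) \<in> chains X e" if q: "q \<in> topspace (W e)" for q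
    proof (rule modify_in_chains)
      have "snd q \<in> chains X e" "0 \<le> fst q" "fst q \<le> 1" using q by (auto simp: W_def)
      then show "strip X (m (fst q) i (snd (snd q) i)) \<and> src (m (fst q) i (snd (snd q) i)) = src (snd (snd q) i) \<and>
          tgt (m (fst q) i (snd (snd q) i)) = tgt (snd (snd q) i) \<and>
          (if linked e i then null_strip (m (fst q) i (snd (snd q) i)) else flat_strip (m (fst q) i (snd (snd q) i)))"
        if "i < dots e" for i
        using continuous_map_strip[OF cont[OF that] q] m[OF that] by blast+
      show "snd q \<in> chains X e" by fact
    qed
    have id: "continuous_map (W e) (chain_space X e) snd" unfolding W_def by (rule continuous_map_snd)
    show "continuous_map (W e) (discrete_topology (topspace X)) (\<lambda>q. fst (modify e (m (fst q)) (snd q)))"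
      using continuous_map_chain(3)[OF id, of 0] by (simp add: modify_def)
    show "continuous_map (W e) (strips X) (\<lambda>q. snd (modify e (m (fst q)) (snd q)) i)" if "i < dots e" for i
      using cont[OF that] that by (simp add: modify_def)
  qed
  then show ?thesis
    unfolding homotopic_with_def W_def
    by (intro exI[of _ "\<lambda>q. modify e (m (fst q)) (snd q)"]) simp
qed

lemma continuous_map_homotopy_arg:
  fixes X :: "'a topology"
  defines "W \<equiv> \<lambda>e. prod_topology (top_of_set {0..1::real}) (chain_space X e)"
  shows "continuous_map (W e) euclideanreal fst"
    and "i < dots e \<Longrightarrow> continuous_map (W e) (strips X) (\<lambda>q. snd (snd q) i)"
proof -
  show "continuous_map (W e) euclideanreal fst"
    unfolding W_def using continuous_map_fst continuous_map_in_subtopology by blast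
  show "continuous_map (W e) (strips X) (\<lambda>q. snd (snd q) i)" if "i < dots e"
    unfolding W_def by (rule continuous_map_chain(2)[OF continuous_map_snd that])
qed

text \<open>All loops are contracted at once and the Moore paths are left alone; a full contraction
  is the constant loop of length 1 that \<open>transport\<close> inserts.\<close>

lemma homotopic_transport_self:
  assumes e: "is_fat_obj e"
  shows "homotopic_with (\<lambda>_. True) (chain_space X e) (chain_space X e) id (transport e e)"
proof -
  define m where "m s i z = (if linked e i then contract s z else z)" for s i and z :: "'a strip"
  have "homotopic_with (\<lambda>_. True) (chain_space X e) (chain_space X e) (modify e (m 0)) (modify e (m 1))"
  proof (rule homotopic_modify)
    fix i assume i: "i < dots e"
    show "src (m s i (snd w i)) = src (snd w i) \<and> tgt (m s i (snd w i)) = tgt (snd w i) \<and>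
      (if linked e i then null_strip (m s i (snd w i)) else flat_strip (m s i (snd w i)))"
      if w: "w \<in> chains X e" and "0 \<le> s" "s \<le> 1" for w :: "'a moore_chain" and s
      using i that chainsD(5-7)[OF w i] by (simp add: m_def ends_contract null_contract)
    show "continuous_map (prod_topology (top_of_set {0..1}) (chain_space X e)) (strips X)
        (\<lambda>q. m (fst q) i (snd (snd q) i))"
    proof (cases "linked e i")
      case True
      then show ?thesis
        unfolding m_def if_P[OF True]
        by (intro continuous_map_contract continuous_map_homotopy_arg i)
            (auto dest!: chainsD(5)[OF _ i])
    qed (simp add: m_def continuous_map_homotopy_arg i)
  qed
  then show ?thesis
  proof (rule homotopic_with_eq)
    fix w assume "w \<in> topspace (chain_space X e)"
    then have w: "w \<in> chains X e" by simp
    have s: "snd w = (\<lambda>i\<in>{..<dots e}. snd w i)"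
      using chainsD(2)[OF w] by (simp add: extensional_restrict)
    have "modify e (m 0) w = (fst w, \<lambda>i\<in>{..<dots e}. snd w i)"
      unfolding modify_def using chainsD(7)[OF w] by (simp add: m_def contract_0 fun_eq_iff)
    then show "id w = modify e (m 0) w" using s by (simp add: prod_eq_iff)
    show "transport e e w = modify e (m 1) w"
      unfolding modify_def transport_def using chainsD(4,5)[OF w] vert_last_in_col[OF e w]
      by (auto simp: m_def contract_1 last_in_col_unlinked[OF e] fun_eq_iff)
  qed simp
qed

section \<open>Composites that contain constant strips\<close>

lemma cat_const:
  "r \<ge> 0 \<Longrightarrow> cat (const_strip r x) (const_strip r' x) = const_strip (r + r') x"
  unfolding cat_def const_strip_def mk_strip_simps by (rule mk_strip_cong) auto

text \<open>A constant strip in front of \<open>z\<close> is \<open>z\<close> itself evaluated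
  before time 0, where it waits at its source.\<close>

lemma cat_const_left: "strip_shape z \<Longrightarrow> cat (const_strip r (src z)) z = pad r 0 z"
  unfolding cat_def pad_def const_strip_simps by (rule mk_strip_cong) (auto simp: strip_shapeD)

lemma cat_const_right:
  "strip_shape z \<Longrightarrow> q \<ge> 0 \<Longrightarrow> cat (pad p q z) (const_strip r (tgt z)) = pad p (q + r) z"
  unfolding cat_def const_strip_simps pad_def mk_strip_simps
  by (rule mk_strip_cong) (auto simp: strip_shapeD)

lemma joins_const:
  assumes "p < q" "\<And>k. p \<le> k \<Longrightarrow> k < q \<Longrightarrow> s k = const_strip 1 x"
  shows "joins s p q = const_strip (real (q - p)) x"
  using assms
proof (induction q)
  case (Suc q)
  show ?case
  proof (cases "q = p")
    case False
    then show ?thesis using Suc by (simp add: cat_const Suc_diff_le of_nat_diff algebra_simps)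
  qed (use Suc.prems in simp)
qed simp

text \<open>One strip among constant loops of length 1: the numbers of loops before and after it
  become waiting times.\<close>

lemma joins_pad:
  assumes z: "strip_shape (s l)" and "p \<le> l" "l < q"
    and "\<And>k. p \<le> k \<Longrightarrow> k < l \<Longrightarrow> s k = const_strip 1 (src (s l))"
    and "\<And>k. l < k \<Longrightarrow> k < q \<Longrightarrow> s k = const_strip 1 (tgt (s l))"
  shows "joins s p q = pad (real (l - p)) (real (q - Suc l)) (s l)"
  using assms(3,5)
proof (induction q)
  case (Suc q)
  show ?case
  proof (cases "q = l")
    case True
    show ?thesis
    proof (cases "p = l")
      case False
      then have "joins s p l = const_strip (real (l - p)) (src (s l))"
        using assms(2,4) by (intro joins_const) auto
      then show ?thesis using True False assms(2) z by (simp add: cat_const_left)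
    qed (use True z in \<open>simp add: pad_0\<close>)
  next
    case False
    then have "joins s p q = pad (real (l - p)) (real (q - Suc l)) (s l)" "l < q" using Suc by auto
    then show ?thesis
      using Suc.prems assms(2) z by (simp add: cat_const_right Suc_diff_Suc of_nat_diff algebra_simps)
  qed
qed simp

text \<open>Contracting all loops first turns the face into a map that differs from the transport
  only in lengths of constant pieces. The second homotopy, in the space over the domain of
  \<open>a\<close>, scales these lengths to those of the normal form.\<close>

lemma homotopic_face_transport:
  assumes a: "is_vertical a"
  shows "homotopic_with (\<lambda>_. True) (chain_space X (fcod a)) (chain_space X (fdom a))
    (face a) (transport (fcod a) (fdom a))"
proof -
  define d c where "d = fdom a" and "c = fcod a"
  have arr: "is_fat_arr a" and cols: "cols d = cols c"
    and proj: "\<And>i. i \<le> dots d \<Longrightarrow> proj c (fmap a i) = proj d i"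
    and mono: "\<And>i j. i < j \<Longrightarrow> j \<le> dots d \<Longrightarrow> fmap a i < fmap a j"
    and bound: "\<And>i. i \<le> dots d \<Longrightarrow> fmap a i \<le> dots c"
    and obj: "is_fat_obj d" "is_fat_obj c"
  proof -
    show arr: "is_fat_arr a" and "cols d = cols c" using a by (simp_all add: is_vertical_def d_def c_def)
    show "\<And>i. i \<le> dots d \<Longrightarrow> fmap a i \<le> dots c" "is_fat_obj d" "is_fat_obj c"
      "\<And>i j. i < j \<Longrightarrow> j \<le> dots d \<Longrightarrow> fmap a i < fmap a j"
      using fat_arrD[OF arr] by (simp_all add: d_def c_def)
    \<comment> \<open>Verticality enters here: every dot keeps its column.\<close>
    show "proj c (fmap a i) = proj d i" if "i \<le> dots d" for i
      using a fat_arrD(5)[OF arr, of i] fat_objD(1)[OF fat_arrD(1)[OF arr], of i] that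
      by (simp add: is_vertical_def d_def c_def)
  qed
  define l where "l i = last_in_col c (proj d i)" for i
  \<comment> \<open>Time 0 is the normal form and time 1 the composite of loops of length 1. A
    linked gap composes \<open>fmap a (Suc i) - fmap a i\<close> loops; an unlinked one has
    \<open>l i - fmap a i\<close> loops before its Moore path and the remaining
    \<open>fmap a (Suc i) - Suc (l i)\<close> after it.\<close>
  define m where "m s i z = (if linked d i
      then const_strip ((1 - s) + s * real (fmap a (Suc i) - fmap a i)) (src z)
      else pad (s * real (l i - fmap a i)) (s * real (fmap a (Suc i) - Suc (l i))) z)"
    for s :: real and i and z :: "'a strip"
  have "homotopic_with (\<lambda>_. True) (chain_space X d) (chain_space X d) (modify d (m 0)) (modify d (m 1))"
  proof (rule homotopic_modify)
    fix i assume i: "i < dots d"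
    show "src (m s i (snd w i)) = src (snd w i) \<and> tgt (m s i (snd w i)) = tgt (snd w i) \<and>
      (if linked d i then null_strip (m s i (snd w i)) else flat_strip (m s i (snd w i)))"
      if w: "w \<in> chains X d" and "0 \<le> s" "s \<le> 1" for w :: "'a moore_chain" and s
      using i that chainsD(5-7)[OF w i] by (simp add: m_def null_strip_tgt ends_pad flat_pad)
    let ?W = "prod_topology (top_of_set {0..1::real}) (chain_space X d)"
    show "continuous_map ?W (strips X) (\<lambda>q. m (fst q) i (snd (snd q) i))"
    proof (cases "linked d i")
      case True
      have "fmap a i < fmap a (Suc i)" using i mono by simp
      then have pos: "0 < (1 - s) + s * real (fmap a (Suc i) - fmap a i)" if "0 \<le> s" "s \<le> 1" for s
        using contract_len_pos[OF that, of "real (fmap a (Suc i) - fmap a i)"]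
          that by (cases "s = 1") (simp_all add: add_pos_nonneg)
      show ?thesis
        unfolding m_def if_P[OF True]
        by (intro continuous_map_const continuous_map_src continuous_map_homotopy_arg i
            continuous_map_add continuous_map_diff continuous_map_real_mult) (auto intro: pos)
    next
      case False
      show ?thesis
        unfolding m_def if_not_P[OF False]
        by (intro continuous_map_pad continuous_map_homotopy_arg i continuous_map_real_mult) auto
    qed
  qed
  from homotopic_with_compose_continuous_map_right[OF this continuous_map_transport[OF obj(2,1) cols[symmetric]]]
  have 1: "homotopic_with (\<lambda>_. True) (chain_space X c) (chain_space X d)
      (modify d (m 0) \<circ> transport c d) (modify d (m 1) \<circ> transport c d)"
    by simp
  have 2: "homotopic_with (\<lambda>_. True) (chain_space X c) (chain_space X d)
      (face a \<circ> id) (face a \<circ> transport c c)"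
    using homotopic_with_compose_continuous_map_left[OF homotopic_transport_self[OF obj(2)], of X "chain_space X d" "face a"]
      continuous_map_face[OF arr, of X] by (simp add: d_def c_def)
  have m0: "modify d (m 0) (transport c d w) = transport c d w" if w: "w \<in> chains X c" for w
  proof -
    have "m 0 i (snd (transport c d w) i) = snd (transport c d w) i" if i: "i < dots d" for i
    proof (cases "linked d i")
      case True
      then show ?thesis using i by (simp add: m_def snd_transport)
    next
      case False
      then show ?thesis
        using i chainsD(7)[OF transport_in_chains[OF obj(2,1) cols[symmetric] w]] by (simp add: m_def pad_0)
    qed
    then show ?thesis
      by (simp add: modify_def prod_eq_iff fun_eq_iff transport_def restrict_def)
  qed
  \<comment> \<open>The two homotopies are joined by this exact equality: composing a contracted
    chain only produces constant strips and padded Moore paths.\<close>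
  have m1: "face a (transport c c w) = modify d (m 1) (transport c d w)" if w: "w \<in> chains X c" for w
  proof -
    note cc = transport_in_chains[OF obj(2,2) refl w] and cd = transport_in_chains[OF obj(2,1) cols[symmetric] w]
    have "fst (face a (transport c c w)) = fst w"
      using vert_transport[OF obj(2,2) refl w bound[of 0]] vert_last_in_col[OF obj(2) w, of 0] proj[of 0]
        fat_objD(4)[OF obj(1)] fat_objD(4)[OF obj(2)] by (simp add: face_def)
    moreover have "snd (face a (transport c c w)) i = m 1 i (snd (transport c d w) i)" if i: "i < dots d" for i
    proof -
      let ?p = "fmap a i" and ?q = "fmap a (Suc i)" and ?s = "snd (transport c c w)"
      have pq: "?p < ?q" "?q \<le> dots c" using i mono bound by auto
      have ip: "proj c ?p = proj d i" "proj c ?q = proj d (Suc i)" using i proj by auto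
      have col: "proj d i \<le> cols c" using i fat_objD(1)[OF obj(1), of i] cols by simp
      show ?thesis
      proof (cases "linked d i")
        case True
        have "?s k = const_strip 1 (vert w (l i))" if k: "?p \<le> k" "k < ?q" for k
        proof -
          have "linked c k"
            using ip True by (intro linked_between[OF obj(2) _ k pq(2)]) (simp add: linked_def)
          moreover have "proj c k = proj d i"
            using fat_objD(2)[OF obj(2), of ?p k] fat_objD(2)[OF obj(2), of k ?q] k pq ip True
            by (simp add: linked_def)
          ultimately show ?thesis using k pq by (simp add: snd_transport l_def)
        qed
        then have "joins ?s ?p ?q = const_strip (real (?q - ?p)) (vert w (l i))"
          by (rule joins_const[OF pq(1)])
        then show ?thesis
          using i True by (simp add: snd_face[of i a, folded d_def] m_def snd_transport l_def retop_def)
      next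
        case False
        have S: "proj d (Suc i) = Suc (proj d i)" using proj_Suc_unlinked[OF obj(1) i False] .
        have less: "proj d i < cols c" using col_less[OF obj(1) i False] cols by simp
        have L: "l i < dots c" "\<not> linked c (l i)" "proj c (l i) = proj d i"
          using last_in_col_inner[OF obj(2) less] last_in_col(2)[OF obj(2) col] by (simp_all add: l_def)
        have SL: "proj c (Suc (l i)) = Suc (proj d i)" using proj_Suc_unlinked[OF obj(2) L(1,2)] L(3) by simp
        have pl: "?p \<le> l i" using last_in_col(3)[OF obj(2) col, of ?p] ip pq by (simp add: l_def)
        have lq: "l i < ?q"
        proof (rule ccontr)
          assume "\<not> l i < ?q"
          then have "proj c ?q \<le> proj c (l i)" using fat_objD(2)[OF obj(2)] L(1) by simp
          then show False using ip S L(3) by simp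
        qed
        have sl: "?s (l i) = snd w (l i)" using L by (simp add: snd_transport l_def)
        \<comment> \<open>The only unlinked gap between \<open>?p\<close> and \<open>?q\<close> is
          \<open>l i\<close>: earlier gaps lie inside the column of \<open>?p\<close>, later ones
          inside that of \<open>?q\<close>.\<close>
        have "joins ?s ?p ?q = pad (real (l i - ?p)) (real (?q - Suc (l i))) (?s (l i))"
        proof (rule joins_pad[OF _ pl lq])
          show "strip_shape (?s (l i))" using chainsD(7)[OF cc L(1)] .
          show "?s k = const_strip 1 (src (?s (l i)))" if k: "?p \<le> k" "k < l i" for k
          proof -
            have "proj c k = proj d i"
              using fat_objD(2)[OF obj(2), of ?p k] fat_objD(2)[OF obj(2), of k "l i"] k L ip by simp
            moreover have "linked c k"
              using ip L by (intro linked_between[OF obj(2) _ k]) simp_all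
            ultimately show ?thesis
              using k L chainsD(4)[OF w L(1)] by (simp add: snd_transport sl flip: l_def)
          qed
          show "?s k = const_strip 1 (tgt (?s (l i)))" if k: "l i < k" "k < ?q" for k
          proof -
            have "proj c k = Suc (proj d i)"
              using fat_objD(2)[OF obj(2), of "Suc (l i)" k] fat_objD(2)[OF obj(2), of k ?q] k SL S ip pq by simp
            moreover have "linked c k"
              using ip S SL k pq by (intro linked_between[OF obj(2), of "Suc (l i)" ?q]) simp_all
            moreover have "vert w (last_in_col c (Suc (proj d i))) = tgt (snd w (l i))"
              using vert_last_in_col[OF obj(2) w, of "Suc (l i)"] SL L(1) by simp
            ultimately show ?thesis using k pq by (simp add: snd_transport sl)
          qed
        qed
        moreover have "flat_strip (snd w (l i))" "strip_shape (snd w (l i))"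
          using chainsD(6,7)[OF w L(1)] L(2) by simp_all
        ultimately show ?thesis
          using i False by (simp add: snd_face[of i a, folded d_def] m_def snd_transport retop_def sl
              top_flat flat_pad strip_shape_pad flip: l_def)
      qed
    qed
    ultimately show ?thesis
      using face_in_chains[OF arr, of _ X] cc
      by (simp add: modify_def prod_eq_iff transport_def face_def fun_eq_iff d_def c_def)
  qed
  have "homotopic_with (\<lambda>_. True) (chain_space X c) (chain_space X d) (face a) (modify d (m 1) \<circ> transport c d)"
    using 2 by (rule homotopic_with_eq) (simp_all add: m1)
  moreover have "homotopic_with (\<lambda>_. True) (chain_space X c) (chain_space X d)
      (modify d (m 1) \<circ> transport c d) (transport c d)"
    using 1 by (subst homotopic_with_sym, rule homotopic_with_eq) (simp_all add: m0)
  ultimately have "homotopic_with (\<lambda>_. True) (chain_space X c) (chain_space X d) (face a) (transport c d)"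
    by (rule homotopic_with_trans)
  then show ?thesis by (simp add: d_def c_def)
qed

text \<open>The homotopy inverse is \<open>transport d c\<close>. With the face replaced by
  \<open>transport c d\<close>, both composites are transports from an object to itself, hence
  homotopic to the identity.\<close>

lemma homotopy_equivalence_face:
  assumes a: "is_vertical a"
  shows "homotopy_equivalence_map (chain_space X (fcod a)) (chain_space X (fdom a)) (face a)"
proof -
  define d c where "d = fdom a" and "c = fcod a"
  have arr: "is_fat_arr a" and cols: "cols d = cols c" using a by (simp_all add: is_vertical_def d_def c_def)
  have d: "is_fat_obj d" and c: "is_fat_obj c" using fat_arrD(1,2)[OF arr] by (simp_all add: d_def c_def)
  note hom = homotopic_face_transport[OF a, of X, folded d_def c_def]
  note cont = continuous_map_transport[OF d c cols, of X]
  have "homotopic_with (\<lambda>_. True) (chain_space X c) (chain_space X c) (transport d c \<circ> face a) (transport d c \<circ> transport c d)"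
    using hom cont by (rule homotopic_with_compose_continuous_map_left) simp
  moreover have "homotopic_with (\<lambda>_. True) (chain_space X c) (chain_space X c) (transport d c \<circ> transport c d) id"
    using homotopic_transport_self[OF c, of X]
    by (subst homotopic_with_sym, rule homotopic_with_eq) (simp_all add: transport_transport[OF c d c] cols)
  ultimately have 1: "homotopic_with (\<lambda>_. True) (chain_space X c) (chain_space X c) (transport d c \<circ> face a) id"
    by (rule homotopic_with_trans)
  have "homotopic_with (\<lambda>_. True) (chain_space X d) (chain_space X d) (face a \<circ> transport d c) (transport c d \<circ> transport d c)"
    using hom cont by (rule homotopic_with_compose_continuous_map_right) simp
  moreover have "homotopic_with (\<lambda>_. True) (chain_space X d) (chain_space X d) (transport c d \<circ> transport d c) id"
    using homotopic_transport_self[OF d, of X]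
    by (subst homotopic_with_sym, rule homotopic_with_eq) (simp_all add: transport_transport[OF d c d] cols)
  ultimately have 2: "homotopic_with (\<lambda>_. True) (chain_space X d) (chain_space X d) (face a \<circ> transport d c) id"
    by (rule homotopic_with_trans)
  show ?thesis
    using continuous_map_face[OF arr, of X] cont 1 2
    unfolding homotopy_equivalence_map_def d_def c_def by blast
qed

lemma fair_category_chain_space: "fair_category (chain_space X) face"
  unfolding fair_category_def
  by (intro conjI allI impI fat_functor_chain_space homotopy_equivalence_face chain_space_dot
      homeomorphic_map_sum) auto


section \<open>Moore paths and null-homotopic loops as strips\<close>

lemma mem_triangle_iff:
  assumes "0 < r"
  shows "(a, b) \<in> triangle r \<longleftrightarrow> 0 \<le> a \<and> a \<le> r * b \<and> b \<le> 1"
proof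
  assume "(a, b) \<in> triangle r"
  then obtain u v w where "0 \<le> u" "0 \<le> v" "0 \<le> w" "u + v + w = 1" "a = w * r" "b = v + w"
    unfolding triangle_def convex_hull_3 by auto
  then show "0 \<le> a \<and> a \<le> r * b \<and> b \<le> 1"
    using assms by (auto simp: algebra_simps)
next
  assume ab: "0 \<le> a \<and> a \<le> r * b \<and> b \<le> 1"
  then have "a / r \<le> b" using assms by (simp add: pos_divide_le_eq mult.commute)
  \<comment> \<open>Barycentric coordinates: only the corner \<open>(r, 1)\<close> contributes to
    the abscissa, so its weight is \<open>a / r\<close>, and the corner \<open>(0, 1)\<close>
    supplies the rest of the height.\<close>
  then show "(a, b) \<in> triangle r"
    unfolding triangle_def convex_hull_3 using ab assms
    by (intro CollectI exI[of _ "1 - b"] exI[of _ "b - a / r"] exI[of _ "a / r"]) auto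
qed

lemma mem_triangleD:
  assumes "(a, b) \<in> triangle r" "0 < r"
  shows "0 \<le> a" "a \<le> r * b" "0 \<le> b" "b \<le> 1" "b = 0 \<Longrightarrow> a = 0"
proof -
  have *: "0 \<le> a" "a \<le> r * b" "b \<le> 1" using assms by (simp_all add: mem_triangle_iff)
  then show "0 \<le> a" "a \<le> r * b" "b \<le> 1" "b = 0 \<Longrightarrow> a = 0" by auto
  have "0 \<le> r * b" using * by simp
  then show "0 \<le> b" using assms(2) by (simp add: zero_le_mult_iff)
qed

lemma scaled_in_triangle:
  fixes t b r :: real
  assumes "0 \<le> t" "t \<le> r" "0 \<le> b" "b \<le> 1" "0 < r"
  shows "(t * b, b) \<in> triangle r"
  using assms by (simp add: mem_triangle_iff mult_right_mono)

lemma scaled_in_triangle_iff: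
  fixes t b r :: real
  assumes "0 \<le> t" "0 < b" "b \<le> 1" "0 < r"
  shows "(t * b, b) \<in> triangle r \<longleftrightarrow> t \<le> r"
  using assms by (simp add: mem_triangle_iff)

lemma compact_triangle: "compact (triangle r)"
  unfolding triangle_def by (intro finite_imp_compact_convex_hull) simp

lemma triangle_sides:
  fixes r :: real
  assumes "0 < r"
  shows "v \<in> closed_segment (0, 0) (0, 1) \<union> closed_segment (0, 0) (r, 1) \<longleftrightarrow>
    0 \<le> snd v \<and> snd v \<le> 1 \<and> (fst v = 0 \<or> fst v = r * snd v)"
  by (cases v) (auto simp: in_segment)

text \<open>Collapsing the bottom side of the unit square identifies a null-homotopic Moore loop with its
  null-homotopy through loops of constant length.\<close>

lemma quotient_map_triangle:
  "quotient_map (top_of_set ({0..1} \<times> {0..1})) (top_of_set (triangle 1)) (\<lambda>(t, b). (t * b, b))"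
proof (rule continuous_imp_quotient_map)
  have tri: "(t * b, b) \<in> triangle 1" if "0 \<le> t" "t \<le> 1" "0 \<le> b" "b \<le> 1" for t b :: real
    using that by (simp add: scaled_in_triangle)
  show "continuous_map (top_of_set ({0..1} \<times> {0..1})) (top_of_set (triangle 1)) (\<lambda>(t, b). (t * b, b))"
    using tri by (auto simp: continuous_map_in_subtopology case_prod_unfold intro!: continuous_intros)
  show "compact_space (top_of_set ({0..1::real} \<times> {0..1::real}))"
    by (simp add: compact_space_subtopology compact_Times)
  show "Hausdorff_space (top_of_set (triangle 1))"
    by (simp add: Hausdorff_space_subtopology)
  have "p \<in> (\<lambda>(t, b). (t * b, b)) ` ({0..1} \<times> {0..1})" if p: "p \<in> triangle 1" for p
  proof -
    obtain a b where ab: "p = (a, b)" by force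
    note d = mem_triangleD[of a b 1]
    \<comment> \<open>If \<open>b = 0\<close>, then \<open>a = 0\<close> as well, and
      \<open>a / b\<close> takes the default value 0, which still gives a point over the
      vertex.\<close>
    show ?thesis
      using p d by (intro image_eqI[of _ _ "(a / b, b)"]) (auto simp: ab divide_le_eq)
  qed
  then show "(\<lambda>(t, b). (t * b, b)) ` topspace (top_of_set ({0..1} \<times> {0..1})) = topspace (top_of_set (triangle 1))"
    using tri by auto
qed

lemma continuous_map_into_subset_euclidean:
  "continuous_map W euclidean f \<Longrightarrow> (\<And>w. w \<in> topspace W \<Longrightarrow> f w \<in> S) \<Longrightarrow> continuous_map W (top_of_set S) f"
  by (simp add: continuous_map_in_subtopology)

section \<open>The spaces of paths and loops as pullbacks\<close>

lemma moore_arrows_pullback: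
  "moore_arrows X = pullback_topology
     (Sigma (topspace X \<times> topspace X) (\<lambda>(x, y). moore_paths X x y)) (\<lambda>(i, p). (i, rescale_path p))
     (prod_topology (discrete_topology (topspace X \<times> topspace X))
       (prod_topology (top_of_set {0<..}) (compact_open_topology (top_of_set {0..1}) X)))"
  unfolding moore_arrows_def moore_path_space_def case_prod_unfold
  by (rule sum_topology_pullback[unfolded case_prod_unfold])

lemma null_loops_pullback:
  "null_loops X = pullback_topology (Sigma (topspace X) (null_homotopies X)) (\<lambda>(x, p). (x, rescale_null p))
     (prod_topology (discrete_topology (topspace X))
       (prod_topology (top_of_set {0<..}) (compact_open_topology (top_of_set (triangle 1)) X)))"
  unfolding null_loops_def null_homotopy_space_def by (rule sum_topology_pullback)

text \<open>The carrier of a pullback topology contains only points sent into the target space; this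
  shows that no Moore path is lost.\<close>

lemma rescale_path_in:
  assumes "p \<in> moore_paths X x y"
  shows "rescale_path p \<in> topspace (prod_topology (top_of_set {0<..}) (compact_open_topology (top_of_set {0..1}) X))"
proof -
  obtain r \<gamma> where p: "p = (r, \<gamma>)" and r: "0 < r" and \<gamma>: "continuous_map (top_of_set {0..r}) X \<gamma>"
    using assms by (auto simp: moore_paths_def)
  have "continuous_map (top_of_set {0..1}) (top_of_set {0..r}) (\<lambda>t. r * t)"
    using r by (auto simp: continuous_map_in_subtopology mult_left_le intro!: continuous_intros)
  from continuous_map_compose[OF this \<gamma>] have "continuous_map (top_of_set {0..1}) X (\<lambda>t\<in>{0..1}. \<gamma> (r * t))"
    by (rule continuous_map_eq) auto
  then show ?thesis using r by (simp add: p rescale_path_def)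
qed

lemma rescale_null_in:
  assumes "p \<in> null_homotopies X x"
  shows "rescale_null p \<in> topspace (prod_topology (top_of_set {0<..}) (compact_open_topology (top_of_set (triangle 1)) X))"
proof -
  obtain r \<omega> where p: "p = (r, \<omega>)" and r: "0 < r" and \<omega>: "continuous_map (top_of_set (triangle r)) X \<omega>"
    using assms by (auto simp: null_homotopies_def)
  have "(r * fst v, snd v) \<in> triangle r" if "v \<in> triangle 1" for v
    using that r by (cases v) (simp add: mem_triangle_iff)
  then have "continuous_map (top_of_set (triangle 1)) (top_of_set (triangle r)) (\<lambda>v. (r * fst v, snd v))"
    by (auto simp: continuous_map_in_subtopology intro!: continuous_intros)
  from continuous_map_compose[OF this \<omega>]
  have "continuous_map (top_of_set (triangle 1)) X (\<lambda>v\<in>triangle 1. \<omega> (r * fst v, snd v))"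
    by (rule continuous_map_eq) auto
  then show ?thesis using r by (simp add: p rescale_null_def)
qed

lemma topspace_moore_arrows:
  "topspace (moore_arrows X) = Sigma (topspace X \<times> topspace X) (\<lambda>(x, y). moore_paths X x y)"
  unfolding moore_arrows_pullback topspace_pullback_topology
  using rescale_path_in by fastforce

lemma topspace_null_loops: "topspace (null_loops X) = Sigma (topspace X) (null_homotopies X)"
  unfolding null_loops_pullback topspace_pullback_topology
  using rescale_null_in by fastforce

section \<open>Continuous translations to and from strips\<close>

definition arrow_strip :: "'a moore_arrow \<Rightarrow> 'a strip" where
  "arrow_strip a = mk_strip (fst (snd a)) (\<lambda>(t, b). snd (snd a) (max 0 (min (fst (snd a)) t)))"

definition strip_arrow :: "'a strip \<Rightarrow> 'a moore_arrow" where
  "strip_arrow z = ((src z, tgt z), (len z, \<lambda>t\<in>{0..len z}. ev z (t, 1)))"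

definition loop_strip :: "'a null_loop \<Rightarrow> 'a strip" where
  "loop_strip u = mk_strip (fst (snd u)) (\<lambda>(t, b).
     snd (snd u) (max 0 (min (fst (snd u)) t) * max 0 (min 1 b), max 0 (min 1 b)))"

text \<open>At the vertex \<open>(0, 0)\<close> the quotient is \<open>0 / 0 = 0\<close>, which gives the intended value.\<close>

definition strip_loop :: "'a strip \<Rightarrow> 'a null_loop" where
  "strip_loop z = (src z, (len z, \<lambda>v\<in>triangle (len z). ev z (fst v / snd v, snd v)))"

lemma moore_arrowD:
  assumes "a \<in> topspace (moore_arrows X)"
  shows "0 < fst (snd a)" "snd (snd a) 0 = arrow_source a" "snd (snd a) (fst (snd a)) = arrow_target a"
    "snd (snd a) \<in> extensional {0..fst (snd a)}"
  using assms by (auto simp: topspace_moore_arrows moore_paths_def arrow_source_def arrow_target_def)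

lemma null_loopD:
  assumes "u \<in> topspace (null_loops X)"
  shows "0 < fst (snd u)" "snd (snd u) \<in> extensional (triangle (fst (snd u)))"
    "\<And>b. 0 \<le> b \<Longrightarrow> b \<le> 1 \<Longrightarrow> snd (snd u) (0, b) = fst u"
    "\<And>b. 0 \<le> b \<Longrightarrow> b \<le> 1 \<Longrightarrow> snd (snd u) (fst (snd u) * b, b) = fst u"
proof -
  obtain x r \<omega> where u: "u = (x, r, \<omega>)" by (metis prod.collapse)
  have r: "0 < r" and ext: "\<omega> \<in> extensional (triangle r)"
    and side: "\<And>v. v \<in> closed_segment (0, 0) (0, 1) \<union> closed_segment (0, 0) (r, 1) \<Longrightarrow> \<omega> v = x"
    using assms by (auto simp: u topspace_null_loops null_homotopies_def)
  show "0 < fst (snd u)" "snd (snd u) \<in> extensional (triangle (fst (snd u)))" using r ext by (simp_all add: u)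
  show "snd (snd u) (0, b) = fst u" "snd (snd u) (fst (snd u) * b, b) = fst u" if "0 \<le> b" "b \<le> 1" for b
    using that side[unfolded triangle_sides[OF r]] by (simp_all add: u)
qed

lemma arrow_strip:
  assumes "a \<in> topspace (moore_arrows X)"
  shows "strip_shape (arrow_strip a)" "src (arrow_strip a) = arrow_source a"
    "tgt (arrow_strip a) = arrow_target a" "flat_strip (arrow_strip a)" "len (arrow_strip a) = fst (snd a)"
  using moore_arrowD[OF assms] unfolding arrow_strip_def
  by (auto simp: flat_strip_def intro!: strip_shape_mk)

lemma loop_strip:
  assumes "u \<in> topspace (null_loops X)"
  shows "strip_shape (loop_strip u)" "src (loop_strip u) = fst u"
    "tgt (loop_strip u) = fst u" "null_strip (loop_strip u)" "len (loop_strip u) = fst (snd u)"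
  using null_loopD(1,3,4)[OF assms] null_loopD(3)[OF assms, of 0] unfolding loop_strip_def
  by (auto simp: null_strip_def intro!: strip_shape_mk)

lemma continuous_map_arrow_strip: "continuous_map (moore_arrows X) (strips X) arrow_strip"
proof (rule continuous_map_into_strips)
  let ?A = "moore_arrows X"
  note id = continuous_map_id[unfolded id_def, of ?A]
  \<comment> \<open>Applied to the identity, the characterisation of maps into a pullback yields
    continuity of tag, length and rescaled path.\<close>
  note parts = id[unfolded moore_arrows_pullback continuous_map_pullback_topology_iff, folded moore_arrows_pullback,
      unfolded case_prod_unfold continuous_map_pairwise o_def fst_conv snd_conv rescale_path_def]
  have tag: "continuous_map ?A (discrete_topology (topspace X \<times> topspace X)) fst"
    and len: "continuous_map ?A euclideanreal (\<lambda>a. fst (snd a))"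
    and co: "continuous_map ?A (compact_open_topology (top_of_set {0..1}) X)
      (\<lambda>a. \<lambda>t\<in>{0..1}. snd (snd a) (fst (snd a) * t))"
    using parts by (auto simp: continuous_map_in_subtopology)
  show "strip_shape (arrow_strip a)" if "a \<in> topspace ?A" for a using arrow_strip[OF that] by simp
  have "continuous_map ?A (discrete_topology (topspace X)) arrow_source"
    "continuous_map ?A (discrete_topology (topspace X)) arrow_target"
    using tag unfolding prod_topology_discrete_topology continuous_map_pairwise
    by (simp_all add: arrow_source_def[abs_def] arrow_target_def[abs_def] o_def)
  note ends = this
  show "continuous_map ?A (discrete_topology (topspace X)) (\<lambda>a. src (arrow_strip a))"
    by (rule continuous_map_eq[OF ends(1)]) (simp add: arrow_strip)
  show "continuous_map ?A (discrete_topology (topspace X)) (\<lambda>a. tgt (arrow_strip a))"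
    by (rule continuous_map_eq[OF ends(2)]) (simp add: arrow_strip)
  show "continuous_map ?A euclideanreal (\<lambda>a. len (arrow_strip a))" using len by (simp add: arrow_strip_def)
  let ?V = "prod_topology ?A (euclidean :: (real \<times> real) topology)"
  \<comment> \<open>The topology records a path rescaled to the unit interval; \<open>?g\<close> is
    the clamped time on that scale.\<close>
  let ?g = "\<lambda>q::_ \<times> real \<times> real. max 0 (min (fst (snd (fst q))) (fst (snd q))) / fst (snd (fst q))"
  have pos: "0 < fst (snd (fst q))" if "q \<in> topspace ?V" for q
    using that moore_arrowD(1)[of "fst q" X] by auto
  have g: "continuous_map ?V (top_of_set {0..1}) ?g"
  proof (rule continuous_map_into_subset_euclidean)
    show "continuous_map ?V euclideanreal ?g"
      using pos by (intro continuous_map_real_divide continuous_map_real_max continuous_map_real_min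
          continuous_map_of_fst[OF len] continuous_map_fst_snd) fastforce+
    show "?g q \<in> {0..1}" if "q \<in> topspace ?V" for q
      using pos[OF that] by (simp add: divide_le_eq)
  qed
  have "continuous_map ?V X (\<lambda>q. (\<lambda>t\<in>{0..1}. snd (snd (fst q)) (fst (snd (fst q)) * t)) (?g q))"
    by (rule continuous_map_eval_compact_open[OF neighbourhood_base_compact_set continuous_map_of_fst[OF co] g]) simp
  then show "continuous_map ?V X (\<lambda>q. ev (arrow_strip (fst q)) (fst (snd q), snd (snd q)))"
  proof (rule continuous_map_eq)
    fix q assume q: "q \<in> topspace ?V"
    have "?g q \<in> {0..1}" using continuous_map_funspace[OF g] q by (auto simp del: topspace_prod_topology)
    then show "(\<lambda>t\<in>{0..1}. snd (snd (fst q)) (fst (snd (fst q)) * t)) (?g q) =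
        ev (arrow_strip (fst q)) (fst (snd q), snd (snd q))"
      using pos[OF q] by (simp add: arrow_strip_def case_prod_unfold)
  qed
qed

text \<open>In this direction one divides by the positive length but never by the height, so
  evaluating the rescaled null-homotopy at a moving point is enough.\<close>

lemma continuous_map_loop_strip: "continuous_map (null_loops X) (strips X) loop_strip"
proof (rule continuous_map_into_strips)
  let ?U = "null_loops X"
  note id = continuous_map_id[unfolded id_def, of ?U]
  note parts = id[unfolded null_loops_pullback continuous_map_pullback_topology_iff, folded null_loops_pullback,
      unfolded case_prod_unfold continuous_map_pairwise o_def fst_conv snd_conv rescale_null_def]
  have tag: "continuous_map ?U (discrete_topology (topspace X)) fst"
    and len: "continuous_map ?U euclideanreal (\<lambda>u. fst (snd u))"
    and co: "continuous_map ?U (compact_open_topology (top_of_set (triangle 1)) X)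
      (\<lambda>u. \<lambda>v\<in>triangle 1. snd (snd u) (fst (snd u) * fst v, snd v))"
    using parts by (auto simp: continuous_map_in_subtopology)
  show "strip_shape (loop_strip u)" if "u \<in> topspace ?U" for u using loop_strip[OF that] by simp
  show "continuous_map ?U (discrete_topology (topspace X)) (\<lambda>u. src (loop_strip u))"
    "continuous_map ?U (discrete_topology (topspace X)) (\<lambda>u. tgt (loop_strip u))"
    using tag by (auto elim!: continuous_map_eq simp: loop_strip)
  show "continuous_map ?U euclideanreal (\<lambda>u. len (loop_strip u))" using len by (simp add: loop_strip_def)
  let ?V = "prod_topology ?U (euclidean :: (real \<times> real) topology)"
  let ?b = "\<lambda>q::_ \<times> real \<times> real. max 0 (min 1 (snd (snd q)))"
  let ?a = "\<lambda>q::_ \<times> real \<times> real. max 0 (min (fst (snd (fst q))) (fst (snd q))) / fst (snd (fst q))"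
  have pos: "0 < fst (snd (fst q))" if "q \<in> topspace ?V" for q
    using that null_loopD(1)[of "fst q" X] by auto
  have g: "continuous_map ?V (top_of_set (triangle 1)) (\<lambda>q. (?a q * ?b q, ?b q))"
  proof (rule continuous_map_into_subset_euclidean)
    show "continuous_map ?V euclidean (\<lambda>q. (?a q * ?b q, ?b q))"
      using pos by (intro continuous_map_Pair_euclidean continuous_map_real_mult continuous_map_real_divide
          continuous_map_real_max continuous_map_real_min
          continuous_map_of_fst[OF len] continuous_map_fst_snd) fastforce+
    show "(?a q * ?b q, ?b q) \<in> triangle 1" if "q \<in> topspace ?V" for q
    proof -
      have "0 \<le> ?a q" "?a q \<le> 1" using pos[OF that] by (simp_all add: divide_le_eq)
      then show ?thesis by (rule scaled_in_triangle) simp_all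
    qed
  qed
  have "continuous_map ?V X (\<lambda>q. (\<lambda>v\<in>triangle 1. snd (snd (fst q)) (fst (snd (fst q)) * fst v, snd v)) (?a q * ?b q, ?b q))"
    by (rule continuous_map_eval_compact_open[OF neighbourhood_base_compact_set[OF compact_triangle]
          continuous_map_of_fst[OF co] g])
  then show "continuous_map ?V X (\<lambda>q. ev (loop_strip (fst q)) (fst (snd q), snd (snd q)))"
  proof (rule continuous_map_eq)
    fix q assume q: "q \<in> topspace ?V"
    have "(?a q * ?b q, ?b q) \<in> triangle 1"
      using continuous_map_funspace[OF g] q by (auto simp del: topspace_prod_topology)
    then show "(\<lambda>v\<in>triangle 1. snd (snd (fst q)) (fst (snd (fst q)) * fst v, snd v)) (?a q * ?b q, ?b q) =
        ev (loop_strip (fst q)) (fst (snd q), snd (snd q))"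
      using pos[OF q] by (simp add: loop_strip_def case_prod_unfold)
  qed
qed

lemma continuous_map_strips_id:
  "continuous_map (subtopology (strips X) S) (strips X) (\<lambda>z. z)"
  by (intro continuous_map_from_subtopology) simp

lemma strip_arrow_in:
  assumes z: "strip X z"
  shows "strip_arrow z \<in> topspace (moore_arrows X)"
proof -
  note s = strip_shapeD[OF strip_shape_strip[OF z]]
  have "continuous_map euclidean X (ev z)" using z by (simp add: strip_def)
  moreover have "continuous_map (top_of_set {0..len z}) euclidean (\<lambda>t. (t, 1::real))"
    by (auto intro!: continuous_intros)
  ultimately have "continuous_map (top_of_set {0..len z}) X (ev z \<circ> (\<lambda>t. (t, 1)))"
    by (rule continuous_map_compose[rotated])
  then have "continuous_map (top_of_set {0..len z}) X (\<lambda>t\<in>{0..len z}. ev z (t, 1))"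
    by (rule continuous_map_eq) simp
  then show ?thesis
    using s strip_ends_in[OF z] by (simp add: topspace_moore_arrows strip_arrow_def moore_paths_def)
qed

lemma continuous_map_strip_arrow:
  "continuous_map (subtopology (strips X) S) (moore_arrows X) strip_arrow"
  unfolding moore_arrows_pullback continuous_map_pullback_topology_iff case_prod_unfold
    continuous_map_pairwise o_def fst_conv snd_conv prod_topology_discrete_topology rescale_path_def
proof (intro conjI)
  let ?Z = "subtopology (strips X) S"
  note z = continuous_map_strips_id[of X S]
  have "strip_arrow ` topspace ?Z \<subseteq> topspace (moore_arrows X)" using strip_arrow_in by auto
  then show "strip_arrow ` topspace ?Z \<subseteq> Sigma (topspace X \<times> topspace X) (\<lambda>p. moore_paths X (fst p) (snd p))"
    unfolding topspace_moore_arrows case_prod_unfold .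
  show "continuous_map ?Z (discrete_topology (topspace X)) (\<lambda>x. fst (fst (strip_arrow x)))"
    "continuous_map ?Z (discrete_topology (topspace X)) (\<lambda>x. snd (fst (strip_arrow x)))"
    using continuous_map_src[OF z] continuous_map_tgt[OF z] by (simp_all add: strip_arrow_def)
  show "continuous_map ?Z (top_of_set {0<..}) (\<lambda>z. fst (snd (strip_arrow z)))"
    using continuous_map_len[OF z] strip_shapeD(1)[OF strip_shape_strip]
    by (intro continuous_map_into_subset_euclidean) (auto simp: strip_arrow_def)
  show "continuous_map ?Z (compact_open_topology (top_of_set {0..1}) X)
      (\<lambda>z. \<lambda>t\<in>{0..1}. snd (snd (strip_arrow z)) (fst (snd (strip_arrow z)) * t))"
  proof (rule continuous_map_into_compact_open)
    let ?V = "prod_topology ?Z (top_of_set {0..1::real})"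
    have t: "continuous_map ?V euclideanreal snd"
      using continuous_map_snd[of ?Z "top_of_set {0..1::real}"] by (simp add: continuous_map_in_subtopology)
    have "continuous_map ?V X (\<lambda>q. ev (fst q) (len (fst q) * snd q, 1))"
      by (intro continuous_map_ev continuous_map_real_mult t continuous_map_of_fst[OF z]
          continuous_map_of_fst[OF continuous_map_len[OF z]]) simp
    then show "continuous_map ?V X (\<lambda>(z, p). (\<lambda>t\<in>{0..1}. snd (snd (strip_arrow z)) (fst (snd (strip_arrow z)) * t)) p)"
    proof (rule continuous_map_eq)
      fix q assume "q \<in> topspace ?V"
      then have "0 < len (fst q)" "snd q \<in> {0..1}"
        using strip_shapeD(1)[OF strip_shape_strip, of X "fst q"] by auto
      then show "ev (fst q) (len (fst q) * snd q, 1) =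
          (case q of (z, p) \<Rightarrow> (\<lambda>t\<in>{0..1}. snd (snd (strip_arrow z)) (fst (snd (strip_arrow z)) * t)) p)"
        by (simp add: case_prod_unfold strip_arrow_def mult_left_le)
    qed
  qed simp
qed

text \<open>The division by the height has no continuous extension to the vertex. After pulling back
  to the square it cancels, leaving the jointly continuous expression
  \<open>ev z (len z * t, b)\<close>.\<close>

lemma continuous_map_rescaled_strip_loop:
  "continuous_map (subtopology (strips X) {z. null_strip z}) (compact_open_topology (top_of_set (triangle 1)) X)
    (\<lambda>z. \<lambda>v\<in>triangle 1. ev z (len z * fst v / snd v, snd v))"
proof (rule continuous_map_compact_open_quotient[OF _ _ quotient_map_triangle])
  let ?Z = "subtopology (strips X) {z. null_strip z}"
  let ?Q = "top_of_set ({0..1::real} \<times> {0..1::real})"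
  note z = continuous_map_strips_id[of X "{z. null_strip z}"]
  show "compact_space ?Q" by (simp add: compact_space_subtopology compact_Times)
  show "Hausdorff_space (top_of_set (triangle 1))" by (simp add: Hausdorff_space_subtopology)
  show "continuous_map ?Z (compact_open_topology ?Q X)
      (\<lambda>z. \<lambda>p\<in>topspace ?Q. (\<lambda>v\<in>triangle 1. ev z (len z * fst v / snd v, snd v)) (case p of (t, b) \<Rightarrow> (t * b, b)))"
  proof (rule continuous_map_into_compact_open)
    let ?V = "prod_topology ?Z ?Q"
    have "continuous_map ?Q euclidean (\<lambda>p. p)" by simp
    then have t: "continuous_map ?V euclideanreal (\<lambda>q. fst (snd q))" "continuous_map ?V euclideanreal (\<lambda>q. snd (snd q))"
      by (auto intro!: continuous_map_of_snd continuous_intros)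
    have "continuous_map ?V X (\<lambda>q. ev (fst q) (len (fst q) * fst (snd q), snd (snd q)))"
      by (intro continuous_map_ev continuous_map_real_mult t continuous_map_of_fst[OF z]
          continuous_map_of_fst[OF continuous_map_len[OF z]])
    then show "continuous_map ?V X (\<lambda>(z, p). (\<lambda>p\<in>topspace ?Q.
        (\<lambda>v\<in>triangle 1. ev z (len z * fst v / snd v, snd v)) (case p of (t, b) \<Rightarrow> (t * b, b))) p)"
    proof (rule continuous_map_eq)
      fix q assume q: "q \<in> topspace ?V"
      obtain z t b where p: "q = (z, t, b)" by (metis prod.collapse)
      have tb: "t \<in> {0..1}" "b \<in> {0..1}" and null: "null_strip z" using q by (auto simp: p)
      have "(t * b, b) \<in> triangle 1" using tb by (simp add: scaled_in_triangle)
      \<comment> \<open>For \<open>b = 0\<close> nothing cancels and the quotient is 0, but both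
        points lie on the bottom side, which is constant.\<close>
      then show "ev (fst q) (len (fst q) * fst (snd q), snd (snd q)) =
          (case q of (z, p) \<Rightarrow> (\<lambda>p\<in>topspace ?Q.
        (\<lambda>v\<in>triangle 1. ev z (len z * fst v / snd v, snd v)) (case p of (t, b) \<Rightarrow> (t * b, b))) p)"
        using tb null by (cases "b = 0") (simp_all add: p null_strip_def)
    qed
  qed simp
qed simp

lemma strip_loop_in:
  assumes z: "strip X z" and null: "null_strip z"
  shows "strip_loop z \<in> topspace (null_loops X)"
proof -
  note s = strip_shapeD[OF strip_shape_strip[OF z]]
  \<comment> \<open>A continuous map into a mapping space takes values that are themselves
    continuous maps.\<close>
  have "continuous_map (top_of_set (triangle 1)) X (\<lambda>v\<in>triangle 1. ev z (len z * fst v / snd v, snd v))"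
    using continuous_map_funspace[OF continuous_map_rescaled_strip_loop[of X]] z null by auto
  moreover have "continuous_map (top_of_set (triangle (len z))) (top_of_set (triangle 1)) (\<lambda>v. (fst v / len z, snd v))"
    using s(1) by (intro continuous_map_into_subset_euclidean)
      (auto simp: mem_triangle_iff divide_le_eq mult.commute intro!: continuous_intros)
  ultimately have "continuous_map (top_of_set (triangle (len z))) X
      ((\<lambda>v\<in>triangle 1. ev z (len z * fst v / snd v, snd v)) \<circ> (\<lambda>v. (fst v / len z, snd v)))"
    by (rule continuous_map_compose[rotated])
  then have "continuous_map (top_of_set (triangle (len z))) X (\<lambda>v\<in>triangle (len z). ev z (fst v / snd v, snd v))"
    by (rule continuous_map_eq)
      (use s(1) in \<open>auto simp: mem_triangle_iff divide_le_eq mult.commute\<close>)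
  moreover have "(\<lambda>v\<in>triangle (len z). ev z (fst v / snd v, snd v)) v = src z"
    if v: "v \<in> closed_segment (0, 0) (0, 1) \<union> closed_segment (0, 0) (len z, 1)" for v
  proof -
    obtain a b where ab: "v = (a, b)" by force
    have "0 \<le> b" "b \<le> 1" "a = 0 \<or> a = len z * b" using v unfolding triangle_sides[OF s(1)] by (auto simp: ab)
    then show ?thesis
      using s(1-3) null_strip_tgt[OF null] by (cases "b = 0") (auto simp: ab mem_triangle_iff)
  qed
  ultimately show ?thesis
    using s(1) strip_ends_in(1)[OF z] by (simp add: topspace_null_loops strip_loop_def null_homotopies_def)
qed

lemma continuous_map_strip_loop:
  "continuous_map (subtopology (strips X) {z. null_strip z}) (null_loops X) strip_loop"
  unfolding null_loops_pullback continuous_map_pullback_topology_iff case_prod_unfold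
    continuous_map_pairwise o_def fst_conv snd_conv rescale_null_def
proof (intro conjI)
  let ?Z = "subtopology (strips X) {z. null_strip z}"
  note z = continuous_map_strips_id[of X "{z. null_strip z}"]
  show "strip_loop ` topspace ?Z \<subseteq> Sigma (topspace X) (null_homotopies X)"
    unfolding topspace_null_loops[symmetric] using strip_loop_in by auto
  show "continuous_map ?Z (discrete_topology (topspace X)) (\<lambda>x. fst (strip_loop x))"
    using continuous_map_src[OF z] by (simp add: strip_loop_def)
  show "continuous_map ?Z (top_of_set {0<..}) (\<lambda>z. fst (snd (strip_loop z)))"
    using continuous_map_len[OF z] strip_shapeD(1)[OF strip_shape_strip]
    by (intro continuous_map_into_subset_euclidean) (auto simp: strip_loop_def)
  show "continuous_map ?Z (compact_open_topology (top_of_set (triangle 1)) X)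
      (\<lambda>z. \<lambda>v\<in>triangle 1. snd (snd (strip_loop z)) (fst (snd (strip_loop z)) * fst v, snd v))"
    using continuous_map_rescaled_strip_loop
  proof (rule continuous_map_eq)
    fix z assume "z \<in> topspace ?Z"
    then have "0 < len z" using strip_shapeD(1)[OF strip_shape_strip, of X z] by auto
    then show "(\<lambda>v\<in>triangle 1. ev z (len z * fst v / snd v, snd v)) =
        (\<lambda>v\<in>triangle 1. snd (snd (strip_loop z)) (fst (snd (strip_loop z)) * fst v, snd v))"
      by (intro restrict_ext) (auto simp: strip_loop_def mem_triangle_iff)
  qed
qed

section \<open>The translations are mutually inverse\<close>

lemma strip_arrow_arrow_strip:
  assumes "a \<in> topspace (moore_arrows X)"
  shows "strip_arrow (arrow_strip a) = a"
proof -
  obtain x y r \<gamma> where a: "a = ((x, y), r, \<gamma>)" by (metis prod.collapse)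
  have "(\<lambda>t\<in>{0..r}. \<gamma> (max 0 (min r t))) = \<gamma>"
    using moore_arrowD(4)[OF assms] by (auto simp: a fun_eq_iff restrict_def extensional_def)
  then show ?thesis
    using arrow_strip(2,3)[OF assms]
    by (simp add: strip_arrow_def a arrow_source_def arrow_target_def) (simp add: arrow_strip_def)
qed

lemma ev_clamp:
  assumes z: "strip_shape z"
  shows "ev z (max 0 (min (len z) t), b) = ev z (t, b)"
  using strip_shapeD(1-3)[OF z] by (auto simp: max_def min_def)

lemma arrow_strip_strip_arrow:
  assumes z: "strip_shape z" and flat: "flat_strip z"
  shows "arrow_strip (strip_arrow z) = z"
proof -
  have "arrow_strip (strip_arrow z) = mk_strip (len z) (ev z)"
    unfolding arrow_strip_def
  proof (rule mk_strip_cong)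
    fix t b
    have "ev z (t, b) = ev z (t, 1)" using flat unfolding flat_strip_def by blast
    then show "(case (t, b) of (t, b) \<Rightarrow> snd (snd (strip_arrow z)) (max 0 (min (fst (snd (strip_arrow z))) t))) = ev z (t, b)"
      using strip_shapeD(1)[OF z] ev_clamp[OF z, of t 1] by (simp add: strip_arrow_def)
  qed (simp add: strip_arrow_def)
  then show ?thesis using strip_shapeD(5)[OF z] by simp
qed

lemma strip_loop_loop_strip:
  assumes u: "u \<in> topspace (null_loops X)"
  shows "strip_loop (loop_strip u) = u"
proof -
  obtain x r \<omega> where eq: "u = (x, r, \<omega>)" by (metis prod.collapse)
  note r = null_loopD(1)[OF u]
  have "(\<lambda>v\<in>triangle r. \<omega> (max 0 (min r (fst v / snd v)) * max 0 (min 1 (snd v)), max 0 (min 1 (snd v)))) = \<omega>"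
  proof
    fix v :: "real \<times> real"
    obtain a b where v: "v = (a, b)" by force
    show "(\<lambda>v\<in>triangle r. \<omega> (max 0 (min r (fst v / snd v)) * max 0 (min 1 (snd v)), max 0 (min 1 (snd v)))) v = \<omega> v"
    proof (cases "v \<in> triangle r")
      case True
      note d = mem_triangleD[OF True[unfolded v]]
      have "0 < r" using r by (simp add: eq)
      then show ?thesis
        using True d by (cases "b = 0") (simp_all add: v divide_le_eq min_absorb2)
    next
      case False
      then show ?thesis using extensional_arb[OF null_loopD(2)[OF u], of v] by (simp add: eq)
    qed
  qed
  then show ?thesis
    using loop_strip(2)[OF u] by (simp add: strip_loop_def eq) (simp add: loop_strip_def)
qed

lemma loop_strip_strip_loop:
  assumes z: "strip_shape z" and null: "null_strip z"
  shows "loop_strip (strip_loop z) = z"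
proof -
  note s = strip_shapeD[OF z]
  have "loop_strip (strip_loop z) = mk_strip (len z) (ev z)"
    unfolding loop_strip_def
  proof (rule mk_strip_cong)
    fix t b :: real
    let ?t = "max 0 (min (len z) t)" and ?b = "max 0 (min 1 b)"
    have "(?t * ?b, ?b) \<in> triangle (len z)"
      using s(1) by (intro scaled_in_triangle) simp_all
    then have "(case (t, b) of (t, b) \<Rightarrow> snd (snd (strip_loop z)) (max 0 (min (fst (snd (strip_loop z))) t) * max 0 (min 1 b), max 0 (min 1 b)))
      = ev z (?t * ?b / ?b, ?b)"
      by (simp add: strip_loop_def)
    also have "\<dots> = ev z (t, ?b)"
    proof (cases "?b = 0")
      \<comment> \<open>At height 0 the cancellation fails, but both arguments lie on the constant
        bottom side.\<close>
      case True
      then show ?thesis using null by (simp only: null_strip_def)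
    next
      case False
      then show ?thesis using ev_clamp[OF z] by simp
    qed
    also have "\<dots> = ev z (t, b)" by (rule s(4))
    finally show "(case (t, b) of (t, b) \<Rightarrow> snd (snd (strip_loop z)) (max 0 (min (fst (snd (strip_loop z))) t) * max 0 (min 1 b), max 0 (min 1 b)))
      = ev z (t, b)" .
  qed (simp add: strip_loop_def)
  then show ?thesis using s(5) by simp
qed

section \<open>Chains with one gap\<close>

definition single :: "'a strip \<Rightarrow> 'a moore_chain" where
  "single z = (src z, \<lambda>i\<in>{..<1}. z)"

lemma single_simps [simp]: "fst (single z) = src z" "snd (single z) 0 = z"
  by (simp_all add: single_def)

lemma single_in_chains_iff:
  assumes "dots e = 1"
  shows "single z \<in> chains X e \<longleftrightarrow> strip X z \<and> (if linked e 0 then null_strip z else flat_strip z)"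
  using assms strip_ends_in(1)[of X z] by (auto simp: chains_def single_def vert_def)

lemma chain_single:
  assumes "dots e = 1" and w: "w \<in> chains X e"
  shows "w = single (snd w 0)"
proof -
  have "single (snd w 0) \<in> chains X e"
    using chainsD(3,5,6)[OF w, of 0] assms(1) by (simp add: single_in_chains_iff)
  then show ?thesis
    using chainsD(4)[OF w, of 0] assms(1) by (intro chain_eqI[OF w]) simp_all
qed

text \<open>A chain over one gap is determined by its strip, so it suffices to identify
  \<open>W\<close> with the flat or with the null strips. Serves paths and loops alike.\<close>

lemma homeomorphic_map_single:
  assumes e: "dots e = 1" and K: "K = {z. if linked e 0 then null_strip z else flat_strip z}"
    and h: "continuous_map W (strips X) h" "\<And>w. w \<in> topspace W \<Longrightarrow> h w \<in> K"
    and k: "continuous_map (subtopology (strips X) K) W k"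
    and kh: "\<And>w. w \<in> topspace W \<Longrightarrow> k (h w) = w"
    and hk: "\<And>z. strip X z \<Longrightarrow> z \<in> K \<Longrightarrow> h (k z) = z"
  shows "homeomorphic_map W (chain_space X e) (\<lambda>w. single (h w))"
proof -
  have in_chains: "single z \<in> chains X e" if "strip X z" "z \<in> K" for z
    using that by (simp add: single_in_chains_iff[OF e] K)
  have of_chains: "strip X (snd w 0)" "snd w 0 \<in> K" "w = single (snd w 0)" if w: "w \<in> chains X e" for w
    using chainsD(3,5,6)[OF w, of 0] chain_single[OF e w] e by (auto simp: K)
  have "continuous_map W (chain_space X e) (\<lambda>w. single (h w))"
    unfolding continuous_map_chain_space_iff
    using in_chains h continuous_map_strip[OF h(1)] continuous_map_src[OF h(1)] e by auto
  moreover have "continuous_map (chain_space X e) (subtopology (strips X) K) (\<lambda>w. snd w 0)"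
    using of_chains(2) continuous_map_chain(2)[OF continuous_map_id[unfolded id_def], of 0 e X] e
    by (auto simp: continuous_map_in_subtopology)
  from continuous_map_compose[OF this k] have "continuous_map (chain_space X e) W (\<lambda>w. k (snd w 0))"
    by (simp add: o_def)
  ultimately have "homeomorphic_maps W (chain_space X e) (\<lambda>w. single (h w)) (\<lambda>w. k (snd w 0))"
    unfolding homeomorphic_maps_def using kh hk of_chains by auto
  then show ?thesis unfolding homeomorphic_map_maps by blast
qed

lemma shape_simps:
  "dots fat_dot = 0" "dots fat_edge = 1" "dots fat_link = 1" "linked fat_edge 0 = False" "linked fat_link 0 = True"
  by (simp_all add: fat_dot_def fat_edge_def fat_link_def linked_def)

lemma homeomorphic_map_arrows:
  "homeomorphic_map (moore_arrows X) (chain_space X fat_edge) (\<lambda>a. single (arrow_strip a))"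
  by (rule homeomorphic_map_single[where k = strip_arrow and K = "{z. flat_strip z}"])
    (simp_all add: shape_simps continuous_map_arrow_strip continuous_map_strip_arrow arrow_strip
      strip_arrow_arrow_strip arrow_strip_strip_arrow strip_shape_strip)

lemma homeomorphic_map_loops:
  "homeomorphic_map (null_loops X) (chain_space X fat_link) (\<lambda>u. single (loop_strip u))"
  by (rule homeomorphic_map_single[where k = strip_loop and K = "{z. null_strip z}"])
    (simp_all add: shape_simps continuous_map_loop_strip continuous_map_strip_loop loop_strip
      strip_loop_loop_strip loop_strip_strip_loop strip_shape_strip)

lemma homeomorphic_map_objects:
  "homeomorphic_map (moore_objects X) (chain_space X fat_dot) (\<lambda>x. (x, \<lambda>_. undefined))"
proof -
  have "homeomorphic_maps (moore_objects X) (chain_space X fat_dot) (\<lambda>x. (x, \<lambda>_. undefined)) fst"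
    unfolding homeomorphic_maps_def moore_objects_def
    by (subst (1 2) chain_space_dot)
      (auto simp: continuous_map_from_discrete_topology chains_def shape_simps prod_eq_iff fun_eq_iff)
  then show ?thesis unfolding homeomorphic_map_maps by blast
qed

section \<open>Compatibility with the given compositions\<close>

text \<open>Clamping to the total length agrees with clamping inside the factor on either side of
  the seam.\<close>

lemma arrow_strip_concat:
  assumes a: "a \<in> topspace (moore_arrows X)" and b: "b \<in> topspace (moore_arrows X)"
  shows "cat (arrow_strip a) (arrow_strip b) = arrow_strip (arrow_concat a b)"
proof -
  obtain r \<gamma> r' \<gamma>' where p: "snd a = (r, \<gamma>)" "snd b = (r', \<gamma>')" by fastforce
  have r: "0 < r" "0 < r'" using moore_arrowD(1)[OF a] moore_arrowD(1)[OF b] by (simp_all add: p)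
  have m: "max 0 (min (r + r') t) = max 0 t" "max 0 (min r t) = max 0 t" if "t \<le> r" for t
    using that r by auto
  have m': "max 0 (min (r + r') t) = min (r + r') t" "\<not> min (r + r') t \<le> r"
    "max 0 (min r' (t - r)) = min (r + r') t - r" "min r' (t - r) = min (r + r') t - r" if "\<not> t \<le> r" for t
    using that r by auto
  show ?thesis
    unfolding cat_def arrow_strip_def arrow_concat_def concat_path_def p mk_strip_simps prod.case snd_conv fst_conv
    by (rule mk_strip_cong) (use r in \<open>auto simp: m m'\<close>)
qed

text \<open>In the coordinates \<open>(t * b, b)\<close> the shear in the composition of
  null-homotopies becomes the shift of \<open>t\<close> by \<open>r\<close>, and for
  \<open>b > 0\<close> membership in the first triangle becomes \<open>t \<le> r\<close>.\<close>

lemma loop_strip_concat: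
  assumes u: "u \<in> topspace (null_loops X)" and v: "v \<in> topspace (null_loops X)" and uv: "fst u = fst v"
  shows "cat (loop_strip u) (loop_strip v) = loop_strip (null_loop_concat u v)"
proof -
  obtain r \<omega> r' \<omega>' where p: "snd u = (r, \<omega>)" "snd v = (r', \<omega>')" by fastforce
  have r: "0 < r" "0 < r'" using null_loopD(1)[OF u] null_loopD(1)[OF v] by (simp_all add: p)
  have vertex: "\<omega> (0, 0) = \<omega>' (0, 0)" using null_loopD(3)[OF u, of 0] null_loopD(3)[OF v, of 0] uv by (simp add: p)
  have tri: "(max 0 (min (r + r') t) * max 0 (min 1 b), max 0 (min 1 b)) \<in> triangle (r + r')" (is ?tri)
    and eq: "(if t \<le> r then \<omega> (max 0 (min r t) * max 0 (min 1 b), max 0 (min 1 b))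
        else \<omega>' (max 0 (min r' (t - r)) * max 0 (min 1 b), max 0 (min 1 b))) =
      (if (max 0 (min (r + r') t) * max 0 (min 1 b), max 0 (min 1 b)) \<in> triangle r
        then \<omega> (max 0 (min (r + r') t) * max 0 (min 1 b), max 0 (min 1 b))
        else \<omega>' (max 0 (min (r + r') t) * max 0 (min 1 b) - r * max 0 (min 1 b), max 0 (min 1 b)))" (is ?eq)
    for t b :: real
  proof -
    let ?b = "max 0 (min 1 b)" and ?t = "max 0 (min (r + r') t)"
    show ?tri
      using r by (intro scaled_in_triangle) simp_all
    show ?eq
    proof (cases "?b = 0")
      \<comment> \<open>Every \<open>t\<close> now gives the vertex, which belongs to the first
        triangle even when \<open>t\<close> is beyond the seam; the common base point reconciles the
        two branches.\<close>
      case True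
      then show ?thesis using r vertex by (simp add: mem_triangle_iff)
    next
      case False
      then have b: "0 < ?b" by simp
      then have "(?t * ?b, ?b) \<in> triangle r \<longleftrightarrow> ?t \<le> r"
        using r by (intro scaled_in_triangle_iff) simp_all
      also have "\<dots> \<longleftrightarrow> t \<le> r" using r by auto
      finally have iff: "(?t * ?b, ?b) \<in> triangle r \<longleftrightarrow> t \<le> r" .
      show ?thesis
      proof (cases "t \<le> r")
        case True
        then have "max 0 (min r t) = ?t" using r by auto
        then show ?thesis using True by (simp only: iff if_True)
      next
        case False
        then have "max 0 (min r' (t - r)) = ?t - r" using r by auto
        then show ?thesis using False by (simp only: iff if_False left_diff_distrib)
      qed
    qed
  qed
  show ?thesis
    unfolding cat_def loop_strip_def null_loop_concat_def concat_null_def p mk_strip_simps prod.case snd_conv fst_conv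
    by (rule mk_strip_cong) (simp_all only: prod.case restrict_apply' tri eq fst_conv snd_conv)
qed

lemma top_loop_strip:
  assumes u: "u \<in> topspace (null_loops X)"
  shows "top_strip (loop_strip u) = arrow_strip (null_loop_arrow u)"
proof -
  obtain r \<omega> where p: "snd u = (r, \<omega>)" by fastforce
  have "0 < r" using null_loopD(1)[OF u] by (simp add: p)
  then show ?thesis
    unfolding top_strip_def loop_strip_def arrow_strip_def null_loop_arrow_def top_side_def p mk_strip_simps
      prod.case snd_conv fst_conv
    by (intro mk_strip_cong) auto
qed

lemma fair_structure_chain_space:
  "fair_structure (chain_space X) face (moore_objects X) (moore_arrows X) (null_loops X)
     arrow_source arrow_target null_loop_base null_loop_base null_loop_arrow arrow_concat null_loop_concat"
  unfolding fair_structure_def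
proof (intro exI conjI ballI impI)
  show "homeomorphic_map (moore_objects X) (chain_space X fat_dot) (\<lambda>x. (x, \<lambda>_. undefined))"
    by (rule homeomorphic_map_objects)
  show "homeomorphic_map (moore_arrows X) (chain_space X fat_edge) (\<lambda>a. single (arrow_strip a))"
    by (rule homeomorphic_map_arrows)
  show "homeomorphic_map (null_loops X) (chain_space X fat_link) (\<lambda>u. single (loop_strip u))"
    by (rule homeomorphic_map_loops)
  show "face (first_dot fat_edge) (single (arrow_strip a)) = (arrow_source a, \<lambda>_. undefined)"
    "face (last_dot fat_edge) (single (arrow_strip a)) = (arrow_target a, \<lambda>_. undefined)"
    if "a \<in> topspace (moore_arrows X)" for a
    using arrow_strip[OF that] by (simp_all add: face_dot shape_simps)
  show "face (first_dot fat_link) (single (loop_strip u)) = (null_loop_base u, \<lambda>_. undefined)"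
    "face (last_dot fat_link) (single (loop_strip u)) = (null_loop_base u, \<lambda>_. undefined)"
    if "u \<in> topspace (null_loops X)" for u
    using loop_strip[OF that] by (simp_all add: face_dot shape_simps null_loop_base_def)
  show "face edge_to_link (single (loop_strip u)) = single (arrow_strip (null_loop_arrow u))"
    if "u \<in> topspace (null_loops X)" for u
  proof -
    have "face edge_to_link (single (loop_strip u)) = single (top_strip (loop_strip u))"
      using ends_top(1)[OF loop_strip(1)[OF that]]
      by (auto simp: face_def edge_to_link_def shape_simps single_def retop_def fun_eq_iff)
    then show ?thesis using top_loop_strip[OF that] by simp
  qed
next
  fix a b w
  assume a: "a \<in> topspace (moore_arrows X)" and b: "b \<in> topspace (moore_arrows X)"
    and ab: "arrow_target a = arrow_source b" and w: "w \<in> topspace (chain_space X (fat_edge \<dotplus> fat_edge))"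
    and "face (sum_left fat_edge fat_edge) w = single (arrow_strip a) \<and>
      face (sum_right fat_edge fat_edge) w = single (arrow_strip b)"
  then have ends: "fst w = src (arrow_strip a)" "snd w 0 = arrow_strip a" "snd w 1 = arrow_strip b"
    using face_sum[OF fat_shapes(2,2), of w X] by (auto simp: shape_simps)
  let ?z = "cat (arrow_strip a) (arrow_strip b)"
  \<comment> \<open>The composite is already flat, so the flattening in \<open>face\<close> leaves
    it unchanged.\<close>
  have "flat_strip ?z" "strip_shape ?z" "src ?z = src (arrow_strip a)"
    using arrow_strip[OF a] arrow_strip[OF b] ab
    by (auto simp: strip_shape_cat src_cat) (auto simp: flat_strip_def cat_def)
  then have "face edge_ends w = single ?z"
    using ends by (auto simp: face_def edge_ends_def shape_simps single_def retop_def top_flat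
        numeral_2_eq_2 fun_eq_iff)
  then show "face edge_ends w = single (arrow_strip (arrow_concat a b))"
    using arrow_strip_concat[OF a b] by simp
next
  fix u v w
  assume u: "u \<in> topspace (null_loops X)" and v: "v \<in> topspace (null_loops X)"
    and uv: "null_loop_base u = null_loop_base v" and w: "w \<in> topspace (chain_space X (fat_link \<dotplus> fat_link))"
    and "face (sum_left fat_link fat_link) w = single (loop_strip u) \<and>
      face (sum_right fat_link fat_link) w = single (loop_strip v)"
  then have ends: "fst w = src (loop_strip u)" "snd w 0 = loop_strip u" "snd w 1 = loop_strip v"
    using face_sum[OF fat_shapes(3,3), of w X] by (auto simp: shape_simps)
  let ?z = "cat (loop_strip u) (loop_strip v)"
  have "src ?z = src (loop_strip u)" using loop_strip[OF u] by (simp add: src_cat)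
  then have "face link_ends w = single ?z"
    using ends by (auto simp: face_def link_ends_def shape_simps single_def retop_def
        numeral_2_eq_2 fun_eq_iff)
  then show "face link_ends w = single (loop_strip (null_loop_concat u v))"
    using loop_strip_concat[OF u v] uv by (simp add: null_loop_base_def)
qed

theorem proposition8p3:
  fixes X :: "'a topology"
  shows "\<exists>(Y :: fat_obj \<Rightarrow> 'a moore_chain topology) (F :: fat_arr \<Rightarrow> 'a moore_chain \<Rightarrow> 'a moore_chain).
    fair_category Y F \<and>
    fair_structure Y F (moore_objects X) (moore_arrows X) (null_loops X)
      arrow_source arrow_target null_loop_base null_loop_base null_loop_arrow
      arrow_concat null_loop_concat"
  using fair_category_chain_space fair_structure_chain_space by blast

end
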